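(* Let $\Psi$ be the quiver with four vertices $\tilde a_{1,1},\tilde a_{2,2},\tilde a_{3,3},\tilde a_{4,4}$ and four arrows $$\sigma:\tilde a_{2,2}\to\tilde a_{4,4},\quad \vartheta:\tilde a_{4,4}\to\tilde a_{2,2},\quad \rho:\tilde a_{4,4}\to\tilde a_{1,1},\quad \pi:\tilde a_{1,1}\to\tilde a_{4,4},$$ and let $I=(\pi\rho,\ \sigma\vartheta,\ \pi\vartheta,\ \sigma\rho)$, an ideal of the path algebra $\mathbb Q\Psi$. There is an isomorphism of $\mathbb Q$-algebras $A'\to\mathbb Q\Psi/I$ with $$a_{i,i}\mapsto\tilde a_{i,i}+I\ (i=1,2,3,4),\quad a_{4,1}\mapsto\rho+I,\quad a_{1,4}\mapsto\pi+I,\quad a_{4,2}\mapsto\vartheta+I,\quad a_{2,4}\mapsto\sigma+I.$$ In particular, $\mathbb Q\Psi/I$ is Morita equivalent to $A\cong\mathrm{B}_{\mathbb Q}(S_3,S_3)$.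
   Context: **Double Burnside algebra.** For a finite group $G$ and a commutative ring $R$, $\mathrm{B}_R(G,G)$ is the $R$-module generated by the isomorphism classes $[M]$ of finite $(G,G)$-bisets (finite sets with commuting left and right $G$-actions) modulo $[M\sqcup N]=[M]+[N]$, with multiplication induced by $[M]\cdot[N]=[M\times_G N]$, where $M\times_G N$ is the set of $G$-orbits on $M\times N$ under $g(m,n)=(mg^{-1},gn)$, with biset structure induced by $h(m,n)p=(hm,np)$. **The algebra $A$.** Let $\mathbb Q[\bar\eta,\bar\xi]=\mathbb Q[\eta,\xi]/(\eta^2,\eta\xi,\xi^2)$, with $\mathbb Q$-basis $1,\bar\eta,\bar\xi$. $A$ consists of arrays $[a_{i,j}]_{i,j\in\{1,2,3,4\}}$ with $a_{i,j}\in A_{i,j}$, where $A_{1,1}=\mathbb Q^{3\times3}$, $A_{1,4}=\mathbb Q^{3\times1}$, $A_{4,1}=\mathbb Q^{1\times3}$, $A_{2,2}=A_{2,4}=A_{3,3}=A_{4,2}=\mathbb Q$, $A_{4,4}=\mathbb Q[\bar\eta,\bar\xi]$, and all other $A_{i,j}=0$. Addition is entrywise; the product of $[a_{i,j}]$ and $[a'_{i,j}]$ has $(i,j)$ entry $\sum_r\alpha_{i,r,j}(a_{i,r},a'_{r,j})$, where the bilinear maps $\alpha_{i,j,k}:A_{i,j}\times A_{j,k}\to A_{i,k}$ are: zero whenever one of $A_{i,j},A_{j,k},A_{i,k}$ is zero; $\alpha_{1,4,1}=0$, $\alpha_{2,4,2}=0$; $\alpha_{4,1,4}(x,y)=(xy)\bar\eta$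 (row times column); $\alpha_{4,2,4}(x,y)=xy(\bar\xi-12\bar\eta)$; $\alpha_{4,4,4}$ is multiplication in $\mathbb Q[\bar\eta,\bar\xi]$; in $\alpha_{1,4,4},\alpha_{2,4,4},\alpha_{4,4,1},\alpha_{4,4,2}$ an element $a+b\bar\eta+c\bar\xi\in A_{4,4}$ acts as multiplication by its constant term $a$; and $\alpha_{1,1,1},\alpha_{1,1,4},\alpha_{4,1,1},\alpha_{2,2,2},\alpha_{2,2,4},\alpha_{4,2,2},\alpha_{3,3,3}$ are the usual (matrix) products. **The elements $a_{i,j}$ and the algebra $A'$.** The following elements of $A$ have only one nonzero block: $a_{1,1}$ has $(1,1)$ block the $3\times3$ matrix unit with $1$ in position $(1,1)$; $a_{2,2},a_{3,3},a_{4,4}$ have block $1$ in position $(2,2),(3,3),(4,4)$ respectively; $a_{1,4}$ has $(1,4)$ block $(1,0,0)^{t}$; $a_{4,1}$ has $(4,1)$ block $(1,0,0)$; $a_{2,4}$ has $(2,4)$ block $1$; $a_{4,2}$ has $(4,2)$ block $1$. Put $f=a_{1,1}+a_{2,2}+a_{3,3}+a_{4,4}$ (an idempotent) and $A'=fAf$. **Path algebra convention.** Paths are composed from left to right: $\alpha\beta$ means first the arrow $\alpha$, then $\beta$; an arrow $\alpha:x\to y$ satisfies $x\alpha y=\alpha$, where the vertices also denote the corresponding idempotents (trivial paths). Parentheses denote the two-sided ideal generated. *)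

theory Defs
  imports
    "HOL-Analysis.Cartesian_Space"
    "HOL-Computational_Algebra.Polynomial"
    "HOL-Library.Poly_Mapping"
    "HOL-Library.Numeral_Type"
    "HOL-Library.FuncSet"
    "Graph_Theory.Arc_Walk"
    "HOL-Algebra.Sym_Groups"
    "HOL-Algebra.QuotRing"
    "HOL-Algebra.Module"
begin

hide_const (open) Polynomial.smult

section \<open>Associative algebras\<close>

text \<open>
  The library's \<open>algebra\<close> locale is restricted to commutative algebras. Here an algebra is carried
  by the same record type, with coefficients in a type \<open>'k\<close>.
\<close>

locale assoc_algebra = ring A for A :: "('k::comm_ring_1, 'a, 'm) module_scheme" (structure) +
  assumes smult_closed: "x \<in> carrier A \<Longrightarrow> c \<odot> x \<in> carrier A"
    and smult_add_left: "x \<in> carrier A \<Longrightarrow> (c + d) \<odot> x = c \<odot> x \<oplus> d \<odot> x"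
    and smult_add_right: "x \<in> carrier A \<Longrightarrow> y \<in> carrier A \<Longrightarrow> c \<odot> (x \<oplus> y) = c \<odot> x \<oplus> c \<odot> y"
    and smult_smult: "x \<in> carrier A \<Longrightarrow> (c * d) \<odot> x = c \<odot> (d \<odot> x)"
    and smult_1: "x \<in> carrier A \<Longrightarrow> 1 \<odot> x = x"
    and smult_mult_left: "x \<in> carrier A \<Longrightarrow> y \<in> carrier A \<Longrightarrow> (c \<odot> x) \<otimes> y = c \<odot> (x \<otimes> y)"
    and smult_mult_right: "x \<in> carrier A \<Longrightarrow> y \<in> carrier A \<Longrightarrow> x \<otimes> (c \<odot> y) = c \<odot> (x \<otimes> y)"

definition algebra_iso ::
  "('k::comm_ring_1, 'a, 'm) module_scheme \<Rightarrow> ('k, 'b, 'n) module_scheme \<Rightarrow> ('a \<Rightarrow> 'b) set"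
  where "algebra_iso A B = {h \<in> ring_iso A B. assoc_algebra A \<and> assoc_algebra B \<and>
    (\<forall>c. \<forall>x\<in>carrier A. h (c \<odot>\<^bsub>A\<^esub> x) = c \<odot>\<^bsub>B\<^esub> h x)}"

definition corner_algebra ::
  "('k, 'a, 'm) module_scheme \<Rightarrow> 'a \<Rightarrow> ('k, 'a, 'm) module_scheme"
  where "corner_algebra A e =
    A\<lparr>carrier := {e \<otimes>\<^bsub>A\<^esub> x \<otimes>\<^bsub>A\<^esub> e | x. x \<in> carrier A}, one := e\<rparr>"

definition quotient_algebra ::
  "('k, 'a, 'm) module_scheme \<Rightarrow> 'a set \<Rightarrow> ('k, 'a set) module"
  where "quotient_algebra A I =
    ring.extend (A Quot I) (module.fields (\<lambda>c X. \<Union>x\<in>X. I +>\<^bsub>A\<^esub> (c \<odot>\<^bsub>A\<^esub> x)))"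

text \<open>
  The free module on a set \<open>B\<close>, with the bilinear extension of a partial multiplication on \<open>B\<close>;
  undefined products of basis elements are 0.
\<close>

definition bilinear_extension ::
  "('b \<Rightarrow> 'b \<Rightarrow> 'b option) \<Rightarrow> ('b \<Rightarrow>\<^sub>0 'k::comm_ring_1) \<Rightarrow> ('b \<Rightarrow>\<^sub>0 'k) \<Rightarrow> ('b \<Rightarrow>\<^sub>0 'k)"
  where "bilinear_extension m f g =
    (\<Sum>p\<in>Poly_Mapping.keys f. \<Sum>q\<in>Poly_Mapping.keys g.
      case m p q of None \<Rightarrow> 0
      | Some r \<Rightarrow> Poly_Mapping.single r (Poly_Mapping.lookup f p * Poly_Mapping.lookup g q))"

definition basis_algebra ::
  "'b set \<Rightarrow> ('b \<Rightarrow> 'b \<Rightarrow> 'b option) \<Rightarrow> ('b \<Rightarrow>\<^sub>0 'k) \<Rightarrow> ('k::comm_ring_1, 'b \<Rightarrow>\<^sub>0 'k) module"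
  where "basis_algebra B m e =
    \<lparr>carrier = {f. Poly_Mapping.keys f \<subseteq> B}, mult = bilinear_extension m, one = e,
     zero = 0, add = (+), smult = (\<lambda>c. Poly_Mapping.map ((*) c))\<rparr>"


section \<open>Path algebras\<close>

text \<open>
  A path is stored with its start and end vertex, so that there is one trivial path for each vertex.
  Paths are composed from left to right.
\<close>

type_synonym ('v, 'e) qpath = "'v \<times> 'e list \<times> 'v"

definition quiver_paths :: "('v, 'e) pre_digraph \<Rightarrow> ('v, 'e) qpath set"
  where "quiver_paths Q = {(u, p, v). pre_digraph.awalk Q u p v}"

fun path_comp :: "('v, 'e) qpath \<Rightarrow> ('v, 'e) qpath \<Rightarrow> ('v, 'e) qpath option"
  where "path_comp (u, p, v) (v', q, w) = (if v = v' then Some (u, p @ q, w) else None)"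

definition trivial_path :: "'v \<Rightarrow> (('v, 'e) qpath \<Rightarrow>\<^sub>0 'k::comm_ring_1)"
  where "trivial_path v = Poly_Mapping.single (v, [], v) 1"

definition arrow_path :: "('v, 'e) pre_digraph \<Rightarrow> 'e \<Rightarrow> (('v, 'e) qpath \<Rightarrow>\<^sub>0 'k::comm_ring_1)"
  where "arrow_path Q e = Poly_Mapping.single (tail Q e, [e], head Q e) 1"

definition path_algebra ::
  "('v, 'e) pre_digraph \<Rightarrow> ('k::comm_ring_1, ('v, 'e) qpath \<Rightarrow>\<^sub>0 'k) module"
  where "path_algebra Q =
    basis_algebra (quiver_paths Q) path_comp (\<Sum>v\<in>verts Q. trivial_path v)"

datatype psi_vertex = v11 | v22 | v33 | v44

datatype psi_arrow = ar_sigma | ar_vartheta | ar_rho | ar_pi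

definition Psi :: "(psi_vertex, psi_arrow) pre_digraph"
  where "Psi =
    \<lparr>verts = {v11, v22, v33, v44},
     arcs = {ar_sigma, ar_vartheta, ar_rho, ar_pi},
     tail = (\<lambda>a. case a of ar_sigma \<Rightarrow> v22 | ar_vartheta \<Rightarrow> v44 | ar_rho \<Rightarrow> v44 | ar_pi \<Rightarrow> v11),
     head = (\<lambda>a. case a of ar_sigma \<Rightarrow> v44 | ar_vartheta \<Rightarrow> v22 | ar_rho \<Rightarrow> v11 | ar_pi \<Rightarrow> v44)\<rparr>"

definition QPsi :: "(rat, (psi_vertex, psi_arrow) qpath \<Rightarrow>\<^sub>0 rat) module"
  where "QPsi = path_algebra Psi"

definition I_Psi :: "((psi_vertex, psi_arrow) qpath \<Rightarrow>\<^sub>0 rat) set"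
  where "I_Psi = Idl\<^bsub>QPsi\<^esub>
    {arrow_path Psi ar_pi \<otimes>\<^bsub>QPsi\<^esub> arrow_path Psi ar_rho,
     arrow_path Psi ar_sigma \<otimes>\<^bsub>QPsi\<^esub> arrow_path Psi ar_vartheta,
     arrow_path Psi ar_pi \<otimes>\<^bsub>QPsi\<^esub> arrow_path Psi ar_vartheta,
     arrow_path Psi ar_sigma \<otimes>\<^bsub>QPsi\<^esub> arrow_path Psi ar_rho}"


section \<open>The algebra \<open>A\<close>\<close>

text \<open>
  \<open>\<rat>[\<eta>, \<xi>]\<close> is represented as \<open>\<rat>[\<eta>][\<xi>]\<close>: the inner polynomial variable is \<open>\<eta>\<close>, the outer one \<open>\<xi>\<close>.
\<close>

definition eta_poly :: "rat poly poly" where "eta_poly = [:[:0, 1:]:]"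

definition xi_poly :: "rat poly poly" where "xi_poly = [:0, 1:]"

definition eta_xi_ideal :: "rat poly poly set"
  where "eta_xi_ideal =
    {a * eta_poly\<^sup>2 + b * (eta_poly * xi_poly) + c * xi_poly\<^sup>2 | a b c. True}"

lemma eta_xi_ideal_0: "0 \<in> eta_xi_ideal"
  unfolding eta_xi_ideal_def mem_Collect_eq by (intro exI[of _ 0]) simp

lemma eta_xi_ideal_add: "p \<in> eta_xi_ideal \<Longrightarrow> q \<in> eta_xi_ideal \<Longrightarrow> p + q \<in> eta_xi_ideal"
proof -
  assume "p \<in> eta_xi_ideal" "q \<in> eta_xi_ideal"
  then obtain a b c a' b' c' where
    p: "p = a * eta_poly\<^sup>2 + b * (eta_poly * xi_poly) + c * xi_poly\<^sup>2" and
    q: "q = a' * eta_poly\<^sup>2 + b' * (eta_poly * xi_poly) + c' * xi_poly\<^sup>2"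
    unfolding eta_xi_ideal_def by blast
  have "p + q = (a + a') * eta_poly\<^sup>2 + (b + b') * (eta_poly * xi_poly) + (c + c') * xi_poly\<^sup>2"
    unfolding p q by (simp add: algebra_simps)
  then show ?thesis unfolding eta_xi_ideal_def by blast
qed

lemma eta_xi_ideal_mult: "q \<in> eta_xi_ideal \<Longrightarrow> p * q \<in> eta_xi_ideal"
proof -
  assume "q \<in> eta_xi_ideal"
  then obtain a b c where
    q: "q = a * eta_poly\<^sup>2 + b * (eta_poly * xi_poly) + c * xi_poly\<^sup>2"
    unfolding eta_xi_ideal_def by blast
  have "p * q = (p * a) * eta_poly\<^sup>2 + (p * b) * (eta_poly * xi_poly) + (p * c) * xi_poly\<^sup>2"
    unfolding q by (simp add: algebra_simps)
  then show ?thesis unfolding eta_xi_ideal_def by blast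
qed

lemma eta_xi_ideal_uminus: "p \<in> eta_xi_ideal \<Longrightarrow> - p \<in> eta_xi_ideal"
  using eta_xi_ideal_mult[of p "-1"] by simp

lemma eta_xi_ideal_const_term: "p \<in> eta_xi_ideal \<Longrightarrow> coeff (coeff p 0) 0 = 0"
  by (auto simp: eta_xi_ideal_def eta_poly_def xi_poly_def power2_eq_square coeff_mult)

definition eta_xi_rel :: "rat poly poly \<Rightarrow> rat poly poly \<Rightarrow> bool"
  where "eta_xi_rel p q \<longleftrightarrow> p - q \<in> eta_xi_ideal"

quotient_type eta_xi_ring = "rat poly poly" / eta_xi_rel
proof (rule equivpI)
  show "reflp eta_xi_rel"
    by (simp add: reflp_def eta_xi_rel_def eta_xi_ideal_0)
  show "symp eta_xi_rel"
    unfolding symp_def eta_xi_rel_def using eta_xi_ideal_uminus by fastforce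
  show "transp eta_xi_rel"
    unfolding transp_def eta_xi_rel_def using eta_xi_ideal_add by fastforce
qed

instantiation eta_xi_ring :: comm_ring_1
begin

lift_definition zero_eta_xi_ring :: eta_xi_ring is 0 .

lift_definition one_eta_xi_ring :: eta_xi_ring is 1 .

lift_definition plus_eta_xi_ring :: "eta_xi_ring \<Rightarrow> eta_xi_ring \<Rightarrow> eta_xi_ring" is "(+)"
  unfolding eta_xi_rel_def by (metis add_diff_add eta_xi_ideal_add)

lift_definition uminus_eta_xi_ring :: "eta_xi_ring \<Rightarrow> eta_xi_ring" is uminus
  unfolding eta_xi_rel_def by (metis eta_xi_ideal_uminus minus_diff_minus)

lift_definition minus_eta_xi_ring :: "eta_xi_ring \<Rightarrow> eta_xi_ring \<Rightarrow> eta_xi_ring" is "(-)"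
proof -
  fix p p' q q' :: "rat poly poly"
  assume "eta_xi_rel p p'" "eta_xi_rel q q'"
  then have "(p - p') + - (q - q') \<in> eta_xi_ideal"
    unfolding eta_xi_rel_def by (intro eta_xi_ideal_add eta_xi_ideal_uminus)
  then show "eta_xi_rel (p - q) (p' - q')"
    unfolding eta_xi_rel_def by (simp add: algebra_simps)
qed

lift_definition times_eta_xi_ring :: "eta_xi_ring \<Rightarrow> eta_xi_ring \<Rightarrow> eta_xi_ring" is "(*)"
proof -
  fix p p' q q' :: "rat poly poly"
  assume "eta_xi_rel p p'" "eta_xi_rel q q'"
  then have "q * (p - p') + p' * (q - q') \<in> eta_xi_ideal"
    unfolding eta_xi_rel_def by (intro eta_xi_ideal_add eta_xi_ideal_mult)
  then show "eta_xi_rel (p * q) (p' * q')"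
    unfolding eta_xi_rel_def by (simp add: algebra_simps)
qed

instance
proof
  have "\<not> eta_xi_rel 0 1"
    unfolding eta_xi_rel_def using eta_xi_ideal_const_term[of "0 - 1"] by auto
  then show "(0::eta_xi_ring) \<noteq> 1"
    by transfer
qed (transfer; simp add: eta_xi_rel_def eta_xi_ideal_0 algebra_simps)+

end

lift_definition eta_bar :: eta_xi_ring is eta_poly .

lift_definition xi_bar :: eta_xi_ring is xi_poly .

lift_definition eta_xi_of_rat :: "rat \<Rightarrow> eta_xi_ring" is "\<lambda>c. [:[:c:]:]" .

text \<open>The coefficient \<open>a\<close> of \<open>a + b\<eta> + c\<xi>\<close>.\<close>

lift_definition const_term :: "eta_xi_ring \<Rightarrow> rat" is "\<lambda>p. coeff (coeff p 0) 0"
proof -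
  fix p q :: "rat poly poly"
  assume "eta_xi_rel p q"
  then show "coeff (coeff p 0) 0 = coeff (coeff q 0) 0"
    unfolding eta_xi_rel_def using eta_xi_ideal_const_term[of "p - q"] by simp
qed

text \<open>
  The field \<open>bij\<close> is the entry in position \<open>(i, j)\<close>; entries in the zero blocks are omitted.
\<close>

datatype A_array = A_array
  (b11: "rat^3^3") (b14: "rat^1^3") (b41: "rat^3^1")
  (b22: rat) (b24: rat) (b42: rat) (b33: rat) (b44: eta_xi_ring)

definition scale_matrix :: "rat \<Rightarrow> rat^'n^'m \<Rightarrow> rat^'n^'m"
  where "scale_matrix c M = (\<chi> i j. c * M $ i $ j)"

fun A_add :: "A_array \<Rightarrow> A_array \<Rightarrow> A_array"
  where "A_add (A_array x11 x14 x41 x22 x24 x42 x33 x44) (A_array y11 y14 y41 y22 y24 y42 y33 y44) =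
    A_array (x11 + y11) (x14 + y14) (x41 + y41)
      (x22 + y22) (x24 + y24) (x42 + y42) (x33 + y33) (x44 + y44)"

fun A_smult :: "rat \<Rightarrow> A_array \<Rightarrow> A_array"
  where "A_smult c (A_array x11 x14 x41 x22 x24 x42 x33 x44) =
    A_array (scale_matrix c x11) (scale_matrix c x14) (scale_matrix c x41)
      (c * x22) (c * x24) (c * x42) (c * x33) (eta_xi_of_rat c * x44)"

text \<open>
  Entry \<open>(i, j)\<close> is the sum over \<open>r\<close> of the products of the entries \<open>(i, r)\<close> and \<open>(r, j)\<close>.
  There are no terms \<open>x14 ** y41\<close> in \<open>b11\<close> and \<open>x24 * y42\<close> in \<open>b22\<close>, as
  \<open>\<alpha>\<^sub>1\<^sub>4\<^sub>1 = 0\<close> and \<open>\<alpha>\<^sub>2\<^sub>4\<^sub>2 = 0\<close>.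
\<close>

fun A_mult :: "A_array \<Rightarrow> A_array \<Rightarrow> A_array"
  where "A_mult (A_array x11 x14 x41 x22 x24 x42 x33 x44) (A_array y11 y14 y41 y22 y24 y42 y33 y44) =
    A_array
      (x11 ** y11)
      (x11 ** y14 + scale_matrix (const_term y44) x14)
      (x41 ** y11 + scale_matrix (const_term x44) y41)
      (x22 * y22)
      (x22 * y24 + x24 * const_term y44)
      (x42 * y22 + const_term x44 * y42)
      (x33 * y33)
      (eta_xi_of_rat ((x41 ** y14) $ 1 $ 1) * eta_bar
        + eta_xi_of_rat (x42 * y24) * (xi_bar - 12 * eta_bar) + x44 * y44)"

definition A_alg :: "(rat, A_array) module"
  where "A_alg =
    \<lparr>carrier = UNIV, mult = A_mult, one = A_array (mat 1) 0 0 1 0 0 1 1,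
     zero = A_array 0 0 0 0 0 0 0 0, add = A_add, smult = A_smult\<rparr>"

definition a11 :: A_array
  where "a11 = A_array (\<chi> i j. if i = 1 \<and> j = 1 then 1 else 0) 0 0 0 0 0 0 0"

definition a22 :: A_array where "a22 = A_array 0 0 0 1 0 0 0 0"

definition a33 :: A_array where "a33 = A_array 0 0 0 0 0 0 1 0"

definition a44 :: A_array where "a44 = A_array 0 0 0 0 0 0 0 1"

definition a14 :: A_array
  where "a14 = A_array 0 (\<chi> i j. if i = 1 then 1 else 0) 0 0 0 0 0 0"

definition a41 :: A_array
  where "a41 = A_array 0 0 (\<chi> i j. if j = 1 then 1 else 0) 0 0 0 0 0"

definition a24 :: A_array where "a24 = A_array 0 0 0 0 1 0 0 0"

definition a42 :: A_array where "a42 = A_array 0 0 0 0 0 1 0 0"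

definition f_idem :: A_array
  where "f_idem = a11 \<oplus>\<^bsub>A_alg\<^esub> a22 \<oplus>\<^bsub>A_alg\<^esub> a33 \<oplus>\<^bsub>A_alg\<^esub> a44"

definition A'_alg :: "(rat, A_array) module"
  where "A'_alg = corner_algebra A_alg f_idem"


section \<open>The double Burnside algebra\<close>

record ('g, 'x) biset =
  points :: "'x set"
  lact :: "'g \<Rightarrow> 'x \<Rightarrow> 'x"
  ract :: "'x \<Rightarrow> 'g \<Rightarrow> 'x"

locale finite_biset = group G for G :: "('g, 'm) monoid_scheme" (structure) +
  fixes M :: "('g, 'x) biset"
  assumes finite_points: "finite (points M)"
    and lact_closed: "g \<in> carrier G \<Longrightarrow> x \<in> points M \<Longrightarrow> lact M g x \<in> points M"
    and ract_closed: "g \<in> carrier G \<Longrightarrow> x \<in> points M \<Longrightarrow> ract M x g \<in> points M"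
    and lact_one: "x \<in> points M \<Longrightarrow> lact M \<one> x = x"
    and ract_one: "x \<in> points M \<Longrightarrow> ract M x \<one> = x"
    and lact_mult: "g \<in> carrier G \<Longrightarrow> h \<in> carrier G \<Longrightarrow> x \<in> points M \<Longrightarrow>
      lact M (g \<otimes> h) x = lact M g (lact M h x)"
    and ract_mult: "g \<in> carrier G \<Longrightarrow> h \<in> carrier G \<Longrightarrow> x \<in> points M \<Longrightarrow>
      ract M x (g \<otimes> h) = ract M (ract M x g) h"
    and lact_ract: "g \<in> carrier G \<Longrightarrow> h \<in> carrier G \<Longrightarrow> x \<in> points M \<Longrightarrow>
      ract M (lact M g x) h = lact M g (ract M x h)"

definition biset_isomorphic ::
  "('g, 'm) monoid_scheme \<Rightarrow> ('g, 'x) biset \<Rightarrow> ('g, 'y) biset \<Rightarrow> bool"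
  where "biset_isomorphic G M N \<longleftrightarrow>
    (\<exists>h. bij_betw h (points M) (points N) \<and>
      (\<forall>g\<in>carrier G. \<forall>x\<in>points M. h (lact M g x) = lact N g (h x) \<and> h (ract M x g) = ract N (h x) g))"

definition biset_sum :: "('g, 'x) biset \<Rightarrow> ('g, 'y) biset \<Rightarrow> ('g, 'x + 'y) biset"
  where "biset_sum M N =
    \<lparr>points = points M <+> points N,
     lact = (\<lambda>g. map_sum (lact M g) (lact N g)),
     ract = (\<lambda>z g. map_sum (\<lambda>x. ract M x g) (\<lambda>y. ract N y g) z)\<rparr>"

definition middle_orbit ::
  "('g, 'm) monoid_scheme \<Rightarrow> ('g, 'x) biset \<Rightarrow> ('g, 'y) biset \<Rightarrow> 'x \<times> 'y \<Rightarrow> ('x \<times> 'y) set"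
  where "middle_orbit G M N z =
    (\<lambda>g. (ract M (fst z) (inv\<^bsub>G\<^esub> g), lact N g (snd z))) ` carrier G"

definition biset_prod ::
  "('g, 'm) monoid_scheme \<Rightarrow> ('g, 'x) biset \<Rightarrow> ('g, 'y) biset \<Rightarrow> ('g, ('x \<times> 'y) set) biset"
  where "biset_prod G M N =
    \<lparr>points = middle_orbit G M N ` (points M \<times> points N),
     lact = (\<lambda>h X. (\<lambda>(x, y). (lact M h x, y)) ` X),
     ract = (\<lambda>X p. (\<lambda>(x, y). (x, ract N y p)) ` X)\<rparr>"

definition regular_biset :: "('g, 'm) monoid_scheme \<Rightarrow> ('g, 'g) biset"
  where "regular_biset G = \<lparr>points = carrier G, lact = mult G, ract = mult G\<rparr>"

text \<open>
  Every finite biset is isomorphic to one with points in \<^typ>\<open>nat\<close>, so isomorphism classes are formed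
  within that type. The argument of \<open>biset_class\<close> may have points in any type.
\<close>

definition biset_class :: "('g, 'm) monoid_scheme \<Rightarrow> ('g, 'x) biset \<Rightarrow> ('g, nat) biset set"
  where "biset_class G M = {N. finite_biset G N \<and> biset_isomorphic G M N}"

definition biset_classes :: "('g, 'm) monoid_scheme \<Rightarrow> ('g, nat) biset set set"
  where "biset_classes G = {biset_class G M | M :: ('g, nat) biset. finite_biset G M}"

definition class_prod ::
  "('g, 'm) monoid_scheme \<Rightarrow> ('g, nat) biset set \<Rightarrow> ('g, nat) biset set \<Rightarrow> ('g, nat) biset set"
  where "class_prod G X Y = biset_class G (biset_prod G (SOME M. M \<in> X) (SOME N. N \<in> Y))"

definition biset_class_algebra ::
  "('g, 'm) monoid_scheme \<Rightarrow> ('k::comm_ring_1, ('g, nat) biset set \<Rightarrow>\<^sub>0 'k) module"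
  where "biset_class_algebra G =
    basis_algebra (biset_classes G) (\<lambda>X Y. Some (class_prod G X Y))
      (Poly_Mapping.single (biset_class G (regular_biset G)) 1)"

definition burnside_relations ::
  "('g, 'm) monoid_scheme \<Rightarrow> (('g, nat) biset set \<Rightarrow>\<^sub>0 'k::comm_ring_1) set"
  where "burnside_relations G =
    {Poly_Mapping.single (biset_class G (biset_sum M N)) 1
       - (Poly_Mapping.single (biset_class G M) 1 + Poly_Mapping.single (biset_class G N) 1)
     | (M :: ('g, nat) biset) (N :: ('g, nat) biset). finite_biset G M \<and> finite_biset G N}"

definition double_burnside ::
  "('g, 'm) monoid_scheme \<Rightarrow> ('k::comm_ring_1, (('g, nat) biset set \<Rightarrow>\<^sub>0 'k) set) module"
  where "double_burnside G =
    quotient_algebra (biset_class_algebra G)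
      (Modules.module.span (\<lambda>c. Poly_Mapping.map ((*) c)) (burnside_relations G))"


section \<open>Morita equivalence\<close>

text \<open>
  The library's \<open>module\<close> locale is restricted to commutative rings. The fields \<^const>\<open>mult\<close> and
  \<^const>\<open>one\<close> of the record \<open>M\<close> are ignored.
\<close>

locale left_module = R?: ring R + M?: abelian_group M
  for R :: "('a, 'm) ring_scheme" (structure) and M :: "('a, 'u, 'n) module_scheme" (structure) +
  assumes smult_closed: "r \<in> carrier R \<Longrightarrow> x \<in> carrier M \<Longrightarrow> r \<odot>\<^bsub>M\<^esub> x \<in> carrier M"
    and smult_l_distr: "r \<in> carrier R \<Longrightarrow> s \<in> carrier R \<Longrightarrow> x \<in> carrier M \<Longrightarrow>
      (r \<oplus>\<^bsub>R\<^esub> s) \<odot>\<^bsub>M\<^esub> x = r \<odot>\<^bsub>M\<^esub> x \<oplus>\<^bsub>M\<^esub> s \<odot>\<^bsub>M\<^esub> x"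
    and smult_r_distr: "r \<in> carrier R \<Longrightarrow> x \<in> carrier M \<Longrightarrow> y \<in> carrier M \<Longrightarrow>
      r \<odot>\<^bsub>M\<^esub> (x \<oplus>\<^bsub>M\<^esub> y) = r \<odot>\<^bsub>M\<^esub> x \<oplus>\<^bsub>M\<^esub> r \<odot>\<^bsub>M\<^esub> y"
    and smult_assoc: "r \<in> carrier R \<Longrightarrow> s \<in> carrier R \<Longrightarrow> x \<in> carrier M \<Longrightarrow>
      (r \<otimes>\<^bsub>R\<^esub> s) \<odot>\<^bsub>M\<^esub> x = r \<odot>\<^bsub>M\<^esub> (s \<odot>\<^bsub>M\<^esub> x)"
    and smult_one: "x \<in> carrier M \<Longrightarrow> \<one>\<^bsub>R\<^esub> \<odot>\<^bsub>M\<^esub> x = x"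

definition lmod_hom ::
  "('a, 'm) ring_scheme \<Rightarrow> ('a, 'u) module \<Rightarrow> ('a, 'v) module \<Rightarrow> ('u \<Rightarrow> 'v) set"
  where "lmod_hom R M N = {h \<in> carrier M \<rightarrow>\<^sub>E carrier N.
    (\<forall>x\<in>carrier M. \<forall>y\<in>carrier M. h (x \<oplus>\<^bsub>M\<^esub> y) = h x \<oplus>\<^bsub>N\<^esub> h y) \<and>
    (\<forall>r\<in>carrier R. \<forall>x\<in>carrier M. h (r \<odot>\<^bsub>M\<^esub> x) = r \<odot>\<^bsub>N\<^esub> h x)}"

type_synonym ('a, 'b, 'u) obj_map = "('a, 'u) module \<Rightarrow> ('b, 'u) module"

text \<open>A map on morphisms also takes the domain and the codomain of the morphism.\<close>

type_synonym ('a, 'u) mor_map = "('a, 'u) module \<Rightarrow> ('a, 'u) module \<Rightarrow> ('u \<Rightarrow> 'u) \<Rightarrow> ('u \<Rightarrow> 'u)"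

definition lmod_functor ::
  "('a, 'm) ring_scheme \<Rightarrow> ('b, 'n) ring_scheme \<Rightarrow> ('a, 'b, 'u) obj_map \<Rightarrow> ('a, 'u) mor_map \<Rightarrow> bool"
  where "lmod_functor R S Fo Fm \<longleftrightarrow>
    (\<forall>M. left_module R M \<longrightarrow> left_module S (Fo M)) \<and>
    (\<forall>M N. left_module R M \<longrightarrow> left_module R N \<longrightarrow>
      (\<forall>h\<in>lmod_hom R M N. Fm M N h \<in> lmod_hom S (Fo M) (Fo N))) \<and>
    (\<forall>M. left_module R M \<longrightarrow> Fm M M (\<lambda>x\<in>carrier M. x) = (\<lambda>x\<in>carrier (Fo M). x)) \<and>
    (\<forall>L M N. left_module R L \<longrightarrow> left_module R M \<longrightarrow> left_module R N \<longrightarrow>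
      (\<forall>g\<in>lmod_hom R L M. \<forall>h\<in>lmod_hom R M N.
        Fm L N (compose (carrier L) h g) = compose (carrier (Fo L)) (Fm M N h) (Fm L M g)))"

text \<open>Natural isomorphism from the identity functor to the endofunctor \<open>(To, Tm)\<close>.\<close>

definition lmod_nat_iso_id ::
  "('a, 'm) ring_scheme \<Rightarrow> ('a, 'a, 'u) obj_map \<Rightarrow> ('a, 'u) mor_map \<Rightarrow>
    (('a, 'u) module \<Rightarrow> 'u \<Rightarrow> 'u) \<Rightarrow> bool"
  where "lmod_nat_iso_id R To Tm \<tau> \<longleftrightarrow>
    (\<forall>M. left_module R M \<longrightarrow>
      \<tau> M \<in> lmod_hom R M (To M) \<and> bij_betw (\<tau> M) (carrier M) (carrier (To M))) \<and>
    (\<forall>M N. left_module R M \<longrightarrow> left_module R N \<longrightarrow>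
      (\<forall>h\<in>lmod_hom R M N.
        compose (carrier M) (\<tau> N) h = compose (carrier M) (Tm M N h) (\<tau> M)))"

text \<open>
  Equivalence of the categories of left modules over \<open>R\<close> and \<open>S\<close>. As HOL has no type of all modules, modules are
  taken with carriers in a type \<open>'u\<close>, which serves as the universe; statements about Morita
  equivalence are to be made for all \<open>'u\<close>.
\<close>

definition morita_equivalent ::
  "'u itself \<Rightarrow> ('a, 'm) ring_scheme \<Rightarrow> ('b, 'n) ring_scheme \<Rightarrow> bool"
  where "morita_equivalent U R S \<longleftrightarrow>
    (\<exists>(Fo :: ('a, 'b, 'u) obj_map) Fm (Go :: ('b, 'a, 'u) obj_map) Gm \<tau> \<upsilon>.
      lmod_functor R S Fo Fm \<and> lmod_functor S R Go Gm \<and>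
      lmod_nat_iso_id R (\<lambda>M. Go (Fo M)) (\<lambda>M N h. Gm (Fo M) (Fo N) (Fm M N h)) \<tau> \<and>
      lmod_nat_iso_id S (\<lambda>M. Fo (Go M)) (\<lambda>M N h. Fm (Go M) (Go N) (Gm M N h)) \<upsilon>)"

end

theory Submission
  imports Defs
begin

text \<open>
  The linear map from paths to \<open>A\<close> that sends the arrows to the \<open>a\<^sub>i\<^sub>j\<close> is multiplicative. It kills every path
  except ten, whose images form a basis of \<open>fAf\<close>, and the killed paths contain one of the relations.

  With matrix units \<open>e\<^sub>i\<^sub>j\<close> of the block \<open>(1,1)\<close>, \<open>1 = f f + e\<^sub>2\<^sub>1 e\<^sub>1\<^sub>2 + e\<^sub>3\<^sub>1 e\<^sub>1\<^sub>3\<close>, so \<open>f\<close> is a full idempotent, and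
  the induced module \<open>Af \<otimes> N\<close> is the image of an idempotent matrix on \<open>N\<^sup>3\<close>. As a rational vector space, \<open>N\<close> is
  infinite or zero, so \<open>N\<^sup>3\<close> fits into the type of \<open>N\<close>.

  A biset \<open>M\<close> over \<open>G = S\<^sub>3\<close> is mapped to \<open>1/36\<close> times the sum over \<open>m \<in> M\<close> of \<open>\<tau>(L\<^sub>m)\<close>, where
  \<open>L\<^sub>m = {(x, y). x m = m y}\<close>. The class of \<open>(m, n)\<close> in \<open>M \<times>\<^sub>G N\<close> has as stabilizer the relational composite of \<open>L\<^sub>m\<close>
  and \<open>L\<^sub>n\<close>. Counting orbits reduces multiplicativity to the identity
  \<open>\<Sum>g. |k\<^sub>2(K) \<inter> k\<^sub>1(\<^sup>gL)| \<tau>(K \<circ> \<^sup>gL) = \<tau>(K) \<tau>(L)\<close> for subgroups \<open>K, L\<close> of \<open>G \<times> G\<close>, with \<open>k\<^sub>2(K) = {x. (1, x) \<in> K}\<close> and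
  \<open>k\<^sub>1(L) = {x. (x, 1) \<in> L}\<close>; it is checked by computation on the 22 conjugacy classes of subgroups. The map is
  bijective because the 22 values of \<open>\<tau>\<close> form a basis of \<open>A\<close>.
\<close>

section \<open>Coordinates on the algebra \<open>A\<close>\<close>

text \<open>The scaling of \<tau> is what removes all choices. An orbit with stabilizer L has 36/|L|
  points; as \<tau>(L) is |L| times the image of (G x G)/L, summing \<tau> over the points gives 36
  times that image, whence the factor 1/36. The usual Mackey formula runs over double cosets of
  p_2(K) and p_1(L), the middle projections. The double coset of g has |p_2(K)| |p_1(L)| / |p_2(K)
  meet p_1(^gL)| elements, while |K O ^gL| |k_2(K) meet k_1(^gL)| = |p_2(K) meet p_1(^gL)| |k_1(K)|
  |k_2(L)|. So the sum over all g in the overview is the Mackey formula multiplied by |K| |L|, and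
  representatives are never chosen. The entry -20 of \<open>table\<close> stems from the 12 in \<xi>
  - 12\<eta>: the entry for 1 x C_3 with diagonal s, times the entry for C_3 x 1 with diagonal s, is
  18 times the entry for <(s,s)>, so its \<eta>-coefficient is (72 - 12 * 36)/18.\<close>

lemma eta_xi_ideal_iff:
  "p \<in> eta_xi_ideal \<longleftrightarrow> coeff (coeff p 0) 0 = 0 \<and> coeff (coeff p 0) 1 = 0 \<and> coeff (coeff p 1) 0 = 0"
proof
  assume "p \<in> eta_xi_ideal"
  then show "coeff (coeff p 0) 0 = 0 \<and> coeff (coeff p 0) 1 = 0 \<and> coeff (coeff p 1) 0 = 0"
    by (auto simp: eta_xi_ideal_def eta_poly_def xi_poly_def power2_eq_square coeff_mult)
next
  assume 0: "coeff (coeff p 0) 0 = 0 \<and> coeff (coeff p 0) 1 = 0 \<and> coeff (coeff p 1) 0 = 0"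
  obtain p0 p' where p: "p = pCons p0 p'" by (cases p)
  obtain p1 p2 where p': "p' = pCons p1 p2" by (cases p')
  obtain c q where p0: "p0 = pCons c q" by (cases p0)
  obtain d a where q: "q = pCons d a" by (cases q)
  obtain e b where p1: "p1 = pCons e b" by (cases p1)
  have z: "c = 0" "d = 0" "e = 0" using 0 by (auto simp: p p' p0 q p1)
  \<comment> \<open>The ideal is the square of (\<eta>, \<xi>). With \<eta> as inner variable, the
    terms of degree at least two are \<open>a\<close> times \<eta>^2, \<open>b\<close> times
    \<eta>\<xi> and \<open>p2\<close> times \<xi>^2.\<close>
  have "p = [:a:] * eta_poly\<^sup>2 + [:b:] * (eta_poly * xi_poly) + p2 * xi_poly\<^sup>2"
    by (simp add: p p' p0 q p1 z eta_poly_def xi_poly_def power2_eq_square)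
  then show "p \<in> eta_xi_ideal" unfolding eta_xi_ideal_def by blast
qed

lift_definition eta_coeff :: "eta_xi_ring \<Rightarrow> rat" is "\<lambda>p. coeff (coeff p 0) 1"
proof -
  fix p q :: "rat poly poly"
  assume "eta_xi_rel p q"
  then show "coeff (coeff p 0) 1 = coeff (coeff q 0) 1"
    by (simp add: eta_xi_rel_def eta_xi_ideal_iff)
qed

lift_definition xi_coeff :: "eta_xi_ring \<Rightarrow> rat" is "\<lambda>p. coeff (coeff p 1) 0"
proof -
  fix p q :: "rat poly poly"
  assume "eta_xi_rel p q"
  then show "coeff (coeff p 1) 0 = coeff (coeff q 1) 0"
    by (simp add: eta_xi_rel_def eta_xi_ideal_iff)
qed

lemma eta_xi_coeff_add [simp]:
  "const_term (x + y) = const_term x + const_term y"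
  "eta_coeff (x + y) = eta_coeff x + eta_coeff y"
  "xi_coeff (x + y) = xi_coeff x + xi_coeff y"
  by (transfer; simp)+

lemma eta_xi_coeff_diff [simp]:
  "const_term (x - y) = const_term x - const_term y"
  "eta_coeff (x - y) = eta_coeff x - eta_coeff y"
  "xi_coeff (x - y) = xi_coeff x - xi_coeff y"
  by (transfer; simp)+

lemma eta_xi_coeff_mult [simp]:
  "const_term (x * y) = const_term x * const_term y"
  "eta_coeff (x * y) = const_term x * eta_coeff y + eta_coeff x * const_term y"
  "xi_coeff (x * y) = const_term x * xi_coeff y + xi_coeff x * const_term y"
  by (transfer; simp add: coeff_mult)+

lemma eta_xi_coeff_base [simp]:
  "const_term 0 = 0" "eta_coeff 0 = 0" "xi_coeff 0 = 0"
  "const_term 1 = 1" "eta_coeff 1 = 0" "xi_coeff 1 = 0"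
  "const_term eta_bar = 0" "eta_coeff eta_bar = 1" "xi_coeff eta_bar = 0"
  "const_term xi_bar = 0" "eta_coeff xi_bar = 0" "xi_coeff xi_bar = 1"
  "const_term (eta_xi_of_rat c) = c" "eta_coeff (eta_xi_of_rat c) = 0" "xi_coeff (eta_xi_of_rat c) = 0"
  by (transfer; simp add: eta_poly_def xi_poly_def one_pCons)+

lemma eta_xi_coeff_of_nat:
  "const_term (of_nat n) = of_nat n" "eta_coeff (of_nat n) = 0" "xi_coeff (of_nat n) = 0"
  by (induction n) simp_all

lemma eta_xi_coeff_numeral [simp]:
  "const_term (numeral n) = numeral n" "eta_coeff (numeral n) = 0" "xi_coeff (numeral n) = 0"
  using eta_xi_coeff_of_nat[of "numeral n"] by simp_all

lemma eta_xi_eq_iff: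
  "x = y \<longleftrightarrow> const_term x = const_term y \<and> eta_coeff x = eta_coeff y \<and> xi_coeff x = xi_coeff y"
  by transfer (simp add: eta_xi_rel_def eta_xi_ideal_iff)

text \<open>The coefficient type is left open: A has rational coordinates, while the tables further
  down are evaluated over the integers.\<close>

datatype 'a vec3 = V3 'a 'a 'a

text \<open>The three rows of the block \<open>(1,1)\<close>, then the blocks \<open>(1,4)\<close>, \<open>(4,1)\<close>, \<open>(2,2)\<close>, \<open>(2,4)\<close>,
  \<open>(4,2)\<close>, \<open>(3,3)\<close>, and the coefficients of 1, \<open>\<eta>\<close>, \<open>\<xi>\<close> in the block \<open>(4,4)\<close>.\<close>

datatype 'a coords = Coords "'a vec3" "'a vec3" "'a vec3" "'a vec3" "'a vec3" 'a 'a 'a 'a "'a vec3"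

lemma coords_cases:
  obtains x1 x2 x3 x4 x5 x6 x7 x8 x9 x10 x11 x12 x13 x14 x15 x16 x17 x18 x19 x20 x21 x22 where
    "x = Coords (V3 x1 x2 x3) (V3 x4 x5 x6) (V3 x7 x8 x9) (V3 x10 x11 x12) (V3 x13 x14 x15)
      x16 x17 x18 x19 (V3 x20 x21 x22)"
proof (cases x)
  case (Coords p q r s t a b c d u)
  then show ?thesis by (cases p; cases q; cases r; cases s; cases t; cases u) (simp add: that)
qed

fun v3_add :: "'a::comm_ring_1 vec3 \<Rightarrow> 'a vec3 \<Rightarrow> 'a vec3"
  where "v3_add (V3 a b c) (V3 a' b' c') = V3 (a + a') (b + b') (c + c')"

fun v3_scale :: "'a::comm_ring_1 \<Rightarrow> 'a vec3 \<Rightarrow> 'a vec3"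
  where "v3_scale r (V3 a b c) = V3 (r * a) (r * b) (r * c)"

fun v3_dot :: "'a::comm_ring_1 vec3 \<Rightarrow> 'a vec3 \<Rightarrow> 'a"
  where "v3_dot (V3 a b c) (V3 a' b' c') = a * a' + b * b' + c * c'"

fun v3_comb :: "'a::comm_ring_1 vec3 \<Rightarrow> 'a vec3 \<Rightarrow> 'a vec3 \<Rightarrow> 'a vec3 \<Rightarrow> 'a vec3"
  where "v3_comb (V3 a b c) x y z = v3_add (v3_scale a x) (v3_add (v3_scale b y) (v3_scale c z))"

fun coords_add :: "'a::comm_ring_1 coords \<Rightarrow> 'a coords \<Rightarrow> 'a coords"
  where "coords_add (Coords p q r s t a b c d u) (Coords p' q' r' s' t' a' b' c' d' u') =
    Coords (v3_add p p') (v3_add q q') (v3_add r r') (v3_add s s') (v3_add t t')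
      (a + a') (b + b') (c + c') (d + d') (v3_add u u')"

fun coords_scale :: "'a::comm_ring_1 \<Rightarrow> 'a coords \<Rightarrow> 'a coords"
  where "coords_scale k (Coords p q r s t a b c d u) =
    Coords (v3_scale k p) (v3_scale k q) (v3_scale k r) (v3_scale k s) (v3_scale k t)
      (k * a) (k * b) (k * c) (k * d) (v3_scale k u)"

fun coords_mult :: "'a::comm_ring_1 coords \<Rightarrow> 'a coords \<Rightarrow> 'a coords"
  where "coords_mult (Coords p q r s t a b c d (V3 e f g)) (Coords p' q' r' s' t' a' b' c' d' (V3 e' f' g')) =
    Coords (v3_comb p p' q' r') (v3_comb q p' q' r') (v3_comb r p' q' r')
      (v3_add (V3 (v3_dot p s') (v3_dot q s') (v3_dot r s')) (v3_scale e' s))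
      (v3_add (v3_comb t p' q' r') (v3_scale e t'))
      (a * a') (a * b' + b * e') (c * a' + e * c') (d * d')
      (V3 (e * e') (v3_dot t s' - 12 * (c * b') + e * f' + f * e') (c * b' + e * g' + g * e'))"

fun coords_of :: "A_array \<Rightarrow> rat coords"
  where "coords_of (A_array x11 x14 x41 x22 x24 x42 x33 x44) =
    Coords (V3 (x11$1$1) (x11$1$2) (x11$1$3)) (V3 (x11$2$1) (x11$2$2) (x11$2$3))
      (V3 (x11$3$1) (x11$3$2) (x11$3$3)) (V3 (x14$1$1) (x14$2$1) (x14$3$1))
      (V3 (x41$1$1) (x41$1$2) (x41$1$3)) x22 x24 x42 x33
      (V3 (const_term x44) (eta_coeff x44) (xi_coeff x44))"

fun A_of :: "rat coords \<Rightarrow> A_array"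
  where "A_of (Coords (V3 a b c) (V3 d e f) (V3 g h i) (V3 j k l) (V3 m n p) x22 x24 x42 x33 (V3 u v w)) =
    A_array
      (\<chi> r s. if r = 1 then (if s = 1 then a else if s = 2 then b else c)
        else if r = 2 then (if s = 1 then d else if s = 2 then e else f)
        else (if s = 1 then g else if s = 2 then h else i))
      (\<chi> r s. if r = 1 then j else if r = 2 then k else l)
      (\<chi> r s. if s = 1 then m else if s = 2 then n else p)
      x22 x24 x42 x33
      (eta_xi_of_rat u + eta_xi_of_rat v * eta_bar + eta_xi_of_rat w * xi_bar)"

lemma coords_of_A_of [simp]: "coords_of (A_of x) = x"
  by (induction x rule: A_of.induct) simp

text \<open>Turns every identity in A into polynomial identities in 22 rational coordinates; the
  ring laws and all later computations in A go through it.\<close>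

lemma coords_of_inject: "coords_of x = coords_of y \<longleftrightarrow> x = y"
  by (cases x; cases y) (auto simp: vec_eq_iff forall_3 eta_xi_eq_iff)

lemma coords_of_A_add: "coords_of (A_add x y) = coords_add (coords_of x) (coords_of y)"
  by (cases x; cases y) simp

lemma coords_of_A_smult: "coords_of (A_smult c x) = coords_scale c (coords_of x)"
  by (cases x) (simp add: scale_matrix_def)

lemma coords_of_A_mult: "coords_of (A_mult x y) = coords_mult (coords_of x) (coords_of y)"
  by (cases x; cases y) (simp add: scale_matrix_def matrix_matrix_mult_def sum_3 algebra_simps)

instantiation A_array :: ring_1
begin

definition zero_A_array :: A_array where "zero_A_array = A_array 0 0 0 0 0 0 0 0"

definition one_A_array :: A_array where "one_A_array = A_array (mat 1) 0 0 1 0 0 1 1"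

definition plus_A_array :: "A_array \<Rightarrow> A_array \<Rightarrow> A_array" where "plus_A_array = A_add"

definition uminus_A_array :: "A_array \<Rightarrow> A_array" where "uminus_A_array = A_smult (-1)"

definition minus_A_array :: "A_array \<Rightarrow> A_array \<Rightarrow> A_array"
  where "minus_A_array x y = A_add x (A_smult (-1) y)"

definition times_A_array :: "A_array \<Rightarrow> A_array \<Rightarrow> A_array" where "times_A_array = A_mult"

lemma coords_of_ring:
  "coords_of 0 = Coords (V3 0 0 0) (V3 0 0 0) (V3 0 0 0) (V3 0 0 0) (V3 0 0 0) 0 0 0 0 (V3 0 0 0)"
  "coords_of 1 = Coords (V3 1 0 0) (V3 0 1 0) (V3 0 0 1) (V3 0 0 0) (V3 0 0 0) 1 0 0 1 (V3 1 0 0)"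
  "coords_of (x + y) = coords_add (coords_of x) (coords_of y)"
  "coords_of (- x) = coords_scale (- 1) (coords_of x)"
  "coords_of (x - y) = coords_add (coords_of x) (coords_scale (- 1) (coords_of y))"
  "coords_of (x * y) = coords_mult (coords_of x) (coords_of y)"
  by (simp_all add: zero_A_array_def one_A_array_def plus_A_array_def uminus_A_array_def
      minus_A_array_def times_A_array_def coords_of_A_add coords_of_A_smult coords_of_A_mult mat_def)

instance
proof
  fix x y z :: A_array
  note [simp] = coords_of_ring
  show "x * y * z = x * (y * z)"
    unfolding coords_of_inject[symmetric]
    by (cases "coords_of x" rule: coords_cases; cases "coords_of y" rule: coords_cases;
        cases "coords_of z" rule: coords_cases) (simp add: algebra_simps)
  show "(x + y) * z = x * z + y * z" "x * (y + z) = x * y + x * z" "x + y + z = x + (y + z)"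
    unfolding coords_of_inject[symmetric]
    by (cases "coords_of x" rule: coords_cases; cases "coords_of y" rule: coords_cases;
        cases "coords_of z" rule: coords_cases; simp add: algebra_simps)+
  show "1 * x = x" "x * 1 = x" "x + y = y + x" "0 + x = x" "- x + x = 0" "x - y = x + - y"
    unfolding coords_of_inject[symmetric]
    by (cases "coords_of x" rule: coords_cases; cases "coords_of y" rule: coords_cases; simp)+
  show "(0::A_array) \<noteq> 1"
    by (simp add: coords_of_inject[symmetric])
qed

end

section \<open>Quotients of free modules with a partial multiplication on the basis\<close>

lemma lookup_map_mult [simp]:
  "Poly_Mapping.lookup (Poly_Mapping.map ((*) c) f) k = (c::'k::comm_ring_1) * Poly_Mapping.lookup f k"
  by (transfer) (auto simp: when_def)

lemma module_poly_mapping: "Modules.module (\<lambda>c. Poly_Mapping.map ((*) (c::'k::comm_ring_1)))"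
  by standard (auto intro!: poly_mapping_eqI simp: lookup_add algebra_simps)

text \<open>An algebra in type-class form. Units are kept out, since the target of
  \<open>linear_ext\<close> may be a corner whose unit differs from that of the ambient
  ring.\<close>

locale scaled_ring = Modules.module scale
  for scale :: "'k::comm_ring_1 \<Rightarrow> 'a::ring \<Rightarrow> 'a" +
  assumes scale_mult_left: "scale c x * y = scale c (x * y)"
    and scale_mult_right: "x * scale c y = scale c (x * y)"
begin

definition linear_ext :: "('b \<Rightarrow> 'a) \<Rightarrow> ('b \<Rightarrow>\<^sub>0 'k) \<Rightarrow> 'a"
  where "linear_ext \<phi> f = (\<Sum>p\<in>Poly_Mapping.keys f. scale (Poly_Mapping.lookup f p) (\<phi> p))"

lemma linear_ext_superset:
  assumes "finite K" "Poly_Mapping.keys f \<subseteq> K"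
  shows "linear_ext \<phi> f = (\<Sum>p\<in>K. scale (Poly_Mapping.lookup f p) (\<phi> p))"
  unfolding linear_ext_def using assms
  by (intro sum.mono_neutral_left) (auto simp: in_keys_iff)

lemma linear_ext_zero [simp]: "linear_ext \<phi> 0 = 0"
  by (simp add: linear_ext_def)

lemma linear_ext_add: "linear_ext \<phi> (f + g) = linear_ext \<phi> f + linear_ext \<phi> g"
proof -
  let ?K = "Poly_Mapping.keys f \<union> Poly_Mapping.keys g"
  have "Poly_Mapping.keys (f + g) \<subseteq> ?K" by (rule Poly_Mapping.keys_add)
  then show ?thesis
    by (simp add: linear_ext_superset[of ?K] lookup_add scale_left_distrib sum.distrib)
qed

lemma linear_ext_smult:
  "linear_ext \<phi> (Poly_Mapping.map ((*) c) f) = scale c (linear_ext \<phi> f)"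
proof -
  have "Poly_Mapping.keys (Poly_Mapping.map ((*) c) f) \<subseteq> Poly_Mapping.keys f"
    by (auto simp: in_keys_iff)
  then show ?thesis
    by (simp add: linear_ext_superset[of "Poly_Mapping.keys f"] scale_sum_right)
qed

lemma linear_ext_single [simp]: "linear_ext \<phi> (Poly_Mapping.single p c) = scale c (\<phi> p)"
  by (subst linear_ext_superset[of "{p}"]) auto

lemma linear_ext_uminus: "linear_ext \<phi> (- f) = - linear_ext \<phi> f"
  using linear_ext_add[of \<phi> f "- f"] by (simp add: eq_neg_iff_add_eq_0 add.commute)

lemma linear_ext_diff: "linear_ext \<phi> (f - g) = linear_ext \<phi> f - linear_ext \<phi> g"
  using linear_ext_add[of \<phi> f "- g"] by (simp add: linear_ext_uminus)

lemma linear_ext_sum: "linear_ext \<phi> (\<Sum>i\<in>I. h i) = (\<Sum>i\<in>I. linear_ext \<phi> (h i))"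
  by (induction I rule: infinite_finite_induct) (auto simp: linear_ext_add)

text \<open>Both sides are bilinear, so basis elements suffice. The hypothesis is restricted to keys
  because \<phi> is known to be multiplicative only on the basis set.\<close>

lemma linear_ext_bilinear:
  assumes "\<And>p q. p \<in> Poly_Mapping.keys f \<Longrightarrow> q \<in> Poly_Mapping.keys g \<Longrightarrow>
    \<phi> p * \<phi> q = (case m p q of None \<Rightarrow> 0 | Some r \<Rightarrow> \<phi> r)"
  shows "linear_ext \<phi> (bilinear_extension m f g) = linear_ext \<phi> f * linear_ext \<phi> g"
proof -
  have "linear_ext \<phi> (bilinear_extension m f g) =
    (\<Sum>p\<in>Poly_Mapping.keys f. \<Sum>q\<in>Poly_Mapping.keys g.
      scale (Poly_Mapping.lookup f p * Poly_Mapping.lookup g q) (\<phi> p * \<phi> q))"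
    unfolding bilinear_extension_def linear_ext_sum
    by (intro sum.cong refl) (auto simp: assms split: option.splits)
  also have "\<dots> = linear_ext \<phi> f * linear_ext \<phi> g"
    by (simp add: linear_ext_def sum_product scale_mult_left scale_mult_right mult.commute)
  finally show ?thesis .
qed

lemma keys_bilinear_extension:
  assumes "\<And>p q r. p \<in> B \<Longrightarrow> q \<in> B \<Longrightarrow> m p q = Some r \<Longrightarrow> r \<in> B"
    and "Poly_Mapping.keys f \<subseteq> B" "Poly_Mapping.keys g \<subseteq> B"
  shows "Poly_Mapping.keys (bilinear_extension m f g) \<subseteq> B"
proof -
  have "Poly_Mapping.keys (case m p q of None \<Rightarrow> 0 | Some r \<Rightarrow> Poly_Mapping.single r c) \<subseteq> B"
    if "p \<in> Poly_Mapping.keys f" "q \<in> Poly_Mapping.keys g" for p q and c :: 'c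
    using that assms(2,3) by (auto dest: assms(1)[rotated 2] split: option.splits if_splits)
  then show ?thesis unfolding bilinear_extension_def
    by (intro order.trans[OF keys_sum] UN_least)
qed

end

text \<open>Transport of structure: the axioms of \<open>B\<close> follow from those of
  \<open>A\<close>, which spares verifying them for the quotient algebras.\<close>

lemma assoc_algebra_transport:
  fixes A :: "('k::comm_ring_1, 'a, 'm) module_scheme" and B :: "('k, 'b, 'n) module_scheme"
  assumes A: "assoc_algebra A" and bij: "bij_betw h (carrier A) (carrier B)"
    and mult: "\<And>x y. x \<in> carrier A \<Longrightarrow> y \<in> carrier A \<Longrightarrow> h (x \<otimes>\<^bsub>A\<^esub> y) = h x \<otimes>\<^bsub>B\<^esub> h y"
    and add: "\<And>x y. x \<in> carrier A \<Longrightarrow> y \<in> carrier A \<Longrightarrow> h (x \<oplus>\<^bsub>A\<^esub> y) = h x \<oplus>\<^bsub>B\<^esub> h y"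
    and one: "h \<one>\<^bsub>A\<^esub> = \<one>\<^bsub>B\<^esub>" and zero: "h \<zero>\<^bsub>A\<^esub> = \<zero>\<^bsub>B\<^esub>"
    and smult: "\<And>c x. x \<in> carrier A \<Longrightarrow> h (c \<odot>\<^bsub>A\<^esub> x) = c \<odot>\<^bsub>B\<^esub> h x"
  shows "h \<in> algebra_iso A B"
proof -
  interpret A: assoc_algebra A by (rule A)
  have carr: "h x \<in> carrier B" if "x \<in> carrier A" for x using bij that by (auto simp: bij_betw_def)
  have iso: "h \<in> ring_iso A B"
    using bij mult add one carr by (auto simp: ring_iso_def ring_hom_def)
  \<comment> \<open>The transported ring has the image of zero as its zero; the hypothesis
    \<open>zero\<close> says that this is the zero of \<open>B\<close>.\<close>
  have "ring (B\<lparr>zero := h \<zero>\<^bsub>A\<^esub>\<rparr>)"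
    by (rule A.ring_iso_imp_img_ring[OF iso])
  then have "ring B" by (simp add: zero)
  moreover have img: "carrier B = h ` carrier A" using bij by (simp add: bij_betw_def)
  have "assoc_algebra_axioms B"
    unfolding assoc_algebra_axioms_def img
    by (auto simp: A.smult_closed A.smult_add_left A.smult_add_right A.smult_smult
        A.smult_1 A.smult_mult_left A.smult_mult_right simp flip: mult add smult)
  ultimately have "assoc_algebra B" by (simp add: assoc_algebra_def)
  with A iso show ?thesis by (simp add: algebra_iso_def smult)
qed

context scaled_ring
begin

text \<open>\<open>S\<close> may be a corner of the ambient ring, whence its own unit and carrier.\<close>

lemma linear_ext_fibre_iso:
  fixes B :: "'b set" and m :: "'b \<Rightarrow> 'b \<Rightarrow> 'b option" and e :: "'b \<Rightarrow>\<^sub>0 'k"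
    and S :: "('k, 'a) module"
  defines "R \<equiv> basis_algebra B m e"
  assumes S: "assoc_algebra S" "mult S = (*)" "add S = (+)" "zero S = 0" "smult S = scale"
    and m_closed: "\<And>p q r. p \<in> B \<Longrightarrow> q \<in> B \<Longrightarrow> m p q = Some r \<Longrightarrow> r \<in> B"
    and m_mult: "\<And>p q. p \<in> B \<Longrightarrow> q \<in> B \<Longrightarrow> \<phi> p * \<phi> q = (case m p q of None \<Rightarrow> 0 | Some r \<Rightarrow> \<phi> r)"
    and e: "Poly_Mapping.keys e \<subseteq> B" "linear_ext \<phi> e = one S"
    and onto: "linear_ext \<phi> ` {f. Poly_Mapping.keys f \<subseteq> B} = carrier S"
    and J: "J = {f. Poly_Mapping.keys f \<subseteq> B \<and> linear_ext \<phi> f = 0}"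
  defines "h \<equiv> \<lambda>a. {f. Poly_Mapping.keys f \<subseteq> B \<and> linear_ext \<phi> f = a}"
  shows "h \<in> algebra_iso S (quotient_algebra R J)"
    and "\<And>f. Poly_Mapping.keys f \<subseteq> B \<Longrightarrow> h (linear_ext \<phi> f) = J +>\<^bsub>R\<^esub> f"
proof -
  let ?C = "{f. Poly_Mapping.keys f \<subseteq> B}"
  have R: "carrier R = ?C" "mult R = bilinear_extension m" "one R = e" "zero R = 0" "add R = (+)"
    "smult R = (\<lambda>c. Poly_Mapping.map ((*) c))"
    by (simp_all add: R_def basis_algebra_def)
  have closed: "bilinear_extension m f g \<in> ?C" "f + g \<in> ?C" "f - g \<in> ?C"
      "Poly_Mapping.map ((*) c) f \<in> ?C"
    if fg: "f \<in> ?C" "g \<in> ?C" for f g c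
  proof -
    show "bilinear_extension m f g \<in> ?C"
      using keys_bilinear_extension[of B m f g] m_closed fg by blast
    show "f + g \<in> ?C" "f - g \<in> ?C"
      using fg Poly_Mapping.keys_add[of f g] keys_diff[of f g] by auto
    show "Poly_Mapping.map ((*) c) f \<in> ?C"
      using fg by (auto simp: in_keys_iff subset_iff) (metis mult_zero_right)
  qed
  have mult: "linear_ext \<phi> (bilinear_extension m f g) = linear_ext \<phi> f * linear_ext \<phi> g"
    if "f \<in> ?C" "g \<in> ?C" for f g
    using that m_mult by (intro linear_ext_bilinear) auto
  \<comment> \<open>As J is the kernel, its cosets are the fibres of
    \<open>linear_ext \<phi>\<close>. Hence \<open>h\<close> is the inverse of the map induced on
    the quotient.\<close>
  have coset: "J +>\<^bsub>R\<^esub> f = h (linear_ext \<phi> f)" if f: "f \<in> ?C" for f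
  proof
    show "J +>\<^bsub>R\<^esub> f \<subseteq> h (linear_ext \<phi> f)"
      using closed(2) f by (auto simp: a_r_coset_def' R J h_def linear_ext_add)
    show "h (linear_ext \<phi> f) \<subseteq> J +>\<^bsub>R\<^esub> f"
    proof
      fix g assume g: "g \<in> h (linear_ext \<phi> f)"
      then have "g - f \<in> J" using closed(3)[of g f] f by (auto simp: J h_def linear_ext_diff)
      then show "g \<in> J +>\<^bsub>R\<^esub> f" by (auto simp: a_r_coset_def' R intro!: bexI[of _ "g - f"])
    qed
  qed
  then show "\<And>f. Poly_Mapping.keys f \<subseteq> B \<Longrightarrow> h (linear_ext \<phi> f) = J +>\<^bsub>R\<^esub> f" by auto
  have ne: "\<exists>f\<in>?C. linear_ext \<phi> f = a" if "a \<in> carrier S" for a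
    using that unfolding onto[symmetric] by auto
  have h_mem: "f \<in> h a \<longleftrightarrow> f \<in> ?C \<and> linear_ext \<phi> f = a" for f a by (simp add: h_def)
  have "h ` carrier S = (\<lambda>f. h (linear_ext \<phi> f)) ` ?C" by (simp flip: onto add: image_image)
  also have "\<dots> = (\<lambda>f. J +>\<^bsub>R\<^esub> f) ` ?C" by (intro image_cong refl) (simp add: coset)
  also have "\<dots> = carrier (quotient_algebra R J)"
    by (auto simp: quotient_algebra_def FactRing_def ring.defs module.defs A_RCOSETS_def' R)
  finally have Q_carrier: "carrier (quotient_algebra R J) = h ` carrier S" by simp
  have Q: "mult (quotient_algebra R J) X Y = (\<Union>f\<in>X. \<Union>g\<in>Y. J +>\<^bsub>R\<^esub> bilinear_extension m f g)"
    "add (quotient_algebra R J) X Y = (\<Union>f\<in>X. \<Union>g\<in>Y. {f + g})"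
    "one (quotient_algebra R J) = h (one S)" "zero (quotient_algebra R J) = h (zero S)"
    "smult (quotient_algebra R J) c X = (\<Union>f\<in>X. J +>\<^bsub>R\<^esub> Poly_Mapping.map ((*) c) f)" for X Y c
    using coset[of e] e
    by (simp_all add: quotient_algebra_def FactRing_def ring.defs module.defs R
        rcoset_mult_def set_add_def' h_def J S)
  show "h \<in> algebra_iso S (quotient_algebra R J)"
  proof (rule assoc_algebra_transport[OF S(1)])
    have "inj_on h (carrier S)"
      by (intro inj_onI) (metis (mono_tags, lifting) h_mem ne)
    then show "bij_betw h (carrier S) (carrier (quotient_algebra R J))"
      by (simp add: bij_betw_def Q_carrier)
  next
    fix a b assume ab: "a \<in> carrier S" "b \<in> carrier S"
    obtain f g where fg: "f \<in> h a" "g \<in> h b" using ne[OF ab(1)] ne[OF ab(2)] by (auto simp: h_mem)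
    \<comment> \<open>The operations of the quotient are unions over all representatives; each
      representative contributes the same coset, so the union collapses.\<close>
    have "J +>\<^bsub>R\<^esub> bilinear_extension m f g = h (a * b)" if "f \<in> h a" "g \<in> h b" for f g
      using that closed(1)[of f g] coset[of "bilinear_extension m f g"] mult[of f g] by (simp add: h_mem)
    then show "h (a \<otimes>\<^bsub>S\<^esub> b) = h a \<otimes>\<^bsub>quotient_algebra R J\<^esub> h b"
      using fg by (auto simp: Q S)
    show "h (a \<oplus>\<^bsub>S\<^esub> b) = h a \<oplus>\<^bsub>quotient_algebra R J\<^esub> h b"
    proof
      show "h (a \<oplus>\<^bsub>S\<^esub> b) \<subseteq> h a \<oplus>\<^bsub>quotient_algebra R J\<^esub> h b"
      proof
        fix k assume "k \<in> h (a \<oplus>\<^bsub>S\<^esub> b)"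
        then have "k - g \<in> h a" using fg closed(3)[of k g] by (auto simp: h_mem S linear_ext_diff)
        with fg(2) show "k \<in> h a \<oplus>\<^bsub>quotient_algebra R J\<^esub> h b"
          by (simp add: Q) (rule bexI[of _ "k - g"], rule bexI[of _ g], simp_all)
      qed
      show "h a \<oplus>\<^bsub>quotient_algebra R J\<^esub> h b \<subseteq> h (a \<oplus>\<^bsub>S\<^esub> b)"
      proof
        fix k assume "k \<in> h a \<oplus>\<^bsub>quotient_algebra R J\<^esub> h b"
        then obtain f g where "f \<in> h a" "g \<in> h b" "k = f + g" by (auto simp: Q)
        then show "k \<in> h (a \<oplus>\<^bsub>S\<^esub> b)" using closed(2)[of f g] by (simp add: h_mem S linear_ext_add)
      qed
    qed
  next
    fix c a assume a: "a \<in> carrier S"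
    obtain f where f: "f \<in> h a" using ne[OF a] by (auto simp: h_mem)
    have "J +>\<^bsub>R\<^esub> Poly_Mapping.map ((*) c) f = h (scale c a)" if "f \<in> h a" for f
      using that closed(4)[of f f c] coset[of "Poly_Mapping.map ((*) c) f"] by (simp add: h_mem linear_ext_smult)
    then show "h (c \<odot>\<^bsub>S\<^esub> a) = c \<odot>\<^bsub>quotient_algebra R J\<^esub> h a"
      using f by (auto simp: Q S)
  qed (simp_all add: Q)
qed

end

section \<open>The algebra \<open>A\<close> and its corner\<close>

lemma scaled_ring_A: "scaled_ring A_smult"
proof
  fix c d :: rat and x y :: A_array
  note [simp] = coords_of_A_smult coords_of_ring
  show "A_smult c (x + y) = A_smult c x + A_smult c y" "A_smult (c + d) x = A_smult c x + A_smult d x"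
    "A_smult c (A_smult d x) = A_smult (c * d) x" "A_smult 1 x = x"
    "A_smult c x * y = A_smult c (x * y)" "x * A_smult c y = A_smult c (x * y)"
    unfolding coords_of_inject[symmetric]
    by (cases "coords_of x" rule: coords_cases; cases "coords_of y" rule: coords_cases; simp add: algebra_simps)+
qed

interpretation A: scaled_ring A_smult by (rule scaled_ring_A)

lemma A_alg_simps [simp]:
  "carrier A_alg = UNIV" "mult A_alg = (*)" "one A_alg = 1" "zero A_alg = 0" "add A_alg = (+)"
  "smult A_alg = A_smult"
  by (simp_all add: A_alg_def zero_A_array_def one_A_array_def plus_A_array_def times_A_array_def fun_eq_iff)

lemma assoc_algebra_A_alg: "assoc_algebra A_alg"
proof -
  have "ring A_alg"
    by (intro ringI abelian_groupI monoidI)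
      (auto simp: algebra_simps intro!: exI[of _ "- x" for x])
  moreover have "assoc_algebra_axioms A_alg"
    by standard (simp_all add: A.scale_left_distrib A.scale_right_distrib A.scale_mult_left A.scale_mult_right)
  ultimately show ?thesis by (simp add: assoc_algebra_def)
qed

lemma (in assoc_algebra) assoc_algebra_corner:
  assumes e: "e \<in> carrier A" "e \<otimes> e = e"
  shows "assoc_algebra (corner_algebra A e)"
proof -
  let ?C = "carrier (corner_algebra A e)"
  \<comment> \<open>In this form closure under the operations is immediate; idempotence of
    \<open>e\<close> gives the equivalence.\<close>
  have C: "x \<in> ?C \<longleftrightarrow> x \<in> carrier A \<and> e \<otimes> x = x \<and> x \<otimes> e = x" for x
  proof
    assume "x \<in> ?C"
    then obtain y where "y \<in> carrier A" "x = e \<otimes> y \<otimes> e" by (auto simp: corner_algebra_def)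
    then show "x \<in> carrier A \<and> e \<otimes> x = x \<and> x \<otimes> e = x" using e
      by (metis m_assoc m_closed)
  next
    assume "x \<in> carrier A \<and> e \<otimes> x = x \<and> x \<otimes> e = x"
    then show "x \<in> ?C" by (auto simp: corner_algebra_def intro!: exI[of _ x])
  qed
  have ops [simp]: "mult (corner_algebra A e) = (\<otimes>)" "add (corner_algebra A e) = (\<oplus>)"
    "zero (corner_algebra A e) = \<zero>" "one (corner_algebra A e) = e" "smult (corner_algebra A e) = (\<odot>\<^bsub>A\<^esub>)"
    by (simp_all add: corner_algebra_def)
  have closed: "x \<otimes> y \<in> ?C" "x \<oplus> y \<in> ?C" "c \<odot>\<^bsub>A\<^esub> x \<in> ?C" if "x \<in> ?C" "y \<in> ?C" for x y c
    using that e unfolding C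
    by (simp_all add: m_assoc[symmetric] l_distr r_distr smult_closed smult_mult_left smult_mult_right)
      (simp add: m_assoc)
  have base: "e \<in> ?C" "\<zero> \<in> ?C" using e by (simp_all add: C)
  have neg: "\<exists>y\<in>?C. x \<oplus> y = \<zero>" if "x \<in> ?C" for x
    using that e by (auto simp: C r_neg r_minus l_minus intro!: bexI[of _ "\<ominus> x"])
  have [simp]: "x \<in> carrier A" "e \<otimes> x = x" "x \<otimes> e = x" if "x \<in> ?C" for x
    using that by (simp_all add: C)
  have "ring (corner_algebra A e)"
    by (rule ringI, rule abelian_groupI; (rule monoidI)?)
      (use neg in \<open>auto simp: closed base l_distr r_distr m_assoc a_ac\<close>)
  moreover have "assoc_algebra_axioms (corner_algebra A e)"
    by standard
      (auto simp: closed smult_add_left smult_add_right smult_smult smult_1 smult_mult_left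
        smult_mult_right)
  ultimately show ?thesis by (simp add: assoc_algebra_def)
qed

section \<open>Path algebras\<close>

lemma poly_mapping_monomials:
  "f = (\<Sum>p\<in>Poly_Mapping.keys f. Poly_Mapping.single p (Poly_Mapping.lookup f p))"
  by (rule poly_mapping_eqI)
    (auto simp: lookup_sum lookup_single when_def in_keys_iff sum.delta' if_distrib cong: if_cong)

lemma bilinear_extension_superset:
  assumes "finite K" "Poly_Mapping.keys f \<subseteq> K" "finite L" "Poly_Mapping.keys g \<subseteq> L"
  shows "bilinear_extension m f g = (\<Sum>p\<in>K. \<Sum>q\<in>L. case m p q of None \<Rightarrow> 0
    | Some r \<Rightarrow> Poly_Mapping.single r (Poly_Mapping.lookup f p * Poly_Mapping.lookup g q))"
proof -
  have "bilinear_extension m f g = (\<Sum>p\<in>K. \<Sum>q\<in>Poly_Mapping.keys g. case m p q of None \<Rightarrow> 0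
    | Some r \<Rightarrow> Poly_Mapping.single r (Poly_Mapping.lookup f p * Poly_Mapping.lookup g q))"
    unfolding bilinear_extension_def using assms
    by (intro sum.mono_neutral_left) (auto simp: in_keys_iff intro!: sum.neutral split: option.splits)
  also have "\<dots> = (\<Sum>p\<in>K. \<Sum>q\<in>L. case m p q of None \<Rightarrow> 0
    | Some r \<Rightarrow> Poly_Mapping.single r (Poly_Mapping.lookup f p * Poly_Mapping.lookup g q))"
    using assms by (intro sum.cong refl sum.mono_neutral_left) (auto simp: in_keys_iff split: option.splits)
  finally show ?thesis .
qed

lemma bilinear_extension_add_left:
  "bilinear_extension m (f + f') g = bilinear_extension m f g + bilinear_extension m f' g"
proof -
  let ?K = "Poly_Mapping.keys f \<union> Poly_Mapping.keys f'"
  have "Poly_Mapping.keys (f + f') \<subseteq> ?K" by (rule Poly_Mapping.keys_add)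
  then show ?thesis
    unfolding sum.distrib[symmetric]
      bilinear_extension_superset[of ?K _ "Poly_Mapping.keys g", OF _ _ finite_keys order.refl]
    by (auto simp: bilinear_extension_superset[of ?K _ "Poly_Mapping.keys g"] lookup_add algebra_simps
        single_add sum.distrib[symmetric] intro!: sum.cong split: option.splits)
qed

lemma bilinear_extension_add_right:
  "bilinear_extension m f (g + g') = bilinear_extension m f g + bilinear_extension m f g'"
proof -
  let ?K = "Poly_Mapping.keys g \<union> Poly_Mapping.keys g'"
  have "Poly_Mapping.keys (g + g') \<subseteq> ?K" by (rule Poly_Mapping.keys_add)
  then show ?thesis
    by (auto simp: bilinear_extension_superset[of "Poly_Mapping.keys f" _ ?K] lookup_add algebra_simps
        single_add sum.distrib[symmetric] intro!: sum.cong split: option.splits)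
qed

lemma bilinear_extension_zero [simp]: "bilinear_extension m 0 g = 0" "bilinear_extension m f 0 = 0"
  by (simp_all add: bilinear_extension_def)

lemma bilinear_extension_single [simp]:
  "bilinear_extension m (Poly_Mapping.single p a) (Poly_Mapping.single q b) =
    (case m p q of None \<Rightarrow> 0 | Some r \<Rightarrow> Poly_Mapping.single r (a * b))"
  by (subst bilinear_extension_superset[of "{p}" _ "{q}"]) (auto split: option.split)

lemma bilinear_extension_sum_left:
  "bilinear_extension m (\<Sum>i\<in>I. h i) g = (\<Sum>i\<in>I. bilinear_extension m (h i) g)"
  by (induction I rule: infinite_finite_induct) (simp_all add: bilinear_extension_add_left)

lemma bilinear_extension_sum_right:
  "bilinear_extension m f (\<Sum>i\<in>I. h i) = (\<Sum>i\<in>I. bilinear_extension m f (h i))"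
  by (induction I rule: infinite_finite_induct) (simp_all add: bilinear_extension_add_right)

text \<open>By bilinearity only monomials matter. The equation in the option monad also says that
  both bracketings are undefined together, so that the zero products match.\<close>

lemma bilinear_extension_assoc:
  assumes "\<And>p q r. Option.bind (m p q) (\<lambda>x. m x r) = Option.bind (m q r) (m p)"
  shows "bilinear_extension m (bilinear_extension m f g) h = bilinear_extension m f (bilinear_extension m g h)"
proof -
  have *: "bilinear_extension m (bilinear_extension m (Poly_Mapping.single p a) (Poly_Mapping.single q b))
      (Poly_Mapping.single r c) =
    bilinear_extension m (Poly_Mapping.single p a) (bilinear_extension m (Poly_Mapping.single q b)
      (Poly_Mapping.single r c))" for p q r a b c
    using assms[of p q r] by (cases "m p q"; cases "m q r") (auto simp: mult.assoc split: option.splits)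
  show ?thesis
    by (subst (1 2) poly_mapping_monomials[of f], subst (1 2) poly_mapping_monomials[of g],
        subst (1 2) poly_mapping_monomials[of h])
      (simp only: bilinear_extension_sum_left bilinear_extension_sum_right *)
qed

lemma path_comp_assoc: "Option.bind (path_comp p q) (\<lambda>x. path_comp x r) = Option.bind (path_comp q r) (path_comp p)"
  by (cases p; cases q; cases r) auto

lemma cas_append: "pre_digraph.cas Q u p v \<Longrightarrow> pre_digraph.cas Q v q w \<Longrightarrow> pre_digraph.cas Q u (p @ q) w"
  by (induction p arbitrary: u) (simp_all add: pre_digraph.cas.simps)

lemma cas_split:
  "pre_digraph.cas Q u (p @ q) w \<Longrightarrow> \<exists>v. pre_digraph.cas Q u p v \<and> pre_digraph.cas Q v q w"
  by (induction p arbitrary: u) (auto simp: pre_digraph.cas.simps)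

lemma path_comp_closed:
  "p \<in> quiver_paths Q \<Longrightarrow> q \<in> quiver_paths Q \<Longrightarrow> path_comp p q = Some r \<Longrightarrow> r \<in> quiver_paths Q"
  by (cases p; cases q)
    (auto simp: quiver_paths_def pre_digraph.awalk_def intro: cas_append split: if_splits)

text \<open>A path is composable with exactly one trivial path on each side, so one summand of the
  unit survives.\<close>

lemma path_algebra_unit:
  assumes fin: "finite (verts Q)" and f: "Poly_Mapping.keys f \<subseteq> quiver_paths Q"
    and ends: "\<And>u p v. (u, p, v) \<in> quiver_paths Q \<Longrightarrow> u \<in> verts Q \<and> v \<in> verts Q"
  shows "bilinear_extension path_comp (\<Sum>v\<in>verts Q. trivial_path v) f = f"
    and "bilinear_extension path_comp f (\<Sum>v\<in>verts Q. trivial_path v) = f"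
proof -
  have l: "bilinear_extension path_comp (\<Sum>v\<in>verts Q. trivial_path v) (Poly_Mapping.single x c) =
    Poly_Mapping.single x c"
   and r: "bilinear_extension path_comp (Poly_Mapping.single x c) (\<Sum>v\<in>verts Q. trivial_path v) =
    Poly_Mapping.single x c" if "x \<in> quiver_paths Q" for x and c :: 'c
    using that ends[of "fst x" "fst (snd x)" "snd (snd x)"] fin
    by (cases x; simp add: bilinear_extension_sum_left bilinear_extension_sum_right trivial_path_def
        if_distrib[of "\<lambda>x. case x of None \<Rightarrow> _ | Some z \<Rightarrow> _ z"] sum.delta sum.delta' cong: if_cong)+
  let ?e = "\<Sum>v\<in>verts Q. trivial_path v" and ?s = "\<lambda>p. Poly_Mapping.single p (Poly_Mapping.lookup f p)"
  have "bilinear_extension path_comp ?e f = (\<Sum>p\<in>Poly_Mapping.keys f. bilinear_extension path_comp ?e (?s p))"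
    using arg_cong[OF poly_mapping_monomials[of f], of "bilinear_extension path_comp ?e"]
    by (simp only: bilinear_extension_sum_right)
  also have "\<dots> = (\<Sum>p\<in>Poly_Mapping.keys f. ?s p)"
    using f by (intro sum.cong refl) (simp add: l subsetD)
  finally show "bilinear_extension path_comp ?e f = f" by (simp flip: poly_mapping_monomials)
  have "bilinear_extension path_comp f ?e = (\<Sum>p\<in>Poly_Mapping.keys f. bilinear_extension path_comp (?s p) ?e)"
    using arg_cong[OF poly_mapping_monomials[of f], of "\<lambda>f. bilinear_extension path_comp f ?e"]
    by (simp only: bilinear_extension_sum_left)
  also have "\<dots> = (\<Sum>p\<in>Poly_Mapping.keys f. ?s p)"
    using f by (intro sum.cong refl) (simp add: r subsetD)
  finally show "bilinear_extension path_comp f ?e = f" by (simp flip: poly_mapping_monomials)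
qed

section \<open>The quiver \<open>\<Psi>\<close>\<close>

fun psi_vertex_elem :: "psi_vertex \<Rightarrow> A_array"
  where "psi_vertex_elem v11 = a11" | "psi_vertex_elem v22 = a22"
  | "psi_vertex_elem v33 = a33" | "psi_vertex_elem v44 = a44"

fun psi_arrow_elem :: "psi_arrow \<Rightarrow> A_array"
  where "psi_arrow_elem ar_sigma = a24" | "psi_arrow_elem ar_vartheta = a42"
  | "psi_arrow_elem ar_rho = a41" | "psi_arrow_elem ar_pi = a14"

text \<open>The leading idempotent serves the trivial paths; on a nonempty path it is absorbed by
  the first arrow.\<close>

fun psi_path_elem :: "(psi_vertex, psi_arrow) qpath \<Rightarrow> A_array"
  where "psi_path_elem (u, p, v) = psi_vertex_elem u * prod_list (map psi_arrow_elem p)"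

lemma coords_of_basis [simp]:
  "coords_of a11 = Coords (V3 1 0 0) (V3 0 0 0) (V3 0 0 0) (V3 0 0 0) (V3 0 0 0) 0 0 0 0 (V3 0 0 0)"
  "coords_of a22 = Coords (V3 0 0 0) (V3 0 0 0) (V3 0 0 0) (V3 0 0 0) (V3 0 0 0) 1 0 0 0 (V3 0 0 0)"
  "coords_of a33 = Coords (V3 0 0 0) (V3 0 0 0) (V3 0 0 0) (V3 0 0 0) (V3 0 0 0) 0 0 0 1 (V3 0 0 0)"
  "coords_of a44 = Coords (V3 0 0 0) (V3 0 0 0) (V3 0 0 0) (V3 0 0 0) (V3 0 0 0) 0 0 0 0 (V3 1 0 0)"
  "coords_of a14 = Coords (V3 0 0 0) (V3 0 0 0) (V3 0 0 0) (V3 1 0 0) (V3 0 0 0) 0 0 0 0 (V3 0 0 0)"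
  "coords_of a41 = Coords (V3 0 0 0) (V3 0 0 0) (V3 0 0 0) (V3 0 0 0) (V3 1 0 0) 0 0 0 0 (V3 0 0 0)"
  "coords_of a24 = Coords (V3 0 0 0) (V3 0 0 0) (V3 0 0 0) (V3 0 0 0) (V3 0 0 0) 0 1 0 0 (V3 0 0 0)"
  "coords_of a42 = Coords (V3 0 0 0) (V3 0 0 0) (V3 0 0 0) (V3 0 0 0) (V3 0 0 0) 0 0 1 0 (V3 0 0 0)"
  by (simp_all add: a11_def a22_def a33_def a44_def a14_def a41_def a24_def a42_def)

lemma coords_of_f_idem [simp]:
  "coords_of f_idem = Coords (V3 1 0 0) (V3 0 0 0) (V3 0 0 0) (V3 0 0 0) (V3 0 0 0) 1 0 0 1 (V3 1 0 0)"
  by (simp add: f_idem_def coords_of_ring)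

lemma Psi_ends [simp]:
  "tail Psi ar_sigma = v22" "tail Psi ar_vartheta = v44" "tail Psi ar_rho = v44" "tail Psi ar_pi = v11"
  "head Psi ar_sigma = v44" "head Psi ar_vartheta = v22" "head Psi ar_rho = v11" "head Psi ar_pi = v44"
  by (simp_all add: Psi_def)

lemma psi_vertex_elem_mult: "psi_vertex_elem u * psi_vertex_elem v = (if u = v then psi_vertex_elem u else 0)"
  by (cases u; cases v) (simp_all add: coords_of_inject[symmetric] coords_of_ring)

lemma psi_arrow_elem_ends:
  "psi_vertex_elem (tail Psi a) * psi_arrow_elem a = psi_arrow_elem a"
  "psi_arrow_elem a * psi_vertex_elem (head Psi a) = psi_arrow_elem a"
  by (cases a; simp add: coords_of_inject[symmetric] coords_of_ring)+

lemma psi_arrow_elem_relations: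
  "psi_arrow_elem ar_pi * psi_arrow_elem ar_rho = 0" "psi_arrow_elem ar_sigma * psi_arrow_elem ar_vartheta = 0"
  "psi_arrow_elem ar_pi * psi_arrow_elem ar_vartheta = 0" "psi_arrow_elem ar_sigma * psi_arrow_elem ar_rho = 0"
  by (simp_all add: coords_of_inject[symmetric] coords_of_ring)

lemma quiver_paths_Psi: "(u, p, v) \<in> quiver_paths Psi \<longleftrightarrow> pre_digraph.cas Psi u p v"
proof -
  have "verts Psi = UNIV" "arcs Psi = UNIV" by (auto simp: Psi_def intro: psi_vertex.exhaust psi_arrow.exhaust)
  then show ?thesis by (simp add: quiver_paths_def pre_digraph.awalk_def)
qed

text \<open>\<open>psi_path_elem\<close> mentions only the start vertex; the idempotent of the end
  vertex is recovered arrow by arrow.\<close>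

lemma psi_path_elem_end:
  "pre_digraph.cas Psi u p v \<Longrightarrow> psi_path_elem (u, p, v) * psi_vertex_elem v = psi_path_elem (u, p, v)"
proof (induction p arbitrary: u)
  case Nil
  then show ?case by (simp add: pre_digraph.cas.simps psi_vertex_elem_mult)
next
  case (Cons a p)
  then have a: "tail Psi a = u" and "pre_digraph.cas Psi (head Psi a) p v"
    by (simp_all add: pre_digraph.cas.simps)
  then have IH: "psi_vertex_elem (head Psi a) * prod_list (map psi_arrow_elem p) * psi_vertex_elem v =
    psi_vertex_elem (head Psi a) * prod_list (map psi_arrow_elem p)"
    using Cons.IH by simp
  have "psi_path_elem (u, a # p, v) = psi_vertex_elem u * psi_arrow_elem a *
      (psi_vertex_elem (head Psi a) * prod_list (map psi_arrow_elem p))"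
    by (simp add: mult.assoc[symmetric]) (simp add: mult.assoc[of _ _ "psi_vertex_elem (head Psi a)"] psi_arrow_elem_ends)
  then show ?case by (simp add: mult.assoc IH[unfolded mult.assoc])
qed

text \<open>The idempotent at the end of p meets the one at the start of q, and orthogonality kills
  the product unless the two vertices agree.\<close>

lemma psi_path_elem_mult:
  assumes "p \<in> quiver_paths Psi" "q \<in> quiver_paths Psi"
  shows "psi_path_elem p * psi_path_elem q = (case path_comp p q of None \<Rightarrow> 0 | Some r \<Rightarrow> psi_path_elem r)"
proof -
  obtain u x v where p: "p = (u, x, v)" by (cases p)
  obtain v' y w where q: "q = (v', y, w)" by (cases q)
  let ?Y = "prod_list (map psi_arrow_elem y)"
  have P: "psi_path_elem p * psi_vertex_elem v = psi_path_elem p"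
    using psi_path_elem_end[of u x v] assms by (simp add: p quiver_paths_Psi)
  have "psi_path_elem p * psi_path_elem q = psi_path_elem p * (psi_vertex_elem v * psi_vertex_elem v') * ?Y"
    by (subst P[symmetric]) (simp only: q psi_path_elem.simps mult.assoc)
  also have "\<dots> = (if v = v' then psi_path_elem p * ?Y else 0)"
    using P by (auto simp: psi_vertex_elem_mult)
  also have "\<dots> = (case path_comp p q of None \<Rightarrow> 0 | Some r \<Rightarrow> psi_path_elem r)"
    by (simp add: p q mult.assoc)
  finally show ?thesis .
qed

lemma ring_QPsi: "ring QPsi"
proof -
  let ?C = "{f :: (psi_vertex, psi_arrow) qpath \<Rightarrow>\<^sub>0 rat. Poly_Mapping.keys f \<subseteq> quiver_paths Psi}"
  have [simp]: "finite (verts Psi)" by (simp add: Psi_def)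
  have V: "v \<in> verts Psi" for v by (cases v) (simp_all add: Psi_def)
  have "(\<Sum>v\<in>verts Psi. trivial_path v) \<in> ?C"
    using keys_sum[of trivial_path "verts Psi"]
    by (auto simp: trivial_path_def quiver_paths_Psi pre_digraph.cas.simps split: if_splits)
  moreover have "bilinear_extension path_comp f g \<in> ?C" "f + g \<in> ?C" if "f \<in> ?C" "g \<in> ?C" for f g
    using A.keys_bilinear_extension[of "quiver_paths Psi" path_comp f g] path_comp_closed that
      Poly_Mapping.keys_add[of f g] by blast+
  moreover have "\<exists>g\<in>?C. g + f = 0" if "f \<in> ?C" for f
    using that by (intro bexI[of _ "- f"]) simp_all
  ultimately show ?thesis
    unfolding QPsi_def path_algebra_def basis_algebra_def
    by (intro ringI abelian_groupI monoidI)
      (simp_all add: bilinear_extension_assoc[OF path_comp_assoc] path_algebra_unit V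
        bilinear_extension_add_left bilinear_extension_add_right add.assoc add.commute)
qed

lemma QPsi_simps:
  "carrier QPsi = {f. Poly_Mapping.keys f \<subseteq> quiver_paths Psi}" "mult QPsi = bilinear_extension path_comp"
  "add QPsi = (+)" "zero QPsi = 0" "one QPsi = (\<Sum>v\<in>verts Psi. trivial_path v)"
  by (simp_all add: QPsi_def path_algebra_def basis_algebra_def)

text \<open>The paths avoiding \<open>ar_pi\<close> or \<open>ar_sigma\<close> followed by
  \<open>ar_rho\<close> or \<open>ar_vartheta\<close>. Their number is the dimension 10 of
  fAf.\<close>

definition psi_basis :: "(psi_vertex, psi_arrow) qpath list"
  where "psi_basis = [(v11, [], v11), (v22, [], v22), (v33, [], v33), (v44, [], v44),
    (v22, [ar_sigma], v44), (v44, [ar_vartheta], v22), (v44, [ar_rho], v11), (v11, [ar_pi], v44),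
    (v44, [ar_rho, ar_pi], v44), (v44, [ar_vartheta, ar_sigma], v44)]"

lemma I_Psi_ideal: "ideal I_Psi QPsi"
  and I_Psi_gens:
    "Poly_Mapping.single (v11, [ar_pi, ar_rho], v11) 1 \<in> I_Psi"
    "Poly_Mapping.single (v22, [ar_sigma, ar_vartheta], v22) 1 \<in> I_Psi"
    "Poly_Mapping.single (v11, [ar_pi, ar_vartheta], v22) 1 \<in> I_Psi"
    "Poly_Mapping.single (v22, [ar_sigma, ar_rho], v11) 1 \<in> I_Psi"
proof -
  interpret ring QPsi by (rule ring_QPsi)
  let ?gens = "{arrow_path Psi ar_pi \<otimes>\<^bsub>QPsi\<^esub> arrow_path Psi ar_rho,
     arrow_path Psi ar_sigma \<otimes>\<^bsub>QPsi\<^esub> arrow_path Psi ar_vartheta,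
     arrow_path Psi ar_pi \<otimes>\<^bsub>QPsi\<^esub> arrow_path Psi ar_vartheta,
     arrow_path Psi ar_sigma \<otimes>\<^bsub>QPsi\<^esub> arrow_path Psi ar_rho}"
  have gens: "?gens = {Poly_Mapping.single (v11, [ar_pi, ar_rho], v11) 1,
    Poly_Mapping.single (v22, [ar_sigma, ar_vartheta], v22) 1,
    Poly_Mapping.single (v11, [ar_pi, ar_vartheta], v22) 1,
    Poly_Mapping.single (v22, [ar_sigma, ar_rho], v11) 1}"
    by (simp add: arrow_path_def QPsi_simps)
  have "?gens \<subseteq> carrier QPsi"
    unfolding gens by (simp add: QPsi_simps quiver_paths_Psi pre_digraph.cas.simps)
  then show "ideal I_Psi QPsi"
    "Poly_Mapping.single (v11, [ar_pi, ar_rho], v11) 1 \<in> I_Psi"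
    "Poly_Mapping.single (v22, [ar_sigma, ar_vartheta], v22) 1 \<in> I_Psi"
    "Poly_Mapping.single (v11, [ar_pi, ar_vartheta], v22) 1 \<in> I_Psi"
    "Poly_Mapping.single (v22, [ar_sigma, ar_rho], v11) 1 \<in> I_Psi"
    using genideal_ideal[of ?gens] genideal_self[of ?gens] unfolding I_Psi_def gens by auto
qed

lemma single_factor_in_I_Psi:
  assumes "Poly_Mapping.single (w, g, w') 1 \<in> I_Psi"
    and "pre_digraph.cas Psi u p w" "pre_digraph.cas Psi w' q v"
  shows "Poly_Mapping.single (u, p @ g @ q, v) c \<in> I_Psi"
proof -
  interpret ideal I_Psi QPsi by (rule I_Psi_ideal)
  have "Poly_Mapping.single (u, p, w) c \<in> carrier QPsi" "Poly_Mapping.single (w', q, v) 1 \<in> carrier QPsi"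
    using assms by (simp_all add: QPsi_simps quiver_paths_Psi)
  from I_r_closed[OF I_l_closed[OF assms(1) this(1)] this(2)] show ?thesis
    by (simp add: QPsi_simps)
qed

text \<open>Every arrow enters or leaves \<open>v44\<close>, so the two kinds alternate along a
  path. A path outside the basis therefore enters and leaves \<open>v44\<close> again within its
  first three arrows.\<close>

lemma psi_nonbasis_factor:
  assumes "(u, p, v) \<in> quiver_paths Psi" "(u, p, v) \<notin> set psi_basis"
  obtains x a b y where "p = x @ a # b # y" "a \<in> {ar_pi, ar_sigma}" "b \<in> {ar_rho, ar_vartheta}"
    "pre_digraph.cas Psi u x (tail Psi a)" "pre_digraph.cas Psi (head Psi b) y v"
proof -
  have cas: "pre_digraph.cas Psi u p v" using assms by (simp add: quiver_paths_Psi)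
  note found = that
  \<comment> \<open>An arrow ending in \<open>v44\<close> can only be followed by one starting
    there, so any successor of \<open>ar_pi\<close> or \<open>ar_sigma\<close> completes a
    relation.\<close>
  have rel: thesis if p: "p = x @ a # b # y" and a: "a \<in> {ar_pi, ar_sigma}" for x y a b
  proof -
    have "\<exists>w. pre_digraph.cas Psi u x w \<and> pre_digraph.cas Psi w (a # b # y) v"
      using cas unfolding p by (rule cas_split)
    then have *: "pre_digraph.cas Psi u x (tail Psi a)" "tail Psi b = head Psi a" "pre_digraph.cas Psi (head Psi b) y v"
      by (auto simp: pre_digraph.cas.simps)
    then have "b \<in> {ar_rho, ar_vartheta}" using a by (cases b) auto
    then show thesis using found[OF p a] * by simp
  qed
  show thesis
  proof (cases p)
    case Nil
    then show ?thesis using assms cas by (cases u) (simp_all add: psi_basis_def pre_digraph.cas.simps)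
  next
    case (Cons a r)
    note p = Cons
    show ?thesis
    proof (cases r)
      case Nil
      then show ?thesis using assms(2) cas p
        by (cases a) (auto simp: psi_basis_def pre_digraph.cas.simps)
    next
      case (Cons b s)
      show ?thesis
      proof (cases "a \<in> {ar_pi, ar_sigma}")
        case True
        then show ?thesis using rel[of "[]" a b s] p Cons by simp
      next
        case False
        \<comment> \<open>The first arrow leaves \<open>v44\<close>, so the second returns to it; if
          the path stopped there it would be one of the two basis paths of length two.\<close>
        then have b: "b \<in> {ar_pi, ar_sigma}" "s \<noteq> []" using p Cons cas assms(2)
          by (cases a; cases b; auto simp: psi_basis_def pre_digraph.cas.simps)+
        then obtain c t where "s = c # t" by (cases s) auto
        with b p Cons show ?thesis using rel[of "[a]" b c t] by simp
      qed
    qed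
  qed
qed

lemma psi_nonbasis_in_I_Psi:
  assumes "(u, p, v) \<in> quiver_paths Psi" "(u, p, v) \<notin> set psi_basis"
  shows "Poly_Mapping.single (u, p, v) c \<in> I_Psi"
  using assms
proof (rule psi_nonbasis_factor)
  fix x a b y
  assume p: "p = x @ a # b # y" and ab: "a \<in> {ar_pi, ar_sigma}" "b \<in> {ar_rho, ar_vartheta}"
    and cas: "pre_digraph.cas Psi u x (tail Psi a)" "pre_digraph.cas Psi (head Psi b) y v"
  have "Poly_Mapping.single (tail Psi a, [a, b], head Psi b) 1 \<in> I_Psi"
    using ab by (auto simp: I_Psi_gens)
  then show ?thesis
    using single_factor_in_I_Psi[of "tail Psi a" "[a, b]" "head Psi b"] cas by (simp add: p)
qed

lemma psi_nonbasis_elem: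
  assumes "(u, p, v) \<in> quiver_paths Psi" "(u, p, v) \<notin> set psi_basis"
  shows "psi_path_elem (u, p, v) = 0"
  using assms
proof (rule psi_nonbasis_factor)
  fix x a b y
  assume p: "p = x @ a # b # y" and ab: "a \<in> {ar_pi, ar_sigma}" "b \<in> {ar_rho, ar_vartheta}"
  then have "psi_arrow_elem a * psi_arrow_elem b = 0" using psi_arrow_elem_relations by auto
  then show ?thesis by (simp add: p mult.assoc[of "psi_arrow_elem a", symmetric])
qed

text \<open>The kernel is an ideal containing the relations. Conversely, independence of the images
  of the ten basis paths removes their coefficients from a kernel element, and all other monomials
  lie in the ideal.\<close>

lemma I_Psi_eq_kernel:
  "I_Psi = {f. Poly_Mapping.keys f \<subseteq> quiver_paths Psi \<and> A.linear_ext psi_path_elem f = 0}" (is "_ = ?K")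
proof
  interpret ring QPsi by (rule ring_QPsi)
  have mult: "A.linear_ext psi_path_elem (bilinear_extension path_comp f g) =
    A.linear_ext psi_path_elem f * A.linear_ext psi_path_elem g"
    if "f \<in> carrier QPsi" "g \<in> carrier QPsi" for f g
    using that by (intro A.linear_ext_bilinear psi_path_elem_mult) (auto simp: QPsi_simps)
  have "additive_subgroup ?K QPsi"
  proof (intro additive_subgroup.intro add.subgroupI)
    fix f g assume "f \<in> ?K" "g \<in> ?K"
    then show "f \<oplus>\<^bsub>QPsi\<^esub> g \<in> ?K"
      using Poly_Mapping.keys_add[of f g] by (auto simp: QPsi_simps A.linear_ext_add)
  next
    fix f assume f: "f \<in> ?K"
    then have "\<ominus>\<^bsub>QPsi\<^esub> f = - f"
      by (intro minus_equality) (simp_all add: QPsi_simps)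
    with f show "\<ominus>\<^bsub>QPsi\<^esub> f \<in> ?K" by (simp add: A.linear_ext_uminus)
  qed (auto simp: QPsi_simps intro!: exI[of _ 0])
  then have K: "ideal ?K QPsi"
  proof (intro ideal.intro ideal_axioms.intro ring_QPsi)
    fix a x assume "a \<in> ?K" "x \<in> carrier QPsi"
    then show "x \<otimes>\<^bsub>QPsi\<^esub> a \<in> ?K" "a \<otimes>\<^bsub>QPsi\<^esub> x \<in> ?K"
      using m_closed[of a x] m_closed[of x a] mult[of a x] mult[of x a] by (simp_all add: QPsi_simps)
  qed
  show "I_Psi \<subseteq> ?K"
    unfolding I_Psi_def
    by (rule genideal_minimal[OF K])
      (auto simp: arrow_path_def QPsi_simps quiver_paths_Psi pre_digraph.cas.simps coords_of_inject[symmetric]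
        coords_of_ring coords_of_A_smult split: if_splits)
  show "?K \<subseteq> I_Psi"
  proof
    fix f assume f: "f \<in> ?K"
    let ?c = "Poly_Mapping.lookup f"
    let ?K = "Poly_Mapping.keys f \<union> set psi_basis"
    have psi_basis: "set psi_basis \<subseteq> quiver_paths Psi"
      by (auto simp: psi_basis_def quiver_paths_Psi pre_digraph.cas.simps)
    have "0 = A.linear_ext psi_path_elem f" using f by simp
    also have "\<dots> = (\<Sum>p\<in>?K. A_smult (?c p) (psi_path_elem p))"
      by (intro A.linear_ext_superset) auto
    also have "\<dots> = (\<Sum>p\<in>set psi_basis. A_smult (?c p) (psi_path_elem p))"
      using f psi_basis psi_nonbasis_elem by (intro sum.mono_neutral_right) auto
    finally have "coords_of (\<Sum>p\<in>set psi_basis. A_smult (?c p) (psi_path_elem p)) = coords_of 0" by simp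
    then have 0: "?c p = 0" if "p \<in> set psi_basis" for p
      using that by (auto simp: psi_basis_def coords_of_ring coords_of_A_smult)
    have "finite S \<Longrightarrow> S \<subseteq> Poly_Mapping.keys f \<Longrightarrow> (\<Sum>p\<in>S. Poly_Mapping.single p (?c p)) \<in> I_Psi" for S
    proof (induction S rule: finite_induct)
      case empty
      then show ?case using ideal.Icarr[OF I_Psi_ideal] additive_subgroup.zero_closed[OF ideal.axioms(1)[OF I_Psi_ideal]]
        by (simp add: QPsi_simps)
    next
      case (insert p S)
      then have "p \<notin> set psi_basis" "p \<in> quiver_paths Psi" using 0[of p] f by (auto simp: in_keys_iff)
      then have "Poly_Mapping.single p (?c p) \<in> I_Psi" by (cases p) (simp add: psi_nonbasis_in_I_Psi)
      then show ?case
        using insert additive_subgroup.a_closed[OF ideal.axioms(1)[OF I_Psi_ideal]]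
        by (simp add: QPsi_simps)
    qed
    then show "f \<in> I_Psi" using poly_mapping_monomials[of f] by (metis finite_keys order.refl)
  qed
qed

lemma A'_alg_simps [simp]:
  "mult A'_alg = (*)" "one A'_alg = f_idem" "zero A'_alg = 0" "add A'_alg = (+)" "smult A'_alg = A_smult"
  by (simp_all add: A'_alg_def corner_algebra_def)

lemma f_idem_idem: "f_idem * f_idem = f_idem"
  by (simp add: coords_of_inject[symmetric] coords_of_ring)

lemma assoc_algebra_A'_alg: "assoc_algebra A'_alg"
  unfolding A'_alg_def
  by (rule assoc_algebra.assoc_algebra_corner[OF assoc_algebra_A_alg]) (simp_all add: f_idem_idem)

lemma carrier_A'_alg:
  "x \<in> carrier A'_alg \<longleftrightarrow> (\<exists>a b c d e f g h i j. coords_of x =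
    Coords (V3 a 0 0) (V3 0 0 0) (V3 0 0 0) (V3 b 0 0) (V3 c 0 0) d e f g (V3 h i j))"
proof
  assume "x \<in> carrier A'_alg"
  then obtain y where x: "x = f_idem * y * f_idem" by (auto simp: A'_alg_def corner_algebra_def)
  show "\<exists>a b c d e f g h i j. coords_of x =
    Coords (V3 a 0 0) (V3 0 0 0) (V3 0 0 0) (V3 b 0 0) (V3 c 0 0) d e f g (V3 h i j)"
    by (cases "coords_of y" rule: coords_cases) (simp add: x coords_of_ring)
next
  assume "\<exists>a b c d e f g h i j. coords_of x =
    Coords (V3 a 0 0) (V3 0 0 0) (V3 0 0 0) (V3 b 0 0) (V3 c 0 0) d e f g (V3 h i j)"
  then have "x = f_idem * x * f_idem"
    by (auto simp: coords_of_inject[symmetric] coords_of_ring)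
  then show "x \<in> carrier A'_alg" by (auto simp: A'_alg_def corner_algebra_def)
qed

lemma psi_linear_ext_onto:
  "A.linear_ext psi_path_elem ` {f. Poly_Mapping.keys f \<subseteq> quiver_paths Psi} = carrier A'_alg"
proof
  interpret A': assoc_algebra A'_alg by (rule assoc_algebra_A'_alg)
  have basis: "psi_path_elem p \<in> carrier A'_alg" if "p \<in> set psi_basis" for p
    using that by (auto simp: carrier_A'_alg psi_basis_def coords_of_ring)
  have elem: "psi_path_elem p \<in> carrier A'_alg" if "p \<in> quiver_paths Psi" for p
    using basis[of p] psi_nonbasis_elem[of "fst p" "fst (snd p)" "snd (snd p)"] that A'.zero_closed
    by (cases "p \<in> set psi_basis") auto
  have sum: "finite S \<Longrightarrow> (\<And>p. p \<in> S \<Longrightarrow> h p \<in> carrier A'_alg) \<Longrightarrow> sum h S \<in> carrier A'_alg"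
    for S and h :: "(psi_vertex, psi_arrow) qpath \<Rightarrow> A_array"
    by (induction S rule: finite_induct) (use A'.zero_closed A'.a_closed in auto)
  show "A.linear_ext psi_path_elem ` {f. Poly_Mapping.keys f \<subseteq> quiver_paths Psi} \<subseteq> carrier A'_alg"
    unfolding A.linear_ext_def using elem A'.smult_closed by (auto intro!: sum)
  show "carrier A'_alg \<subseteq> A.linear_ext psi_path_elem ` {f. Poly_Mapping.keys f \<subseteq> quiver_paths Psi}"
  proof
    fix x assume "x \<in> carrier A'_alg"
    then obtain a b c d e f g h i j where x: "coords_of x =
      Coords (V3 a 0 0) (V3 0 0 0) (V3 0 0 0) (V3 b 0 0) (V3 c 0 0) d e f g (V3 h i j)"
      by (auto simp: carrier_A'_alg)
    \<comment> \<open>Coefficients in the order of \<open>psi_basis\<close>. The last path maps to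
      \<xi> - 12\<eta>, so its coefficient j has to be compensated by 12 j at the path for
      \<eta>.\<close>
    let ?cs = "[a, d, g, h, e, f, c, b, i + 12 * j, j]"
    let ?f = "\<Sum>k<10. Poly_Mapping.single (psi_basis ! k) (?cs ! k)"
    have nums: "{..<10::nat} = {0, 1, 2, 3, 4, 5, 6, 7, 8, 9}" by auto
    have "Poly_Mapping.keys ?f \<subseteq> (\<Union>k<10. Poly_Mapping.keys (Poly_Mapping.single (psi_basis ! k) (?cs ! k)))"
      by (rule keys_sum)
    also have "\<dots> \<subseteq> quiver_paths Psi"
      by (auto simp: nums psi_basis_def quiver_paths_Psi pre_digraph.cas.simps split: if_splits)
    finally have "Poly_Mapping.keys ?f \<subseteq> quiver_paths Psi" .
    moreover have "A.linear_ext psi_path_elem ?f = x"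
      by (simp add: nums psi_basis_def A.linear_ext_add coords_of_inject[symmetric] x coords_of_ring coords_of_A_smult)
    ultimately show "x \<in> A.linear_ext psi_path_elem ` {f. Poly_Mapping.keys f \<subseteq> quiver_paths Psi}"
      by blast
  qed
qed

lemma psi_linear_ext_trivial: "A.linear_ext psi_path_elem (trivial_path v) = psi_vertex_elem v"
  by (simp add: trivial_path_def)

lemma psi_linear_ext_arrow: "A.linear_ext psi_path_elem (arrow_path Psi a) = psi_arrow_elem a"
  by (simp add: arrow_path_def psi_arrow_elem_ends)

theorem A'_alg_iso:
  obtains \<phi> where "\<phi> \<in> algebra_iso A'_alg (quotient_algebra QPsi I_Psi)"
    "\<And>v. \<phi> (psi_vertex_elem v) = I_Psi +>\<^bsub>QPsi\<^esub> trivial_path v"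
    "\<And>a. \<phi> (psi_arrow_elem a) = I_Psi +>\<^bsub>QPsi\<^esub> arrow_path Psi a"
proof -
  define \<phi> where "\<phi> = (\<lambda>a. {f. Poly_Mapping.keys f \<subseteq> quiver_paths Psi \<and> A.linear_ext psi_path_elem f = a})"
  have V: "verts Psi = {v11, v22, v33, v44}" by (simp add: Psi_def)
  have keys: "Poly_Mapping.keys (trivial_path v :: _ \<Rightarrow>\<^sub>0 rat) \<subseteq> quiver_paths Psi"
    "Poly_Mapping.keys (arrow_path Psi a :: _ \<Rightarrow>\<^sub>0 rat) \<subseteq> quiver_paths Psi" for v a
    by (simp_all add: trivial_path_def arrow_path_def quiver_paths_Psi pre_digraph.cas.simps)
  have unit: "Poly_Mapping.keys (\<Sum>v\<in>verts Psi. trivial_path v :: _ \<Rightarrow>\<^sub>0 rat) \<subseteq> quiver_paths Psi"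
    by (rule order.trans[OF keys_sum]) (use keys in auto)
  have e: "A.linear_ext psi_path_elem (\<Sum>v\<in>verts Psi. trivial_path v) = one A'_alg"
    by (simp add: V A.linear_ext_add psi_linear_ext_trivial f_idem_def add.assoc)
  note iso = A.linear_ext_fibre_iso[where \<phi> = psi_path_elem and J = I_Psi,
      OF assoc_algebra_A'_alg A'_alg_simps(1,4,3,5) _ _ unit e psi_linear_ext_onto I_Psi_eq_kernel]
  have "\<phi> \<in> algebra_iso A'_alg (quotient_algebra QPsi I_Psi)"
    unfolding \<phi>_def QPsi_def path_algebra_def by (rule iso(1)) (auto intro: path_comp_closed psi_path_elem_mult)
  moreover have "\<phi> (A.linear_ext psi_path_elem f) = I_Psi +>\<^bsub>QPsi\<^esub> f"
    if "Poly_Mapping.keys f \<subseteq> quiver_paths Psi" for f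
    unfolding \<phi>_def QPsi_def path_algebra_def
    by (rule iso(2)[rotated 2, OF that]) (auto intro: path_comp_closed psi_path_elem_mult)
  ultimately show thesis
    using that[of \<phi>] keys by (simp flip: psi_linear_ext_trivial psi_linear_ext_arrow)
qed

section \<open>Full corners and Morita equivalence\<close>

lemma left_moduleI:
  assumes "ring R" "abelian_group M"
    and "\<And>r x. r \<in> carrier R \<Longrightarrow> x \<in> carrier M \<Longrightarrow> r \<odot>\<^bsub>M\<^esub> x \<in> carrier M"
    and "\<And>r s x. r \<in> carrier R \<Longrightarrow> s \<in> carrier R \<Longrightarrow> x \<in> carrier M \<Longrightarrow>
      (r \<oplus>\<^bsub>R\<^esub> s) \<odot>\<^bsub>M\<^esub> x = r \<odot>\<^bsub>M\<^esub> x \<oplus>\<^bsub>M\<^esub> s \<odot>\<^bsub>M\<^esub> x"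
    and "\<And>r x y. r \<in> carrier R \<Longrightarrow> x \<in> carrier M \<Longrightarrow> y \<in> carrier M \<Longrightarrow>
      r \<odot>\<^bsub>M\<^esub> (x \<oplus>\<^bsub>M\<^esub> y) = r \<odot>\<^bsub>M\<^esub> x \<oplus>\<^bsub>M\<^esub> r \<odot>\<^bsub>M\<^esub> y"
    and "\<And>r s x. r \<in> carrier R \<Longrightarrow> s \<in> carrier R \<Longrightarrow> x \<in> carrier M \<Longrightarrow>
      (r \<otimes>\<^bsub>R\<^esub> s) \<odot>\<^bsub>M\<^esub> x = r \<odot>\<^bsub>M\<^esub> (s \<odot>\<^bsub>M\<^esub> x)"
    and "\<And>x. x \<in> carrier M \<Longrightarrow> \<one>\<^bsub>R\<^esub> \<odot>\<^bsub>M\<^esub> x = x"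
  shows "left_module R M"
  using assms unfolding left_module_def left_module_axioms_def by blast

lemma lmod_homI:
  assumes "h \<in> extensional (carrier M)" "\<And>x. x \<in> carrier M \<Longrightarrow> h x \<in> carrier N"
    and "\<And>x y. x \<in> carrier M \<Longrightarrow> y \<in> carrier M \<Longrightarrow> h (x \<oplus>\<^bsub>M\<^esub> y) = h x \<oplus>\<^bsub>N\<^esub> h y"
    and "\<And>r x. r \<in> carrier R \<Longrightarrow> x \<in> carrier M \<Longrightarrow> h (r \<odot>\<^bsub>M\<^esub> x) = r \<odot>\<^bsub>N\<^esub> h x"
  shows "h \<in> lmod_hom R M N"
  using assms by (auto simp: lmod_hom_def PiE_iff)

lemma lmod_homD:
  assumes "h \<in> lmod_hom R M N"
  shows "h \<in> extensional (carrier M)" "\<And>x. x \<in> carrier M \<Longrightarrow> h x \<in> carrier N"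
    and "\<And>x y. x \<in> carrier M \<Longrightarrow> y \<in> carrier M \<Longrightarrow> h (x \<oplus>\<^bsub>M\<^esub> y) = h x \<oplus>\<^bsub>N\<^esub> h y"
    and "\<And>r x. r \<in> carrier R \<Longrightarrow> x \<in> carrier M \<Longrightarrow> h (r \<odot>\<^bsub>M\<^esub> x) = r \<odot>\<^bsub>N\<^esub> h x"
  using assms by (auto simp: lmod_hom_def PiE_iff)

lemma left_module_smult_zero:
  assumes "left_module S M" "r \<in> carrier S"
  shows "r \<odot>\<^bsub>M\<^esub> \<zero>\<^bsub>M\<^esub> = \<zero>\<^bsub>M\<^esub>"
proof -
  interpret left_module S M by (rule assms)
  have "r \<odot>\<^bsub>M\<^esub> \<zero>\<^bsub>M\<^esub> \<oplus>\<^bsub>M\<^esub> r \<odot>\<^bsub>M\<^esub> \<zero>\<^bsub>M\<^esub> = r \<odot>\<^bsub>M\<^esub> \<zero>\<^bsub>M\<^esub>"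
    using smult_r_distr[of r "\<zero>\<^bsub>M\<^esub>" "\<zero>\<^bsub>M\<^esub>"] assms(2) by simp
  then show ?thesis using assms(2) smult_closed by simp
qed

lemma left_module_smult_minus:
  assumes "left_module S M" "r \<in> carrier S" "x \<in> carrier M"
  shows "r \<odot>\<^bsub>M\<^esub> (\<ominus>\<^bsub>M\<^esub> x) = \<ominus>\<^bsub>M\<^esub> (r \<odot>\<^bsub>M\<^esub> x)"
proof -
  interpret left_module S M by (rule assms)
  have "r \<odot>\<^bsub>M\<^esub> (\<ominus>\<^bsub>M\<^esub> x) \<oplus>\<^bsub>M\<^esub> r \<odot>\<^bsub>M\<^esub> x = \<zero>\<^bsub>M\<^esub>"
    using smult_r_distr[of r "\<ominus>\<^bsub>M\<^esub> x" x] assms by (simp add: M.l_neg left_module_smult_zero)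
  then show ?thesis using assms smult_closed by (simp add: M.minus_equality)
qed

text \<open>Induction produces modules on triples, whereas \<open>morita_equivalent\<close> wants
  source and target modules in the same type; this moves a module along an injection.\<close>

definition encoded_module :: "('w \<Rightarrow> 'u) \<Rightarrow> ('a, 'w) module \<Rightarrow> ('a, 'u) module"
  where "encoded_module e M =
    \<lparr>carrier = e ` carrier M, mult = undefined, one = undefined, zero = e \<zero>\<^bsub>M\<^esub>,
     add = (\<lambda>x y. e (inv_into (carrier M) e x \<oplus>\<^bsub>M\<^esub> inv_into (carrier M) e y)),
     smult = (\<lambda>r x. e (r \<odot>\<^bsub>M\<^esub> inv_into (carrier M) e x))\<rparr>"

lemma encoded_module_simps:
  assumes "inj_on e (carrier M)"
  shows "carrier (encoded_module e M) = e ` carrier M" "zero (encoded_module e M) = e \<zero>\<^bsub>M\<^esub>"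
    "x \<in> carrier M \<Longrightarrow> y \<in> carrier M \<Longrightarrow> e x \<oplus>\<^bsub>encoded_module e M\<^esub> e y = e (x \<oplus>\<^bsub>M\<^esub> y)"
    "x \<in> carrier M \<Longrightarrow> r \<odot>\<^bsub>encoded_module e M\<^esub> e x = e (r \<odot>\<^bsub>M\<^esub> x)"
  using assms by (simp_all add: encoded_module_def)

lemma left_module_encoded:
  assumes M: "left_module R M" and e: "inj_on e (carrier M)"
  shows "left_module R (encoded_module e M)"
proof -
  interpret left_module R M by (rule M)
  note [simp] = encoded_module_simps[OF e] smult_closed smult_l_distr smult_r_distr smult_assoc smult_one
  have "abelian_group (encoded_module e M)"
  proof (rule abelian_groupI)
    fix x assume "x \<in> carrier (encoded_module e M)"
    then obtain a where "x = e a" "a \<in> carrier M" by auto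
    then show "\<exists>y\<in>carrier (encoded_module e M). y \<oplus>\<^bsub>encoded_module e M\<^esub> x = \<zero>\<^bsub>encoded_module e M\<^esub>"
      by (intro bexI[of _ "e (\<ominus>\<^bsub>M\<^esub> a)"]) (auto simp: M.l_neg)
  qed (auto simp: M.a_ac)
  then show ?thesis
    by (intro left_moduleI) (auto simp: R.ring_axioms)
qed

text \<open>With \<open>u k\<close> in Af and \<open>v k\<close> in fA, \<open>uv_sum\<close>
  expresses AfA = A by three terms. \<open>\<psi>\<close> identifies fAf with
  \<open>R\<close>.\<close>

locale full_corner = A: ring A + R: ring R
  for A :: "('a, 'm) ring_scheme" (structure) and R :: "('b, 'n) ring_scheme" +
  fixes f :: 'a and \<psi> :: "'a \<Rightarrow> 'b" and u v :: "nat \<Rightarrow> 'a"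
  assumes f_closed: "f \<in> carrier A"
    and u_closed: "u k \<in> carrier A" and v_closed: "v k \<in> carrier A"
    and f_f: "f \<otimes> f = f" and u_f: "u k \<otimes> f = u k" and f_v: "f \<otimes> v k = v k"
    and uv_sum: "u 0 \<otimes> v 0 \<oplus> (u 1 \<otimes> v 1 \<oplus> u 2 \<otimes> v 2) = \<one>"
    and \<psi>_bij: "bij_betw \<psi> {x \<in> carrier A. f \<otimes> x = x \<and> x \<otimes> f = x} (carrier R)"
    and \<psi>_add: "\<lbrakk>x \<in> carrier A; f \<otimes> x = x; x \<otimes> f = x; y \<in> carrier A; f \<otimes> y = y; y \<otimes> f = y\<rbrakk>
      \<Longrightarrow> \<psi> (x \<oplus> y) = \<psi> x \<oplus>\<^bsub>R\<^esub> \<psi> y"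
    and \<psi>_mult: "\<lbrakk>x \<in> carrier A; f \<otimes> x = x; x \<otimes> f = x; y \<in> carrier A; f \<otimes> y = y; y \<otimes> f = y\<rbrakk>
      \<Longrightarrow> \<psi> (x \<otimes> y) = \<psi> x \<otimes>\<^bsub>R\<^esub> \<psi> y"
    and \<psi>_f: "\<psi> f = \<one>\<^bsub>R\<^esub>"
begin

declare One_nat_def [simp del]

definition corner :: "'a set"
  where "corner = {x \<in> carrier A. f \<otimes> x = x \<and> x \<otimes> f = x}"

definition \<psi>_inv :: "'b \<Rightarrow> 'a" where "\<psi>_inv = inv_into corner \<psi>"

lemma corner_closed: "x \<in> corner \<Longrightarrow> x \<in> carrier A"
  by (simp add: corner_def)

lemma f_corner: "f \<in> corner" by (simp add: corner_def f_closed f_f)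

lemma cornerI: "b \<in> carrier A \<Longrightarrow> f \<otimes> b = b \<Longrightarrow> c \<in> carrier A \<Longrightarrow> c \<otimes> f = c \<Longrightarrow> b \<otimes> c \<in> corner"
  by (simp add: corner_def A.m_assoc f_closed) (simp add: A.m_assoc[symmetric] f_closed)

lemma corner_add: "x \<in> corner \<Longrightarrow> y \<in> corner \<Longrightarrow> x \<oplus> y \<in> corner"
  by (simp add: corner_def A.l_distr A.r_distr f_closed)

lemma corner_mult: "x \<in> corner \<Longrightarrow> y \<in> corner \<Longrightarrow> x \<otimes> y \<in> corner"
  by (rule cornerI) (simp_all add: corner_def)

lemma \<psi>_closed: "x \<in> corner \<Longrightarrow> \<psi> x \<in> carrier R"
  using \<psi>_bij by (auto simp: corner_def bij_betw_def)

lemma \<psi>_plus: "x \<in> corner \<Longrightarrow> y \<in> corner \<Longrightarrow> \<psi> (x \<oplus> y) = \<psi> x \<oplus>\<^bsub>R\<^esub> \<psi> y"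
  by (simp add: corner_def \<psi>_add)

lemma \<psi>_times: "x \<in> corner \<Longrightarrow> y \<in> corner \<Longrightarrow> \<psi> (x \<otimes> y) = \<psi> x \<otimes>\<^bsub>R\<^esub> \<psi> y"
  by (simp add: corner_def \<psi>_mult)

lemma \<psi>_inv_closed: "r \<in> carrier R \<Longrightarrow> \<psi>_inv r \<in> corner"
  using \<psi>_bij unfolding \<psi>_inv_def corner_def[symmetric]
  by (metis bij_betw_imp_surj_on inv_into_into)

lemma \<psi>_inv [simp]: "r \<in> carrier R \<Longrightarrow> \<psi> (\<psi>_inv r) = r"
  using \<psi>_bij unfolding \<psi>_inv_def corner_def[symmetric]
  by (metis bij_betw_imp_surj_on f_inv_into_f)

lemma \<psi>_inv_\<psi> [simp]: "x \<in> corner \<Longrightarrow> \<psi>_inv (\<psi> x) = x"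
  using \<psi>_bij unfolding \<psi>_inv_def corner_def[symmetric]
  by (simp add: bij_betw_def)

lemma \<psi>_inv_eqI: "r \<in> carrier R \<Longrightarrow> x \<in> corner \<Longrightarrow> \<psi> x = r \<Longrightarrow> \<psi>_inv r = x"
  by auto

lemma \<psi>_inv_add: "r \<in> carrier R \<Longrightarrow> s \<in> carrier R \<Longrightarrow> \<psi>_inv (r \<oplus>\<^bsub>R\<^esub> s) = \<psi>_inv r \<oplus> \<psi>_inv s"
  by (intro \<psi>_inv_eqI) (simp_all add: \<psi>_inv_closed corner_add \<psi>_plus)

lemma \<psi>_inv_mult: "r \<in> carrier R \<Longrightarrow> s \<in> carrier R \<Longrightarrow> \<psi>_inv (r \<otimes>\<^bsub>R\<^esub> s) = \<psi>_inv r \<otimes> \<psi>_inv s"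
  by (intro \<psi>_inv_eqI) (simp_all add: \<psi>_inv_closed corner_mult \<psi>_times)

lemma \<psi>_inv_one: "\<psi>_inv \<one>\<^bsub>R\<^esub> = f"
  by (intro \<psi>_inv_eqI) (simp_all add: f_corner \<psi>_f)

subsection \<open>Restriction to the corner\<close>

definition corner_mod :: "('a, 'u) module \<Rightarrow> ('b, 'u) module"
  where "corner_mod M = \<lparr>carrier = {m \<in> carrier M. f \<odot>\<^bsub>M\<^esub> m = m}, mult = undefined, one = undefined,
    zero = \<zero>\<^bsub>M\<^esub>, add = add M, smult = (\<lambda>r m. \<psi>_inv r \<odot>\<^bsub>M\<^esub> m)\<rparr>"

lemma left_module_corner_mod:
  assumes "left_module A M"
  shows "left_module R (corner_mod M)"
proof -
  interpret M: left_module A M by (rule assms)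
  note [simp] = M.smult_closed f_closed
  have sub: "\<psi>_inv r \<odot>\<^bsub>M\<^esub> m \<in> carrier M" "f \<odot>\<^bsub>M\<^esub> (\<psi>_inv r \<odot>\<^bsub>M\<^esub> m) = \<psi>_inv r \<odot>\<^bsub>M\<^esub> m"
    if "r \<in> carrier R" "m \<in> carrier M" for r m
    using \<psi>_inv_closed[OF that(1)] that by (simp_all add: corner_def M.smult_assoc[symmetric])
  have "abelian_group (corner_mod M)"
  proof (rule abelian_groupI)
    fix x assume "x \<in> carrier (corner_mod M)"
    then show "\<exists>y\<in>carrier (corner_mod M). y \<oplus>\<^bsub>corner_mod M\<^esub> x = \<zero>\<^bsub>corner_mod M\<^esub>"
      by (intro bexI[of _ "\<ominus>\<^bsub>M\<^esub> x"])
        (auto simp: corner_mod_def M.M.l_neg left_module_smult_minus[OF assms])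
  qed (auto simp: corner_mod_def M.M.a_ac M.smult_r_distr left_module_smult_zero[OF assms])
  then show ?thesis
    using \<psi>_inv_closed[THEN corner_closed]
    by (intro left_moduleI R.ring_axioms)
      (auto simp: corner_mod_def sub M.smult_l_distr M.smult_r_distr M.smult_assoc \<psi>_inv_add \<psi>_inv_mult \<psi>_inv_one)
qed

definition corner_mor :: "('a, 'u) mor_map"
  where "corner_mor M N h = restrict h (carrier (corner_mod M))"

lemma corner_functor: "lmod_functor A R corner_mod corner_mor"
  unfolding lmod_functor_def
proof (intro conjI allI impI ballI)
  fix M :: "('a, 'u) module" assume "left_module A M"
  then show "left_module R (corner_mod M)" by (rule left_module_corner_mod)
next
  fix M N :: "('a, 'u) module" and h assume M: "left_module A M" "left_module A N" and h: "h \<in> lmod_hom A M N"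
  note mod = left_module.smult_closed[OF M(1)] left_module_corner_mod[OF M(1)] lmod_homD[OF h]
  note closed = left_module.smult_closed[OF left_module_corner_mod[OF M(1)]]
    abelian_monoid.a_closed[OF abelian_group.axioms(1)[OF left_module.axioms(2)[OF left_module_corner_mod[OF M(1)]]]]
  have "h x \<in> carrier (corner_mod N)" if "x \<in> carrier (corner_mod M)" for x
    using that mod(4) mod(6)[of f x] f_closed by (simp add: corner_mod_def)
  then show "corner_mor M N h \<in> lmod_hom R (corner_mod M) (corner_mod N)"
    using mod(5,6) closed \<psi>_inv_closed[THEN corner_closed]
    by (intro lmod_homI) (auto simp: corner_mor_def corner_mod_def)
next
  fix M :: "('a, 'u) module"
  show "corner_mor M M (\<lambda>x\<in>carrier M. x) = (\<lambda>x\<in>carrier (corner_mod M). x)"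
    by (auto simp: corner_mor_def corner_mod_def)
next
  fix L M N :: "('a, 'u) module" and g h
  assume "left_module A L" "left_module A M" "left_module A N" and g: "g \<in> lmod_hom A L M"
  show "corner_mor L N (compose (carrier L) h g) =
    compose (carrier (corner_mod L)) (corner_mor M N h) (corner_mor L M g)"
    using lmod_homD[OF g] f_closed
    by (auto simp: corner_mor_def corner_mod_def compose_def fun_eq_iff restrict_def)
      metis+
qed


subsection \<open>Induction from the corner\<close>

text \<open>A module \<open>N\<close> over the corner is induced to the image of the idempotent matrix \<open>(v k * u l)\<close>
  acting on \<open>N\<^sup>3\<close>, on which \<open>a\<close> acts by the matrix \<open>(v k * a * u l)\<close>.\<close>

fun comb :: "('b, 'u) module \<Rightarrow> 'a \<Rightarrow> 'u \<times> 'u \<times> 'u \<Rightarrow> 'u"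
  where "comb N b (x0, x1, x2) = \<psi> (b \<otimes> u 0) \<odot>\<^bsub>N\<^esub> x0 \<oplus>\<^bsub>N\<^esub>
    (\<psi> (b \<otimes> u 1) \<odot>\<^bsub>N\<^esub> x1 \<oplus>\<^bsub>N\<^esub> \<psi> (b \<otimes> u 2) \<odot>\<^bsub>N\<^esub> x2)"

text \<open>A triple X stands for the sum of the u_k \<otimes> x_k in Af \<otimes> N. For b in fA,
  \<open>comb N b X\<close> is b times this tensor, an element of fAf \<otimes> N = N; the
  coordinates of a tensor are its values at the \<open>v k\<close>.\<close>

definition act :: "('b, 'u) module \<Rightarrow> 'a \<Rightarrow> 'u \<times> 'u \<times> 'u \<Rightarrow> 'u \<times> 'u \<times> 'u"
  where "act N a X = (comb N (v 0 \<otimes> a) X, comb N (v 1 \<otimes> a) X, comb N (v 2 \<otimes> a) X)"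

fun add3 :: "('b, 'u) module \<Rightarrow> 'u \<times> 'u \<times> 'u \<Rightarrow> 'u \<times> 'u \<times> 'u \<Rightarrow> 'u \<times> 'u \<times> 'u"
  where "add3 N (x0, x1, x2) (y0, y1, y2) = (x0 \<oplus>\<^bsub>N\<^esub> y0, x1 \<oplus>\<^bsub>N\<^esub> y1, x2 \<oplus>\<^bsub>N\<^esub> y2)"

definition cube :: "('b, 'u) module \<Rightarrow> ('u \<times> 'u \<times> 'u) set"
  where "cube N = carrier N \<times> carrier N \<times> carrier N"

lemma cube_iff: "(x, y, z) \<in> cube N \<longleftrightarrow> x \<in> carrier N \<and> y \<in> carrier N \<and> z \<in> carrier N"
  by (simp add: cube_def)

definition ind_mod :: "('b, 'u) module \<Rightarrow> ('a, 'u \<times> 'u \<times> 'u) module"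
  where "ind_mod N = \<lparr>carrier = {X \<in> cube N. act N \<one> X = X}, mult = undefined, one = undefined,
    zero = (\<zero>\<^bsub>N\<^esub>, \<zero>\<^bsub>N\<^esub>, \<zero>\<^bsub>N\<^esub>), add = add3 N, smult = act N\<rparr>"

text \<open>The coordinates of f \<otimes> n.\<close>

definition emb :: "('b, 'u) module \<Rightarrow> 'u \<Rightarrow> 'u \<times> 'u \<times> 'u"
  where "emb N n = (\<psi> (v 0 \<otimes> f) \<odot>\<^bsub>N\<^esub> n, \<psi> (v 1 \<otimes> f) \<odot>\<^bsub>N\<^esub> n, \<psi> (v 2 \<otimes> f) \<odot>\<^bsub>N\<^esub> n)"

text \<open>The right ideal fA. For b in it each \<open>b \<otimes> u k\<close> lies in the corner,
  where \<open>\<psi>\<close> is a homomorphism.\<close>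

definition left_f :: "'a set" where "left_f = {b \<in> carrier A. f \<otimes> b = b}"

lemma left_f_rules:
  "b \<in> left_f \<Longrightarrow> b \<in> carrier A" "v k \<in> left_f" "f \<in> left_f"
  "b \<in> left_f \<Longrightarrow> a \<in> carrier A \<Longrightarrow> b \<otimes> a \<in> left_f"
  "b \<in> left_f \<Longrightarrow> c \<in> left_f \<Longrightarrow> b \<oplus> c \<in> left_f"
  "d \<in> corner \<Longrightarrow> b \<in> left_f \<Longrightarrow> d \<otimes> b \<in> left_f"
  "b \<in> left_f \<Longrightarrow> b \<otimes> u k \<in> corner"
  "b \<in> left_f \<Longrightarrow> b \<otimes> f \<in> corner"
  "d \<in> corner \<Longrightarrow> d \<in> left_f"
  using f_closed u_closed v_closed f_f f_v u_f
  by (auto simp: left_f_def A.r_distr corner_def A.m_assoc[symmetric]) (auto simp: A.m_assoc)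

context
  fixes N :: "('b, 'u) module"
  assumes N: "left_module R N"
begin

interpretation N: left_module R N by (rule N)

lemma comb_closed: "b \<in> left_f \<Longrightarrow> X \<in> cube N \<Longrightarrow> comb N b X \<in> carrier N"
  by (cases X) (auto simp: cube_def N.smult_closed \<psi>_closed left_f_rules)

lemma comb_add3: "b \<in> left_f \<Longrightarrow> X \<in> cube N \<Longrightarrow> Y \<in> cube N \<Longrightarrow>
    comb N b (add3 N X Y) = comb N b X \<oplus>\<^bsub>N\<^esub> comb N b Y"
  by (cases X; cases Y)
    (simp add: cube_def N.smult_closed \<psi>_closed left_f_rules N.smult_r_distr N.M.a_ac)

lemma comb_add_left: "b \<in> left_f \<Longrightarrow> c \<in> left_f \<Longrightarrow> X \<in> cube N \<Longrightarrow>
    comb N (b \<oplus> c) X = comb N b X \<oplus>\<^bsub>N\<^esub> comb N c X"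
  by (cases X)
    (simp add: cube_def N.smult_closed \<psi>_closed left_f_rules N.smult_l_distr N.M.a_ac A.l_distr u_closed \<psi>_plus)

lemma comb_smult: "d \<in> corner \<Longrightarrow> b \<in> left_f \<Longrightarrow> X \<in> cube N \<Longrightarrow>
    \<psi> d \<odot>\<^bsub>N\<^esub> comb N b X = comb N (d \<otimes> b) X"
  by (cases X)
    (simp add: cube_def N.smult_closed \<psi>_closed left_f_rules N.smult_r_distr A.m_assoc u_closed
      corner_closed \<psi>_times N.smult_assoc)

lemma act_closed: "a \<in> carrier A \<Longrightarrow> X \<in> cube N \<Longrightarrow> act N a X \<in> cube N"
  by (simp add: act_def cube_iff comb_closed left_f_rules)

text \<open>Inserts 1 = sum of the u_k v_k between b and a. All module laws of the induced module,
  and the idempotence of \<open>act N \<one>\<close>, come from this.\<close>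

lemma comb_act:
  assumes b: "b \<in> left_f" and a: "a \<in> carrier A" and X: "X \<in> cube N"
  shows "comb N b (act N a X) = comb N (b \<otimes> a) X"
proof -
  let ?w = "\<lambda>k. b \<otimes> u k \<otimes> (v k \<otimes> a)"
  have w: "?w k \<in> left_f" for k using a b by (simp add: left_f_rules)
  have cA: "b \<in> carrier A" using b by (rule left_f_rules)
  have "comb N b (act N a X) = comb N (?w 0) X \<oplus>\<^bsub>N\<^esub> (comb N (?w 1) X \<oplus>\<^bsub>N\<^esub> comb N (?w 2) X)"
    using a b X by (simp add: act_def comb_smult left_f_rules)
  also have "\<dots> = comb N (?w 0 \<oplus> (?w 1 \<oplus> ?w 2)) X"
    using w X by (simp add: comb_add_left left_f_rules(5))
  also have "?w 0 \<oplus> (?w 1 \<oplus> ?w 2) =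
    b \<otimes> (u 0 \<otimes> v 0 \<oplus> (u 1 \<otimes> v 1 \<oplus> u 2 \<otimes> v 2)) \<otimes> a"
    using a cA u_closed v_closed by (simp only: A.r_distr A.l_distr A.m_assoc A.m_closed A.a_closed)
  also have "\<dots> = b \<otimes> a" using a cA by (simp only: uv_sum A.r_one)
  finally show ?thesis .
qed

lemma act_act: "a \<in> carrier A \<Longrightarrow> b \<in> carrier A \<Longrightarrow> X \<in> cube N \<Longrightarrow>
    act N a (act N b X) = act N (a \<otimes> b) X"
  unfolding act_def[of N a] act_def[of N "a \<otimes> b"]
  by (simp add: comb_act left_f_rules A.m_assoc v_closed)

lemma act_add_left: "a \<in> carrier A \<Longrightarrow> b \<in> carrier A \<Longrightarrow> X \<in> cube N \<Longrightarrow>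
    act N (a \<oplus> b) X = add3 N (act N a X) (act N b X)"
  by (simp add: act_def comb_add_left left_f_rules A.r_distr v_closed)

lemma act_add3: "a \<in> carrier A \<Longrightarrow> X \<in> cube N \<Longrightarrow> Y \<in> cube N \<Longrightarrow>
    act N a (add3 N X Y) = add3 N (act N a X) (act N a Y)"
  by (simp add: act_def comb_add3 left_f_rules)

lemma comb_zero: "X \<in> cube N \<Longrightarrow> comb N \<zero> X = \<zero>\<^bsub>N\<^esub>"
proof -
  assume X: "X \<in> cube N"
  have 0: "\<zero> \<in> left_f" by (simp add: left_f_def f_closed)
  have "comb N \<zero> X \<oplus>\<^bsub>N\<^esub> comb N \<zero> X = comb N \<zero> X"
    using comb_add_left[OF 0 0 X] by simp
  then show ?thesis using comb_closed[OF 0 X] by simp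
qed

lemma left_module_ind_mod: "left_module A (ind_mod N)"
proof -
  have cube_add: "add3 N X Y \<in> cube N" if "X \<in> cube N" "Y \<in> cube N" for X Y
    using that by (cases X; cases Y) (simp add: cube_def)
  have add3_ac: "add3 N (add3 N X Y) Z = add3 N X (add3 N Y Z)" "add3 N X Y = add3 N Y X"
    "add3 N (\<zero>\<^bsub>N\<^esub>, \<zero>\<^bsub>N\<^esub>, \<zero>\<^bsub>N\<^esub>) X = X"
    if "X \<in> cube N" "Y \<in> cube N" "Z \<in> cube N" for X Y Z
    using that by (cases X; cases Y; cases Z; simp add: cube_def N.M.a_ac)+
  have zero: "act N a (\<zero>\<^bsub>N\<^esub>, \<zero>\<^bsub>N\<^esub>, \<zero>\<^bsub>N\<^esub>) = (\<zero>\<^bsub>N\<^esub>, \<zero>\<^bsub>N\<^esub>, \<zero>\<^bsub>N\<^esub>)" if "a \<in> carrier A" for a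
    using that by (simp add: act_def left_module_smult_zero[OF N] \<psi>_closed left_f_rules)
  have inv: "\<exists>Y\<in>carrier (ind_mod N). add3 N Y X = (\<zero>\<^bsub>N\<^esub>, \<zero>\<^bsub>N\<^esub>, \<zero>\<^bsub>N\<^esub>)" if "X \<in> carrier (ind_mod N)" for X
  proof
    have X: "X \<in> cube N" "act N \<one> X = X" using that by (auto simp: ind_mod_def)
    \<comment> \<open>The negative is taken as the action of -1, because \<open>act_act\<close> then
      shows at once that it is fixed by \<open>act N \<one>\<close>.\<close>
    show "act N (\<ominus> \<one>) X \<in> carrier (ind_mod N)"
      using X by (simp add: ind_mod_def act_closed act_act)
    have "add3 N (act N (\<ominus> \<one>) X) (act N \<one> X) = act N \<zero> X"
      using X(1) by (simp only: act_add_left[symmetric] A.one_closed A.a_inv_closed A.l_neg)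
    also have "\<dots> = (\<zero>\<^bsub>N\<^esub>, \<zero>\<^bsub>N\<^esub>, \<zero>\<^bsub>N\<^esub>)" using X by (simp add: act_def v_closed comb_zero)
    finally show "add3 N (act N (\<ominus> \<one>) X) X = (\<zero>\<^bsub>N\<^esub>, \<zero>\<^bsub>N\<^esub>, \<zero>\<^bsub>N\<^esub>)" using X by simp
  qed
  have "abelian_group (ind_mod N)"
    using inv by (intro abelian_groupI)
      (auto simp: ind_mod_def cube_add act_add3 add3_ac zero cube_def[symmetric], auto simp: cube_def N.M.a_comm)
  then show ?thesis
    by (intro left_moduleI A.ring_axioms)
      (auto simp: ind_mod_def act_closed act_act act_add_left act_add3)
qed

lemma comb_emb: "b \<in> left_f \<Longrightarrow> n \<in> carrier N \<Longrightarrow> comb N b (emb N n) = \<psi> (b \<otimes> f) \<odot>\<^bsub>N\<^esub> n"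
proof -
  assume b: "b \<in> left_f" and n: "n \<in> carrier N"
  let ?w = "\<lambda>k. b \<otimes> u k \<otimes> (v k \<otimes> f)"
  have w: "?w k \<in> corner" for k
    using left_f_rules(7)[OF b] left_f_rules(8)[OF left_f_rules(2)] by (rule corner_mult)
  have cA: "b \<in> carrier A" using b by (rule left_f_rules)
  have "comb N b (emb N n) = \<psi> (?w 0) \<odot>\<^bsub>N\<^esub> n \<oplus>\<^bsub>N\<^esub> (\<psi> (?w 1) \<odot>\<^bsub>N\<^esub> n \<oplus>\<^bsub>N\<^esub> \<psi> (?w 2) \<odot>\<^bsub>N\<^esub> n)"
    using b n by (simp add: emb_def \<psi>_times left_f_rules N.smult_assoc \<psi>_closed)
  also have "\<dots> = \<psi> (?w 0 \<oplus> (?w 1 \<oplus> ?w 2)) \<odot>\<^bsub>N\<^esub> n"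
    using w n by (simp add: \<psi>_plus corner_add N.smult_l_distr \<psi>_closed)
  also have "?w 0 \<oplus> (?w 1 \<oplus> ?w 2) =
    b \<otimes> (u 0 \<otimes> v 0 \<oplus> (u 1 \<otimes> v 1 \<oplus> u 2 \<otimes> v 2)) \<otimes> f"
    using f_closed cA u_closed v_closed by (simp only: A.r_distr A.l_distr A.m_assoc A.m_closed A.a_closed)
  also have "\<dots> = b \<otimes> f" using f_closed cA by (simp only: uv_sum A.r_one)
  finally show ?thesis .
qed

lemma act_emb: "a \<in> carrier A \<Longrightarrow> n \<in> carrier N \<Longrightarrow> act N a (emb N n) =
  (\<psi> (v 0 \<otimes> a \<otimes> f) \<odot>\<^bsub>N\<^esub> n, \<psi> (v 1 \<otimes> a \<otimes> f) \<odot>\<^bsub>N\<^esub> n, \<psi> (v 2 \<otimes> a \<otimes> f) \<odot>\<^bsub>N\<^esub> n)"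
  by (simp add: act_def comb_emb left_f_rules)

lemma emb_closed: "n \<in> carrier N \<Longrightarrow> emb N n \<in> carrier (ind_mod N)"
  by (simp add: ind_mod_def act_emb v_closed)
    (simp add: emb_def cube_def N.smult_closed \<psi>_closed left_f_rules)

lemma act_f_emb: "n \<in> carrier N \<Longrightarrow> act N f (emb N n) = emb N n"
  by (simp add: act_emb f_closed v_closed A.m_assoc f_f) (simp add: emb_def)

lemma emb_add: "n \<in> carrier N \<Longrightarrow> n' \<in> carrier N \<Longrightarrow> emb N (n \<oplus>\<^bsub>N\<^esub> n') = add3 N (emb N n) (emb N n')"
  by (simp add: emb_def N.smult_r_distr \<psi>_closed left_f_rules)

lemma emb_smult:
  assumes "r \<in> carrier R" "n \<in> carrier N"
  shows "emb N (r \<odot>\<^bsub>N\<^esub> n) = act N (\<psi>_inv r) (emb N n)"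
proof -
  let ?b = "\<psi>_inv r"
  have b: "?b \<in> corner" using assms by (simp add: \<psi>_inv_closed)
  have "\<psi> (v k \<otimes> f) \<odot>\<^bsub>N\<^esub> (r \<odot>\<^bsub>N\<^esub> n) = \<psi> (v k \<otimes> ?b \<otimes> f) \<odot>\<^bsub>N\<^esub> n" for k
  proof -
    have "v k \<otimes> ?b \<otimes> f = v k \<otimes> f \<otimes> ?b"
      using b v_closed f_closed by (simp add: corner_def A.m_assoc)
    then have "\<psi> (v k \<otimes> ?b \<otimes> f) = \<psi> (v k \<otimes> f) \<otimes>\<^bsub>R\<^esub> r"
      using b assms(1) by (simp add: \<psi>_times left_f_rules)
    then show ?thesis using assms by (simp add: N.smult_assoc \<psi>_closed left_f_rules)
  qed
  then show ?thesis
    using b assms by (simp add: act_emb corner_closed) (simp add: emb_def)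
qed

text \<open>With \<open>emb_comb_f\<close> this makes \<open>emb\<close> and \<open>comb N f\<close>
  inverse to each other between N and the f-part of the induced module.\<close>

lemma comb_f_emb: "n \<in> carrier N \<Longrightarrow> comb N f (emb N n) = n"
  by (simp add: comb_emb left_f_rules f_f \<psi>_f N.smult_one)

lemma emb_comb_f: "X \<in> cube N \<Longrightarrow> emb N (comb N f X) = act N f X"
  by (simp add: emb_def act_def comb_smult left_f_rules A.m_assoc f_closed v_closed f_f)

end

section \<open>Functoriality of induction and encoding into the type of the given module\<close>

fun map3 :: "('u \<Rightarrow> 'w) \<Rightarrow> 'u \<times> 'u \<times> 'u \<Rightarrow> 'w \<times> 'w \<times> 'w"
  where "map3 h (x, y, z) = (h x, h y, h z)"

lemma map3_comb:
  assumes "left_module R N" "h \<in> lmod_hom R N N'" "b \<in> left_f" "X \<in> cube N"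
  shows "comb N' b (map3 h X) = h (comb N b X)"
proof -
  interpret N: left_module R N by (rule assms)
  show ?thesis using assms(3,4)
    by (cases X) (simp add: cube_def lmod_homD[OF assms(2)] N.smult_closed \<psi>_closed left_f_rules)
qed

lemma map3_act:
  assumes "left_module R N" "h \<in> lmod_hom R N N'" "a \<in> carrier A" "X \<in> cube N"
  shows "act N' a (map3 h X) = map3 h (act N a X)"
  using assms by (simp add: act_def map3_comb left_f_rules)

lemma map3_closed:
  assumes "left_module R N" "h \<in> lmod_hom R N N'" "X \<in> carrier (ind_mod N)"
  shows "map3 h X \<in> carrier (ind_mod N')"
  using map3_act[OF assms(1,2) A.one_closed] assms(3) lmod_homD(2)[OF assms(2)]
  by (cases X) (auto simp: ind_mod_def cube_def)

lemma map3_add3: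
  assumes "h \<in> lmod_hom R N N'" "X \<in> cube N" "Y \<in> cube N"
  shows "map3 h (add3 N X Y) = add3 N' (map3 h X) (map3 h Y)"
  using assms(2,3) by (cases X; cases Y) (simp add: cube_def lmod_homD[OF assms(1)])

lemma map3_emb:
  assumes "left_module R N" "h \<in> lmod_hom R N N'" "n \<in> carrier N"
  shows "map3 h (emb N n) = emb N' (h n)"
  using assms(3) by (simp add: emb_def lmod_homD[OF assms(2)] \<psi>_closed left_f_rules)


text \<open>The encoding is chosen separately for each module, so morphisms have to decode with one
  encoding and encode with another.\<close>

definition cube_code :: "('b, 'u) module \<Rightarrow> 'u \<times> 'u \<times> 'u \<Rightarrow> 'u"
  where "cube_code N = (SOME e. inj_on e (cube N))"

definition cube_decode :: "('b, 'u) module \<Rightarrow> 'u \<Rightarrow> 'u \<times> 'u \<times> 'u"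
  where "cube_decode N = inv_into (carrier (ind_mod N)) (cube_code N)"

definition ind_obj :: "('b, 'u) module \<Rightarrow> ('a, 'u) module"
  where "ind_obj N = encoded_module (cube_code N) (ind_mod N)"

definition ind_mor :: "('b, 'u) mor_map"
  where "ind_mor N N' h = (\<lambda>y\<in>carrier (ind_obj N). cube_code N' (map3 h (cube_decode N y)))"

definition corner_unit :: "('b, 'u) module \<Rightarrow> 'u \<Rightarrow> 'u"
  where "corner_unit N = (\<lambda>n\<in>carrier N. cube_code N (emb N n))"

text \<open>Since m is the sum of the u_k (v_k m), its coordinates in Af \<otimes> fM are the v_k
  m.\<close>

definition ind_unit :: "('a, 'u) module \<Rightarrow> 'u \<Rightarrow> 'u"
  where "ind_unit M = (\<lambda>m\<in>carrier M. cube_code (corner_mod M) (v 0 \<odot>\<^bsub>M\<^esub> m, v 1 \<odot>\<^bsub>M\<^esub> m, v 2 \<odot>\<^bsub>M\<^esub> m))"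

lemma corner_mod_simps:
  "carrier (corner_mod M) = {m \<in> carrier M. f \<odot>\<^bsub>M\<^esub> m = m}" "zero (corner_mod M) = \<zero>\<^bsub>M\<^esub>"
  "add (corner_mod M) = add M" "smult (corner_mod M) = (\<lambda>r m. \<psi>_inv r \<odot>\<^bsub>M\<^esub> m)"
  by (simp_all add: corner_mod_def)

lemma ind_mod_simps:
  "carrier (ind_mod N) = {X \<in> cube N. act N \<one> X = X}" "add (ind_mod N) = add3 N" "smult (ind_mod N) = act N"
  by (simp_all add: ind_mod_def)

context
  assumes code_ex: "\<And>N :: ('b, 'u) module. left_module R N \<Longrightarrow> \<exists>e :: 'u \<times> 'u \<times> 'u \<Rightarrow> 'u. inj_on e (cube N)"
begin

lemma cube_code_inj: "left_module R (N :: ('b, 'u) module) \<Longrightarrow> inj_on (cube_code N) (carrier (ind_mod N))"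
  using someI_ex[OF code_ex[of N]] unfolding cube_code_def[symmetric] ind_mod_simps
  by (auto intro: inj_on_subset)

lemma cube_decode_code:
  "left_module R (N :: ('b, 'u) module) \<Longrightarrow> X \<in> carrier (ind_mod N) \<Longrightarrow> cube_decode N (cube_code N X) = X"
  by (simp add: cube_decode_def cube_code_inj)

lemma cube_code_eq_iff:
  "left_module R (N :: ('b, 'u) module) \<Longrightarrow> X \<in> carrier (ind_mod N) \<Longrightarrow> Y \<in> carrier (ind_mod N) \<Longrightarrow>
    cube_code N X = cube_code N Y \<longleftrightarrow> X = Y"
  using cube_code_inj[of N] by (auto simp: inj_on_def)

lemma ind_obj_simps:
  assumes "left_module R (N :: ('b, 'u) module)"
  shows "carrier (ind_obj N) = cube_code N ` carrier (ind_mod N)"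
    "X \<in> carrier (ind_mod N) \<Longrightarrow> Y \<in> carrier (ind_mod N) \<Longrightarrow>
      cube_code N X \<oplus>\<^bsub>ind_obj N\<^esub> cube_code N Y = cube_code N (add3 N X Y)"
    "X \<in> carrier (ind_mod N) \<Longrightarrow> a \<odot>\<^bsub>ind_obj N\<^esub> cube_code N X = cube_code N (act N a X)"
  unfolding ind_obj_def
  by (simp_all add: encoded_module_simps[OF cube_code_inj[OF assms]] ind_mod_simps(2,3))

lemma ind_mor_code:
  assumes "left_module R (N :: ('b, 'u) module)" "X \<in> carrier (ind_mod N)"
  shows "ind_mor N N' h (cube_code N X) = cube_code N' (map3 h X)"
  using assms by (simp add: ind_mor_def ind_obj_simps cube_decode_code)

lemma ind_mod_closed:
  assumes "left_module R (N :: ('b, 'u) module)" "X \<in> carrier (ind_mod N)" "Y \<in> carrier (ind_mod N)"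
  shows "add3 N X Y \<in> carrier (ind_mod N)" "a \<in> carrier A \<Longrightarrow> act N a X \<in> carrier (ind_mod N)"
proof -
  interpret I: left_module A "ind_mod N" by (rule left_module_ind_mod[OF assms(1)])
  show "add3 N X Y \<in> carrier (ind_mod N)" "a \<in> carrier A \<Longrightarrow> act N a X \<in> carrier (ind_mod N)"
    using I.M.a_closed[OF assms(2,3)] I.smult_closed[OF _ assms(2)] by (simp_all add: ind_mod_def)
qed

lemma ind_functor: "lmod_functor R A (ind_obj :: ('b, 'a, 'u) obj_map) ind_mor"
  unfolding lmod_functor_def
proof (intro conjI allI impI ballI)
  fix N :: "('b, 'u) module" assume N: "left_module R N"
  then show "left_module A (ind_obj N)"
    unfolding ind_obj_def by (intro left_module_encoded left_module_ind_mod cube_code_inj)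
  show "ind_mor N N (\<lambda>x\<in>carrier N. x) = (\<lambda>x\<in>carrier (ind_obj N). x)"
  proof
    fix y show "ind_mor N N (\<lambda>x\<in>carrier N. x) y = (\<lambda>x\<in>carrier (ind_obj N). x) y"
    proof (cases "y \<in> carrier (ind_obj N)")
      case True
      then obtain X where y: "y = cube_code N X" and X: "X \<in> carrier (ind_mod N)"
        by (auto simp: ind_obj_simps[OF N])
      then have "map3 (\<lambda>x\<in>carrier N. x) X = X" by (cases X) (simp add: ind_mod_simps cube_iff)
      then show ?thesis using True by (simp add: y ind_mor_code[OF N X])
    qed (simp add: ind_mor_def)
  qed
next
  fix N N' :: "('b, 'u) module" and h
  assume N: "left_module R N" and N': "left_module R N'" and h: "h \<in> lmod_hom R N N'"
  show "ind_mor N N' h \<in> lmod_hom A (ind_obj N) (ind_obj N')"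
  proof (rule lmod_homI)
    show "ind_mor N N' h \<in> extensional (carrier (ind_obj N))" by (simp add: ind_mor_def)
  next
    fix y assume "y \<in> carrier (ind_obj N)"
    then obtain X where "y = cube_code N X" "X \<in> carrier (ind_mod N)"
      by (auto simp: ind_obj_simps(1)[OF N])
    then show "ind_mor N N' h y \<in> carrier (ind_obj N')"
      by (simp add: ind_obj_simps(1)[OF N'] ind_mor_code[OF N] map3_closed[OF N h])
  next
    fix y z assume "y \<in> carrier (ind_obj N)" "z \<in> carrier (ind_obj N)"
    then obtain X Y where *: "y = cube_code N X" "z = cube_code N Y" "X \<in> carrier (ind_mod N)" "Y \<in> carrier (ind_mod N)"
      by (auto simp: ind_obj_simps(1)[OF N])
    then have "map3 h (add3 N X Y) = add3 N' (map3 h X) (map3 h Y)"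
      using map3_add3[OF h] by (simp add: ind_mod_simps)
    with * show "ind_mor N N' h (y \<oplus>\<^bsub>ind_obj N\<^esub> z) = ind_mor N N' h y \<oplus>\<^bsub>ind_obj N'\<^esub> ind_mor N N' h z"
      by (simp add: ind_obj_simps[OF N] ind_obj_simps[OF N'] ind_mor_code[OF N] ind_mod_closed[OF N] map3_closed[OF N h])
  next
    fix a y assume "y \<in> carrier (ind_obj N)" and a: "a \<in> carrier A"
    then obtain X where *: "y = cube_code N X" "X \<in> carrier (ind_mod N)"
      by (auto simp: ind_obj_simps(1)[OF N])
    then have "act N' a (map3 h X) = map3 h (act N a X)"
      using map3_act[OF N h a] by (simp add: ind_mod_simps)
    with * a show "ind_mor N N' h (a \<odot>\<^bsub>ind_obj N\<^esub> y) = a \<odot>\<^bsub>ind_obj N'\<^esub> ind_mor N N' h y"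
      using ind_mod_closed(2)[OF N *(2) *(2) a]
      by (simp add: ind_obj_simps[OF N] ind_obj_simps[OF N'] ind_mor_code[OF N] map3_closed[OF N h])
  qed
next
  fix L M N :: "('b, 'u) module" and g h
  assume L: "left_module R L" and M: "left_module R M" and g: "g \<in> lmod_hom R L M"
  show "ind_mor L N (compose (carrier L) h g) =
    compose (carrier (ind_obj L)) (ind_mor M N h) (ind_mor L M g)"
  proof
    fix y show "ind_mor L N (compose (carrier L) h g) y =
      compose (carrier (ind_obj L)) (ind_mor M N h) (ind_mor L M g) y"
    proof (cases "y \<in> carrier (ind_obj L)")
      case True
      then obtain X where y: "y = cube_code L X" and X: "X \<in> carrier (ind_mod L)"
        by (auto simp: ind_obj_simps[OF L])
      then have "map3 (compose (carrier L) h g) X = map3 h (map3 g X)"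
        by (cases X) (simp add: ind_mod_simps cube_iff compose_def)
      then show ?thesis using True
        by (simp add: y compose_def ind_mor_code[OF L X] ind_mor_code[OF M map3_closed[OF L g X]])
    qed (simp add: ind_mor_def compose_def)
  qed
qed

lemma corner_unit_iso:
  "lmod_nat_iso_id R (\<lambda>N :: ('b, 'u) module. corner_mod (ind_obj N))
    (\<lambda>N N' h. corner_mor (ind_obj N) (ind_obj N') (ind_mor N N' h)) corner_unit"
  unfolding lmod_nat_iso_id_def
proof (intro conjI allI impI ballI)
  fix N :: "('b, 'u) module" assume N: "left_module R N"
  note [simp] = ind_obj_simps[OF N] emb_closed[OF N] corner_mod_simps corner_unit_def
  have fe: "f \<odot>\<^bsub>ind_obj N\<^esub> cube_code N (emb N n) = cube_code N (emb N n)" if "n \<in> carrier N" for n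
    using that by (simp add: act_f_emb[OF N])
  interpret N: left_module R N by (rule N)
  show "corner_unit N \<in> lmod_hom R N (corner_mod (ind_obj N))"
    by (rule lmod_homI)
      (auto simp: fe emb_add[OF N] emb_smult[OF N] N.smult_closed act_f_emb[OF N])
  have "inj_on (corner_unit N) (carrier N)"
  proof (rule inj_onI)
    fix n n' assume n: "n \<in> carrier N" "n' \<in> carrier N" and "corner_unit N n = corner_unit N n'"
    then have "emb N n = emb N n'" by (simp add: cube_code_eq_iff[OF N])
    then show "n = n'" using comb_f_emb[OF N n(1)] comb_f_emb[OF N n(2)] by metis
  qed
  moreover have "corner_unit N ` carrier N = carrier (corner_mod (ind_obj N))"
  proof
    show "corner_unit N ` carrier N \<subseteq> carrier (corner_mod (ind_obj N))"
      by (auto simp: act_f_emb[OF N])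
    show "carrier (corner_mod (ind_obj N)) \<subseteq> corner_unit N ` carrier N"
    proof
      fix y assume y: "y \<in> carrier (corner_mod (ind_obj N))"
      then obtain X where X: "y = cube_code N X" "X \<in> carrier (ind_mod N)" by auto
      have X3: "X \<in> cube N" using X by (simp add: ind_mod_simps)
      have "cube_code N (act N f X) = cube_code N X" using y X by simp
      then have "act N f X = X"
        using X ind_mod_closed(2)[OF N X(2) X(2) f_closed] by (simp add: cube_code_eq_iff[OF N])
      then have "emb N (comb N f X) = X" by (simp add: emb_comb_f[OF N X3])
      moreover have "comb N f X \<in> carrier N" using X3 by (intro comb_closed[OF N] left_f_rules)
      ultimately show "y \<in> corner_unit N ` carrier N"
        using X by (intro image_eqI[of _ _ "comb N f X"]) simp_all
    qed
  qed
  ultimately show "bij_betw (corner_unit N) (carrier N) (carrier (corner_mod (ind_obj N)))"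
    by (simp add: bij_betw_def)
next
  fix N N' :: "('b, 'u) module" and h
  assume N: "left_module R N" and N': "left_module R N'" and h: "h \<in> lmod_hom R N N'"
  have "cube_code N (emb N n) \<in> carrier (corner_mod (ind_obj N))" if "n \<in> carrier N" for n
    using that by (simp add: corner_mod_simps ind_obj_simps[OF N] emb_closed[OF N] act_f_emb[OF N])
  then show "compose (carrier N) (corner_unit N') h =
      compose (carrier N) (corner_mor (ind_obj N) (ind_obj N') (ind_mor N N' h)) (corner_unit N)"
    by (auto simp: compose_def fun_eq_iff corner_unit_def corner_mor_def lmod_homD[OF h]
        ind_mor_code[OF N emb_closed[OF N]] map3_emb[OF N h])
qed

lemma ind_unit_iso:
  "lmod_nat_iso_id A (\<lambda>M :: ('a, 'u) module. ind_obj (corner_mod M))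
    (\<lambda>M M' h. ind_mor (corner_mod M) (corner_mod M') (corner_mor M M' h)) ind_unit"
  unfolding lmod_nat_iso_id_def
proof (intro conjI allI impI ballI)
  fix M :: "('a, 'u) module" assume M: "left_module A M"
  let ?N = "corner_mod M"
  let ?v = "\<lambda>m. (v 0 \<odot>\<^bsub>M\<^esub> m, v 1 \<odot>\<^bsub>M\<^esub> m, v 2 \<odot>\<^bsub>M\<^esub> m)"
  have N: "left_module R ?N" by (rule left_module_corner_mod[OF M])
  interpret M: left_module A M by (rule M)
  note [simp] = M.smult_closed f_closed u_closed v_closed left_f_rules
  have comb: "comb ?N b (x0, x1, x2) = (b \<otimes> u 0) \<odot>\<^bsub>M\<^esub> x0 \<oplus>\<^bsub>M\<^esub>
      ((b \<otimes> u 1) \<odot>\<^bsub>M\<^esub> x1 \<oplus>\<^bsub>M\<^esub> (b \<otimes> u 2) \<odot>\<^bsub>M\<^esub> x2)" if "b \<in> left_f" for b x0 x1 x2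
    using that by (simp add: corner_mod_simps)
  have recover: "u 0 \<odot>\<^bsub>M\<^esub> (v 0 \<odot>\<^bsub>M\<^esub> m) \<oplus>\<^bsub>M\<^esub> (u 1 \<odot>\<^bsub>M\<^esub> (v 1 \<odot>\<^bsub>M\<^esub> m) \<oplus>\<^bsub>M\<^esub> u 2 \<odot>\<^bsub>M\<^esub> (v 2 \<odot>\<^bsub>M\<^esub> m)) = m"
    if "m \<in> carrier M" for m
  proof -
    have "(u 0 \<otimes> v 0 \<oplus> (u 1 \<otimes> v 1 \<oplus> u 2 \<otimes> v 2)) \<odot>\<^bsub>M\<^esub> m = m"
      using that by (simp only: uv_sum M.smult_one)
    then show ?thesis using that by (simp add: M.smult_l_distr M.smult_assoc)
  qed
  have comb_v: "comb ?N b (?v m) = b \<odot>\<^bsub>M\<^esub> m" if "b \<in> left_f" "m \<in> carrier M" for b m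
  proof -
    have "comb ?N b (?v m) = b \<odot>\<^bsub>M\<^esub> (u 0 \<odot>\<^bsub>M\<^esub> (v 0 \<odot>\<^bsub>M\<^esub> m) \<oplus>\<^bsub>M\<^esub>
        (u 1 \<odot>\<^bsub>M\<^esub> (v 1 \<odot>\<^bsub>M\<^esub> m) \<oplus>\<^bsub>M\<^esub> u 2 \<odot>\<^bsub>M\<^esub> (v 2 \<odot>\<^bsub>M\<^esub> m)))"
      using that by (simp only: comb M.smult_r_distr M.smult_assoc M.smult_closed M.M.a_closed
          u_closed v_closed left_f_rules)
    then show ?thesis using that by (simp only: recover)
  qed
  have act_v: "act ?N a (?v m) = ?v (a \<odot>\<^bsub>M\<^esub> m)" if "a \<in> carrier A" "m \<in> carrier M" for a m
    using that by (simp only: act_def comb_v left_f_rules) (simp add: M.smult_assoc)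
  have v_closed': "?v m \<in> carrier (ind_mod ?N)" if "m \<in> carrier M" for m
    using that act_v[of "\<one>" m]
    by (simp add: ind_mod_simps cube_iff corner_mod_simps M.smult_assoc[symmetric] f_v M.smult_one)
  note [simp] = v_closed' ind_obj_simps[OF N]
  show "ind_unit M \<in> lmod_hom A M (ind_obj ?N)"
    by (rule lmod_homI) (auto simp: ind_unit_def act_v M.smult_r_distr corner_mod_simps)
  have "inj_on (ind_unit M) (carrier M)"
  proof (rule inj_onI)
    fix m m' assume m: "m \<in> carrier M" "m' \<in> carrier M" and "ind_unit M m = ind_unit M m'"
    then have "?v m = ?v m'" by (simp add: ind_unit_def cube_code_eq_iff[OF N])
    then show "m = m'" using recover[OF m(1)] recover[OF m(2)] by (metis prod.inject)
  qed
  moreover have "ind_unit M ` carrier M = carrier (ind_obj ?N)"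
  proof
    show "ind_unit M ` carrier M \<subseteq> carrier (ind_obj ?N)" by (auto simp: ind_unit_def)
    show "carrier (ind_obj ?N) \<subseteq> ind_unit M ` carrier M"
    proof
      fix y assume "y \<in> carrier (ind_obj ?N)"
      then obtain x0 x1 x2 where y: "y = cube_code ?N (x0, x1, x2)" and X: "(x0, x1, x2) \<in> carrier (ind_mod ?N)"
        by auto
      then have x: "x0 \<in> carrier M" "x1 \<in> carrier M" "x2 \<in> carrier M"
        and act1: "act ?N \<one> (x0, x1, x2) = (x0, x1, x2)"
        by (auto simp: ind_mod_simps cube_iff corner_mod_simps)
      \<comment> \<open>The preimage is the sum of the u_k x_k. Multiplying it by v_k gives the k-th
        coordinate of \<open>act ?N \<one>\<close> on the triple, which is the triple
        itself.\<close>
      let ?m = "u 0 \<odot>\<^bsub>M\<^esub> x0 \<oplus>\<^bsub>M\<^esub> (u 1 \<odot>\<^bsub>M\<^esub> x1 \<oplus>\<^bsub>M\<^esub> u 2 \<odot>\<^bsub>M\<^esub> x2)"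
      have m: "?m \<in> carrier M" using x by simp
      have "v k \<odot>\<^bsub>M\<^esub> ?m = comb ?N (v k) (x0, x1, x2)" for k
        using x by (simp only: comb left_f_rules M.smult_r_distr M.smult_assoc M.smult_closed M.M.a_closed
          u_closed v_closed)
      then have "?v ?m = act ?N \<one> (x0, x1, x2)"
        by (simp only: act_def A.r_one v_closed)
      with act1 m y show "y \<in> ind_unit M ` carrier M"
        by (intro image_eqI[of _ _ ?m]) (simp_all add: ind_unit_def)
    qed
  qed
  ultimately show "bij_betw (ind_unit M) (carrier M) (carrier (ind_obj ?N))"
    by (simp add: bij_betw_def)
  fix M' :: "('a, 'u) module" and h
  assume h: "h \<in> lmod_hom A M M'"
  have "v k \<odot>\<^bsub>M\<^esub> m \<in> carrier ?N" if "m \<in> carrier M" for m k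
    using that by (simp add: corner_mod_simps M.smult_assoc[symmetric] f_v)
  then show "compose (carrier M) (ind_unit M') h =
      compose (carrier M) (ind_mor ?N (corner_mod M') (corner_mor M M' h)) (ind_unit M)"
    by (auto simp: compose_def fun_eq_iff ind_unit_def lmod_homD[OF h] ind_mor_code[OF N] corner_mor_def)
qed

theorem morita_equivalent_corner: "morita_equivalent TYPE('u) R A"
  unfolding morita_equivalent_def
  using ind_functor corner_functor corner_unit_iso ind_unit_iso by blast

end

end

text \<open>A nonzero x has distinct rational multiples, as nonzero rationals are invertible; so the
  carrier is infinite and equipotent to its square. This supplies \<open>code_ex\<close>, the one
  input to the equivalence that uses rational scalars.\<close>

lemma ex_inj_on_cube:
  fixes R :: "(rat, 'a, 'm) module_scheme" and N :: "('a, 'u) module"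
  assumes R: "assoc_algebra R" and N: "left_module R N"
  shows "\<exists>e :: 'u \<times> 'u \<times> 'u \<Rightarrow> 'u. inj_on e (carrier N \<times> carrier N \<times> carrier N)"
proof (cases "carrier N = {\<zero>\<^bsub>N\<^esub>}")
  case True
  then show ?thesis by (intro exI[of _ fst]) (auto simp: inj_on_def)
next
  case False
  interpret R: assoc_algebra R by (rule R)
  interpret N: left_module R N by (rule N)
  obtain x where x: "x \<in> carrier N" "x \<noteq> \<zero>\<^bsub>N\<^esub>" using False N.M.zero_closed by blast
  define s where "s c = (c \<odot>\<^bsub>R\<^esub> \<one>\<^bsub>R\<^esub>) \<odot>\<^bsub>N\<^esub> x" for c
  have s_closed: "s c \<in> carrier N" for c
    by (simp add: s_def x R.smult_closed N.smult_closed)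
  have s_add: "s (c + d) = s c \<oplus>\<^bsub>N\<^esub> s d" for c d
    by (simp add: s_def x R.smult_closed R.smult_add_left N.smult_l_distr)
  have s_1: "s 1 = x" by (simp add: s_def x R.smult_1 N.smult_one)
  have s_mult: "s (c * d) = (c \<odot>\<^bsub>R\<^esub> \<one>\<^bsub>R\<^esub>) \<odot>\<^bsub>N\<^esub> s d" for c d
    by (simp add: s_def x R.smult_closed R.smult_smult R.smult_mult_left flip: N.smult_assoc)
  have "inj s"
  proof (rule injI, rule ccontr)
    fix c d assume eq: "s c = s d" and "c \<noteq> d"
    have "s (c - d) \<oplus>\<^bsub>N\<^esub> s d = s d" using s_add[of "c - d" d] eq by simp
    then have "s (c - d) = \<zero>\<^bsub>N\<^esub>" using s_closed by simp
    then have "s (inverse (c - d) * (c - d)) = (inverse (c - d) \<odot>\<^bsub>R\<^esub> \<one>\<^bsub>R\<^esub>) \<odot>\<^bsub>N\<^esub> \<zero>\<^bsub>N\<^esub>"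
      by (simp only: s_mult)
    also have "\<dots> = \<zero>\<^bsub>N\<^esub>" by (simp add: left_module_smult_zero[OF N] R.smult_closed)
    finally show False using \<open>c \<noteq> d\<close> x s_1 by simp
  qed
  then have inf: "infinite (carrier N)"
    using s_closed range_inj_infinite[of "s \<circ> of_nat"] finite_subset[of "range (s \<circ> of_nat)" "carrier N"]
    by (auto simp: inj_compose)
  obtain g where g: "bij_betw g (carrier N \<times> carrier N) (carrier N)"
    using card_of_Times_same_infinite[OF inf] unfolding card_of_ordIso[symmetric] by blast
  have "g (x, y) \<in> carrier N" "g (x, y) = g (x', y') \<longleftrightarrow> x = x' \<and> y = y'"
    if "x \<in> carrier N" "y \<in> carrier N" "x' \<in> carrier N" "y' \<in> carrier N" for x y x' y'
    using that g by (auto simp: bij_betw_def inj_on_def)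
  then have "inj_on (\<lambda>(x, y, z). g (x, g (y, z))) (carrier N \<times> carrier N \<times> carrier N)"
    by (auto simp: inj_on_def)
  then show ?thesis by blast
qed

text \<open>The \<open>v k\<close> of \<open>full_corner\<close>, namely f, e_12, e_13. The locale
  constrains every index, so indices beyond 2 repeat the value at 2; likewise for
  \<open>e11_col\<close>.\<close>

definition e11_row :: "nat \<Rightarrow> A_array"
  where "e11_row k = A_of (Coords (if k = 0 then V3 0 0 0 else if k = 1 then V3 0 1 0 else V3 0 0 1)
    (V3 0 0 0) (V3 0 0 0) (V3 0 0 0) (V3 0 0 0) 0 0 0 0 (V3 0 0 0)) + (if k = 0 then f_idem else 0)"

definition e11_col :: "nat \<Rightarrow> A_array"
  where "e11_col k = A_of (Coords (V3 0 0 0) (if k = 1 then V3 1 0 0 else V3 0 0 0)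
    (if k = 0 \<or> k = 1 then V3 0 0 0 else V3 1 0 0) (V3 0 0 0) (V3 0 0 0) 0 0 0 0 (V3 0 0 0)) +
    (if k = 0 then f_idem else 0)"

lemma morita_equivalent_Psi: "morita_equivalent TYPE('u) (quotient_algebra QPsi I_Psi) A_alg"
proof -
  obtain \<phi> where \<phi>: "\<phi> \<in> algebra_iso A'_alg (quotient_algebra QPsi I_Psi)"
    by (rule A'_alg_iso)
  then have iso: "\<phi> \<in> ring_iso A'_alg (quotient_algebra QPsi I_Psi)"
    and R: "assoc_algebra (quotient_algebra QPsi I_Psi)" by (auto simp: algebra_iso_def)
  have corner: "carrier A'_alg = {x. f_idem * x = x \<and> x * f_idem = x}"
  proof
    show "carrier A'_alg \<subseteq> {x. f_idem * x = x \<and> x * f_idem = x}"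
      by (auto simp: carrier_A'_alg coords_of_inject[symmetric] coords_of_ring)
    show "{x. f_idem * x = x \<and> x * f_idem = x} \<subseteq> carrier A'_alg"
      by (auto simp: A'_alg_def corner_algebra_def) (metis mult.assoc)
  qed
  interpret full_corner A_alg "quotient_algebra QPsi I_Psi" f_idem \<phi> e11_col e11_row
  proof (intro full_corner.intro full_corner_axioms.intro)
    show "ring A_alg" "ring (quotient_algebra QPsi I_Psi)"
      using assoc_algebra_A_alg R by (auto simp: assoc_algebra_def)
    show "bij_betw \<phi> {x \<in> carrier A_alg. f_idem \<otimes>\<^bsub>A_alg\<^esub> x = x \<and> x \<otimes>\<^bsub>A_alg\<^esub> f_idem = x}
      (carrier (quotient_algebra QPsi I_Psi))"
      using iso by (simp add: ring_iso_def corner)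
    show "\<phi> f_idem = \<one>\<^bsub>quotient_algebra QPsi I_Psi\<^esub>"
      using iso by (auto simp: ring_iso_def ring_hom_def)
    fix x y
    assume "x \<in> carrier A_alg" "f_idem \<otimes>\<^bsub>A_alg\<^esub> x = x" "x \<otimes>\<^bsub>A_alg\<^esub> f_idem = x"
      "y \<in> carrier A_alg" "f_idem \<otimes>\<^bsub>A_alg\<^esub> y = y" "y \<otimes>\<^bsub>A_alg\<^esub> f_idem = y"
    then have "x \<in> carrier A'_alg" "y \<in> carrier A'_alg" by (simp_all add: corner)
    then show "\<phi> (x \<oplus>\<^bsub>A_alg\<^esub> y) = \<phi> x \<oplus>\<^bsub>quotient_algebra QPsi I_Psi\<^esub> \<phi> y"
      "\<phi> (x \<otimes>\<^bsub>A_alg\<^esub> y) = \<phi> x \<otimes>\<^bsub>quotient_algebra QPsi I_Psi\<^esub> \<phi> y"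
      using iso by (auto simp: ring_iso_def ring_hom_def)
  qed (simp_all add: f_idem_idem e11_row_def e11_col_def coords_of_inject[symmetric] coords_of_ring)
  show ?thesis
    using ex_inj_on_cube[OF R] by (intro morita_equivalent_corner) (simp add: cube_def)
qed

section \<open>Finite bisets\<close>

text \<open>Along an orbit the stabilizer sizes add up to the group order, so points weighted by
  them count each orbit equally often.\<close>

lemma orbit_sum:
  fixes act :: "'s::{group_add,finite} \<Rightarrow> 'p \<Rightarrow> 'p" and F :: "'p set \<Rightarrow> 'a::ring_1"
  assumes fin: "finite P" and closed: "\<And>g z. z \<in> P \<Longrightarrow> act g z \<in> P"
    and zero: "\<And>z. z \<in> P \<Longrightarrow> act 0 z = z"
    and add: "\<And>g h z. z \<in> P \<Longrightarrow> act (g + h) z = act g (act h z)"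
  defines "orb \<equiv> \<lambda>z. range (\<lambda>g. act g z)"
  shows "(\<Sum>z\<in>P. of_nat (card {g. act g z = z}) * F (orb z)) = of_nat CARD('s) * (\<Sum>X\<in>orb ` P. F X)"
proof -
  have orb_eq: "orb (act h z) = orb z" if "z \<in> P" for h z
  proof
    show "orb (act h z) \<subseteq> orb z" using that by (auto simp: orb_def simp flip: add)
    show "orb z \<subseteq> orb (act h z)"
    proof
      fix y assume "y \<in> orb z"
      then obtain g where "y = act g z" by (auto simp: orb_def)
      then have "y = act (g - h) (act h z)" using that by (simp flip: add)
      then show "y \<in> orb (act h z)" by (auto simp: orb_def)
    qed
  qed
  have self: "z \<in> orb z" if "z \<in> P" for z using zero[OF that] by (auto simp: orb_def intro: range_eqI[of _ _ 0])
  have fibre: "{z \<in> P. orb z = orb z0} = orb z0" if "z0 \<in> P" for z0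
  proof -
    have "z \<in> P \<and> orb z = orb z0" if "z \<in> orb z0" for z
      using that orb_eq[OF \<open>z0 \<in> P\<close>] closed[OF \<open>z0 \<in> P\<close>] unfolding orb_def by blast
    then show ?thesis using self by blast
  qed
  have stab: "(\<Sum>z\<in>orb z0. card {g. act g z = z}) = CARD('s)" if z0: "z0 \<in> P" for z0
  proof -
    have "CARD('s) = (\<Sum>g\<in>(UNIV :: 's set). 1)" by simp
    also have "\<dots> = (\<Sum>z\<in>orb z0. \<Sum>g | g \<in> UNIV \<and> act g z0 = z. 1)"
      unfolding orb_def by (rule sum.image_gen) simp
    also have "\<dots> = (\<Sum>z\<in>orb z0. card {g. act g z = z})"
    proof (rule sum.cong[OF refl])
      fix z assume "z \<in> orb z0"
      then obtain h where z: "z = act h z0" by (auto simp: orb_def)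
      \<comment> \<open>The elements carrying z0 to z form the coset of the stabilizer of z through
        h.\<close>
      have "bij_betw (\<lambda>g. g - h) {g. act g z0 = z} {g. act g z = z}"
        using z0 by (intro bij_betw_byWitness[where f' = "\<lambda>g. g + h"]) (auto simp: z simp flip: add)
      then show "(\<Sum>g | g \<in> UNIV \<and> act g z0 = z. 1) = card {g. act g z = z}"
        by (simp add: bij_betw_same_card)
    qed
    finally show ?thesis by simp
  qed
  have "(\<Sum>z\<in>P. of_nat (card {g. act g z = z}) * F (orb z)) =
    (\<Sum>X\<in>orb ` P. \<Sum>z | z \<in> P \<and> orb z = X. of_nat (card {g. act g z = z}) * F (orb z))"
    by (rule sum.image_gen[OF fin])
  also have "\<dots> = (\<Sum>X\<in>orb ` P. of_nat CARD('s) * F X)"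
  proof (rule sum.cong[OF refl])
    fix X assume "X \<in> orb ` P"
    then obtain z0 where z0: "z0 \<in> P" "X = orb z0" by blast
    have "(\<Sum>z | z \<in> P \<and> orb z = X. of_nat (card {g. act g z = z}) * F (orb z)) =
      (\<Sum>z\<in>{z \<in> P. orb z = X}. of_nat (card {g. act g z = z}) * F X)"
      by (intro sum.cong) auto
    also have "\<dots> = of_nat (\<Sum>z\<in>orb z0. card {g. act g z = z}) * F X"
      using fibre[OF z0(1)] by (simp add: z0(2) sum_distrib_right)
    finally show "(\<Sum>z | z \<in> P \<and> orb z = X. of_nat (card {g. act g z = z}) * F (orb z)) =
        of_nat CARD('s) * F X"
      using stab[OF z0(1)] by simp
  qed
  finally show ?thesis by (simp add: sum_distrib_left)
qed

definition is_subgroup :: "('s::group_add \<times> 's) set \<Rightarrow> bool"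
  where "is_subgroup L \<longleftrightarrow> (0, 0) \<in> L \<and> (\<forall>x y x' y'. (x, y) \<in> L \<longrightarrow> (x', y') \<in> L \<longrightarrow> (x + x', y + y') \<in> L) \<and>
    (\<forall>x y. (x, y) \<in> L \<longrightarrow> (- x, - y) \<in> L)"

definition conj_rel :: "'s::group_add \<Rightarrow> 's \<Rightarrow> ('s \<times> 's) set \<Rightarrow> ('s \<times> 's) set"
  where "conj_rel a b L = {(x, y). (- a + x + a, - b + y + b) \<in> L}"

text \<open>Moves the group to a finite type, where sums range over \<open>UNIV\<close>, the laws
  are those of a type class, and S_3 can be computed with.\<close>

locale enumerated_group = group G for G :: "('g, 'm) monoid_scheme" (structure) +
  fixes \<iota> :: "'s::{group_add,finite} \<Rightarrow> 'g"
  assumes \<iota>_bij: "bij_betw \<iota> UNIV (carrier G)"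
    and \<iota>_add: "\<iota> (x + y) = \<iota> x \<otimes> \<iota> y"
begin

lemma \<iota>_closed [simp]: "\<iota> x \<in> carrier G"
  using \<iota>_bij by (auto simp: bij_betw_def)

lemma \<iota>_eq_iff [simp]: "\<iota> x = \<iota> y \<longleftrightarrow> x = y"
  using \<iota>_bij by (auto simp: bij_betw_def inj_def)

lemma \<iota>_zero [simp]: "\<iota> 0 = \<one>"
  using \<iota>_add[of 0 0] by (simp add: l_cancel_one')

lemma \<iota>_minus [simp]: "\<iota> (- x) = inv (\<iota> x)"
  using \<iota>_add[of "- x" x] by (simp add: inv_equality)

lemma carrier_\<iota>: "carrier G = range \<iota>"
  using \<iota>_bij by (auto simp: bij_betw_def)

abbreviation lt :: "('g, 'x) biset \<Rightarrow> 's \<Rightarrow> 'x \<Rightarrow> 'x" where "lt M x m \<equiv> lact M (\<iota> x) m"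
abbreviation rt :: "('g, 'x) biset \<Rightarrow> 'x \<Rightarrow> 's \<Rightarrow> 'x" where "rt M m x \<equiv> ract M m (\<iota> x)"

text \<open>The stabilizer of m under (x, y) m = x m y^-1. As a relation it can be composed.\<close>

definition stab :: "('g, 'x) biset \<Rightarrow> 'x \<Rightarrow> ('s \<times> 's) set"
  where "stab M m = {(x, y). lt M x m = rt M m y}"

lemma finite_bisetI:
  assumes "finite (points M)"
    and "\<And>g x. x \<in> points M \<Longrightarrow> lt M g x \<in> points M" "\<And>g x. x \<in> points M \<Longrightarrow> rt M x g \<in> points M"
    and "\<And>x. x \<in> points M \<Longrightarrow> lt M 0 x = x" "\<And>x. x \<in> points M \<Longrightarrow> rt M x 0 = x"
    and "\<And>g h x. x \<in> points M \<Longrightarrow> lt M (g + h) x = lt M g (lt M h x)"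
    and "\<And>g h x. x \<in> points M \<Longrightarrow> rt M x (g + h) = rt M (rt M x g) h"
    and "\<And>g h x. x \<in> points M \<Longrightarrow> rt M (lt M g x) h = lt M g (rt M x h)"
  shows "finite_biset G M"
proof (intro finite_biset.intro finite_biset_axioms.intro is_group)
  show "lact M \<one> x = x" if "x \<in> points M" for x using assms(4)[OF that] by simp
  show "ract M x \<one> = x" if "x \<in> points M" for x using assms(5)[OF that] by simp
qed (use assms in \<open>auto simp: carrier_\<iota> simp flip: \<iota>_add\<close>)

lemma biset_rules:
  assumes "finite_biset G M" "x \<in> points M"
  shows "lt M g x \<in> points M" "rt M x g \<in> points M" "lt M 0 x = x" "rt M x 0 = x"
    "lt M (g + h) x = lt M g (lt M h x)" "rt M x (g + h) = rt M (rt M x g) h"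
    "rt M (lt M g x) h = lt M g (rt M x h)"
    "lt M (- g) (lt M g x) = x" "lt M g (lt M (- g) x) = x" "rt M (rt M x g) (- g) = x" "rt M (rt M x (- g)) g = x"
proof -
  interpret finite_biset G M by (rule assms)
  note [simp] = assms(2)
  show *: "lt M g x \<in> points M" "rt M x g \<in> points M" "lt M 0 x = x" "rt M x 0 = x"
    "rt M (lt M g x) h = lt M g (rt M x h)"
    by (simp_all add: lact_closed ract_closed lact_one ract_one lact_ract)
  show l: "lt M (g + h) x = lt M g (lt M h x)" and r: "rt M x (g + h) = rt M (rt M x g) h" for g h
    by (simp_all add: \<iota>_add lact_mult ract_mult)
  show "lt M (- g) (lt M g x) = x" "lt M g (lt M (- g) x) = x" "rt M (rt M x g) (- g) = x" "rt M (rt M x (- g)) g = x"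
    using * by (simp_all del: \<iota>_minus add: l[symmetric] r[symmetric] del: \<iota>_zero)
qed

lemma biset_isomorphic_iff:
  "biset_isomorphic G M N \<longleftrightarrow> (\<exists>h. bij_betw h (points M) (points N) \<and>
    (\<forall>g. \<forall>x\<in>points M. h (lt M g x) = lt N g (h x) \<and> h (rt M x g) = rt N (h x) g))"
  by (simp add: biset_isomorphic_def carrier_\<iota>)

lemma biset_isomorphic_sym:
  assumes M: "finite_biset G M" and iso: "biset_isomorphic G M N"
  shows "biset_isomorphic G N M"
proof -
  obtain h where h: "bij_betw h (points M) (points N)"
    "\<And>g x. x \<in> points M \<Longrightarrow> h (lt M g x) = lt N g (h x) \<and> h (rt M x g) = rt N (h x) g"
    using iso by (auto simp: biset_isomorphic_iff)
  let ?k = "inv_into (points M) h"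
  have "?k (lt N g y) = lt M g (?k y) \<and> ?k (rt N y g) = rt M (?k y) g" if y: "y \<in> points N" for g y
  proof -
    obtain x where x: "x \<in> points M" "y = h x" using h(1) y by (auto simp: bij_betw_def)
    have "?k (h z) = z" if "z \<in> points M" for z using h(1) that by (simp add: bij_betw_def)
    then show ?thesis using x h(2)[OF x(1), THEN conjunct1, symmetric] h(2)[OF x(1), THEN conjunct2, symmetric]
        biset_rules(1,2)[OF M x(1)] by simp
  qed
  then show ?thesis unfolding biset_isomorphic_iff using bij_betw_inv_into[OF h(1)] by blast
qed

lemma biset_isomorphic_trans:
  assumes "biset_isomorphic G L M" "biset_isomorphic G M N"
  shows "biset_isomorphic G L N"
proof -
  obtain h where h: "bij_betw h (points L) (points M)"
    "\<And>g x. x \<in> points L \<Longrightarrow> h (lt L g x) = lt M g (h x) \<and> h (rt L x g) = rt M (h x) g"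
    using assms(1) by (auto simp: biset_isomorphic_iff)
  obtain k where k: "bij_betw k (points M) (points N)"
    "\<And>g x. x \<in> points M \<Longrightarrow> k (lt M g x) = lt N g (k x) \<and> k (rt M x g) = rt N (k x) g"
    using assms(2) by (auto simp: biset_isomorphic_iff)
  have "h x \<in> points M" if "x \<in> points L" for x using h(1) that by (auto simp: bij_betw_def)
  then show ?thesis
    unfolding biset_isomorphic_iff using bij_betw_trans[OF h(1) k(1)] h(2) k(2)
    by (intro exI[of _ "k \<circ> h"]) simp
qed

lemma ex_nat_biset:
  assumes M: "finite_biset G M"
  shows "\<exists>N :: ('g, nat) biset. finite_biset G N \<and> biset_isomorphic G M N"
proof -
  obtain h where h: "bij_betw h (points M) {0..<card (points M)}"
    using ex_bij_betw_finite_nat[OF finite_biset.finite_points[OF M]] by blast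
  let ?k = "inv_into (points M) h"
  define N where "N = \<lparr>points = h ` points M, lact = (\<lambda>g y. h (lact M g (?k y))), ract = (\<lambda>y g. h (ract M (?k y) g))\<rparr>"
  have k: "?k (h z) = z" if "z \<in> points M" for z using h that by (simp add: bij_betw_def)
  have "finite_biset G N"
    using finite_biset.finite_points[OF M]
    by (intro finite_bisetI) (auto simp: N_def k biset_rules[OF M] simp del: \<iota>_zero)
  moreover have "biset_isomorphic G M N"
    unfolding biset_isomorphic_iff using h k by (intro exI[of _ h]) (auto simp: N_def bij_betw_def)
  ultimately show ?thesis by blast
qed

lemma biset_class_eq_iff:
  assumes "finite_biset G M" "finite_biset G N"
  shows "biset_class G M = biset_class G N \<longleftrightarrow> biset_isomorphic G M N"
proof
  assume eq: "biset_class G M = biset_class G N"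
  obtain K :: "('g, nat) biset" where K: "finite_biset G K" "biset_isomorphic G M K"
    using ex_nat_biset[OF assms(1)] by blast
  then have "K \<in> biset_class G N" using eq by (auto simp: biset_class_def)
  then show "biset_isomorphic G M N"
    using K biset_isomorphic_sym[OF assms(2)] biset_isomorphic_trans by (auto simp: biset_class_def)
next
  assume iso: "biset_isomorphic G M N"
  note iso' = biset_isomorphic_sym[OF assms(1) iso]
  have "biset_isomorphic G M K \<longleftrightarrow> biset_isomorphic G N K" for K :: "('g, nat) biset"
    by (rule iffI) (erule biset_isomorphic_trans[OF iso'] biset_isomorphic_trans[OF iso])+
  then show "biset_class G M = biset_class G N"
    by (simp add: biset_class_def)
qed

lemma biset_class_in_classes:
  assumes "finite_biset G M"
  shows "biset_class G M \<in> biset_classes G"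
proof -
  obtain K :: "('g, nat) biset" where K: "finite_biset G K" "biset_isomorphic G M K"
    using ex_nat_biset[OF assms] by blast
  then have "biset_class G M = biset_class G K" using biset_class_eq_iff[OF assms] by blast
  then show ?thesis using K by (auto simp: biset_classes_def)
qed

lemma some_in_biset_class:
  assumes "finite_biset G M"
  defines "K \<equiv> SOME K. K \<in> biset_class G M"
  shows "finite_biset G K" "biset_isomorphic G M K"
proof -
  have "\<exists>K. K \<in> biset_class G M" using ex_nat_biset[OF assms(1)] by (simp add: biset_class_def)
  then have "K \<in> biset_class G M" unfolding K_def by (rule someI_ex)
  then show "finite_biset G K" "biset_isomorphic G M K" by (simp_all add: biset_class_def)
qed

lemma stab_iso:
  assumes "finite_biset G M" "bij_betw h (points M) (points N)" "m \<in> points M"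
    "\<And>g x. x \<in> points M \<Longrightarrow> h (lt M g x) = lt N g (h x) \<and> h (rt M x g) = rt N (h x) g"
  shows "stab N (h m) = stab M m"
proof -
  have "inj_on h (points M)" using assms(2) by (simp add: bij_betw_def)
  then have "h (lt M x m) = h (rt M m y) \<longleftrightarrow> lt M x m = rt M m y" for x y
    by (rule inj_on_eq_iff) (rule biset_rules[OF assms(1,3)])+
  then show ?thesis using assms(4)[OF assms(3)] by (simp add: stab_def)
qed

lemma is_subgroup_stab:
  assumes "finite_biset G M" "m \<in> points M"
  shows "is_subgroup (stab M m)"
proof -
  note rules = biset_rules[OF assms(1)]
  have "lt M (x + x') m = rt M m (y + y')" if "lt M x m = rt M m y" "lt M x' m = rt M m y'" for x y x' y'
  proof -
    have "lt M (x + x') m = lt M x (rt M m y')" using that rules(5)[OF assms(2)] by simp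
    also have "\<dots> = rt M (rt M m y) y'" using that by (simp flip: rules(7)[OF assms(2)])
    finally show ?thesis using rules(6)[OF assms(2)] by simp
  qed
  moreover have "lt M (- x) m = rt M m (- y)" if "lt M x m = rt M m y" for x y
  proof -
    have "rt M m (- y) = rt M (lt M (- x) (lt M x m)) (- y)" using rules(8)[OF assms(2)] by (simp del: \<iota>_minus)
    also have "\<dots> = lt M (- x) (rt M (rt M m y) (- y))"
      by (simp only: that rules(7)[OF rules(2)[OF assms(2)]])
    finally show ?thesis using rules(10)[OF assms(2)] by simp
  qed
  ultimately show ?thesis using rules(3,4)[OF assms(2)] by (simp add: is_subgroup_def stab_def del: \<iota>_minus \<iota>_zero)
qed

lemma translate_eq_iff:
  assumes "finite_biset G M" "x \<in> points M" "y \<in> points M"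
  shows "lt M g x = lt M g y \<longleftrightarrow> x = y" "rt M x g = rt M y g \<longleftrightarrow> x = y"
  using biset_rules(8,10)[OF assms(1,2), of g] biset_rules(8,10)[OF assms(1,3), of g] by metis+

text \<open>Since (x, y) acts by x m y^-1, the point a m b is the translate of m by (a, b^-1); this
  explains the sign of b.\<close>

lemma stab_translate:
  assumes M: "finite_biset G M" and m: "m \<in> points M"
  shows "stab M (lt M a (rt M m b)) = conj_rel a (- b) (stab M m)"
proof -
  note rules = biset_rules[OF M]
  have "lt M x (lt M a (rt M m b)) = rt M (lt M a (rt M m b)) y \<longleftrightarrow>
    lt M (- a + x + a) m = rt M m (b + y - b)" for x y
  proof -
    have "lt M x (lt M a (rt M m b)) = rt M (lt M a (rt M m b)) y \<longleftrightarrow>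
      lt M (x + a) (rt M m b) = lt M a (rt M m (b + y))"
      by (simp only: rules(5)[OF rules(2)[OF m]] rules(6)[OF m] rules(7)[OF rules(2)[OF m]])
    also have "\<dots> \<longleftrightarrow> lt M (- a) (lt M (x + a) (rt M m b)) = lt M (- a) (lt M a (rt M m (b + y)))"
      by (intro translate_eq_iff(1)[OF M, symmetric] rules(1,2) m)
    also have "\<dots> \<longleftrightarrow> lt M (- a + x + a) (rt M m b) = rt M m (b + y)"
      by (simp only: rules(8)[OF rules(2)[OF m]] rules(5)[OF rules(2)[OF m], symmetric] add.assoc
          left_minus rules(3)[OF rules(2)[OF m]])
    also have "\<dots> \<longleftrightarrow> rt M (lt M (- a + x + a) (rt M m b)) (- b) = rt M (rt M m (b + y)) (- b)"
      by (intro translate_eq_iff(2)[OF M, symmetric] rules(1,2) m)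
    also have "\<dots> \<longleftrightarrow> lt M (- a + x + a) m = rt M m (b + y - b)"
      by (simp only: rules(7)[OF rules(2)[OF m]] rules(10)[OF m] rules(6)[OF m, symmetric] diff_conv_add_uminus
          right_minus rules(4)[OF m])
    finally show ?thesis .
  qed
  then show ?thesis by (simp add: stab_def conj_rel_def del: \<iota>_minus)
qed


subsection \<open>Products\<close>

definition mact :: "('g, 'x) biset \<Rightarrow> ('g, 'y) biset \<Rightarrow> 's \<Rightarrow> 'x \<times> 'y \<Rightarrow> 'x \<times> 'y"
  where "mact M N g z = (rt M (fst z) (- g), lt N g (snd z))"

lemma middle_orbit_mact: "middle_orbit G M N z = range (\<lambda>g. mact M N g z)"
  by (simp add: middle_orbit_def carrier_\<iota> image_image mact_def)

context
  fixes M :: "('g, 'x) biset" and N :: "('g, 'y) biset"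
  assumes M: "finite_biset G M" and N: "finite_biset G N"
begin

lemma mact_rules:
  assumes "z \<in> points M \<times> points N"
  shows "mact M N g z \<in> points M \<times> points N" "mact M N 0 z = z" "mact M N (g + h) z = mact M N g (mact M N h z)"
proof -
  have z: "fst z \<in> points M" "snd z \<in> points N" using assms by auto
  note rules = biset_rules[OF M z(1)] biset_rules[OF N z(2)]
  show "mact M N g z \<in> points M \<times> points N"
    unfolding mact_def mem_Times_iff fst_conv snd_conv by (intro conjI rules)
  show "mact M N 0 z = z" using rules(4,14) by (simp add: mact_def prod_eq_iff del: \<iota>_minus \<iota>_zero)
  have "rt M (fst z) (- (g + h)) = rt M (rt M (fst z) (- h)) (- g)"
    by (simp only: minus_add rules(6))
  then show "mact M N (g + h) z = mact M N g (mact M N h z)"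
    using rules(16) by (simp add: mact_def del: \<iota>_minus)
qed

lemma middle_orbit_eq_iff:
  assumes z: "z \<in> points M \<times> points N" and w: "w \<in> points M \<times> points N"
  shows "middle_orbit G M N z = middle_orbit G M N w \<longleftrightarrow> (\<exists>g. z = mact M N g w)"
proof
  assume "middle_orbit G M N z = middle_orbit G M N w"
  moreover have "z \<in> middle_orbit G M N z"
    using mact_rules(2)[OF z] unfolding middle_orbit_mact by (metis rangeI)
  ultimately show "\<exists>g. z = mact M N g w" by (auto simp: middle_orbit_mact)
next
  assume "\<exists>g. z = mact M N g w"
  then obtain g where g: "z = mact M N g w" by blast
  have "mact M N h z = mact M N (h + g) w" for h by (simp add: g mact_rules(3)[OF w])
  moreover have "mact M N h w = mact M N (h - g) z" for h by (simp add: g flip: mact_rules(3)[OF w])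
  ultimately show "middle_orbit G M N z = middle_orbit G M N w"
    unfolding middle_orbit_mact by (metis (no_types, lifting) rangeI subsetI subset_antisym image_subset_iff)
qed

lemma biset_prod_lact:
  assumes "m \<in> points M" "n \<in> points N"
  shows "lt (biset_prod G M N) x (middle_orbit G M N (m, n)) = middle_orbit G M N (lt M x m, n)"
  by (simp add: biset_prod_def middle_orbit_mact mact_def image_image biset_rules(7)[OF M assms(1)] del: \<iota>_minus)

lemma biset_prod_ract:
  assumes "m \<in> points M" "n \<in> points N"
  shows "rt (biset_prod G M N) (middle_orbit G M N (m, n)) y = middle_orbit G M N (m, rt N n y)"
  by (simp add: biset_prod_def middle_orbit_mact mact_def image_image biset_rules(7)[OF N assms(2)] del: \<iota>_minus)

lemma points_biset_prod:
  "points (biset_prod G M N) = middle_orbit G M N ` (points M \<times> points N)"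
  by (simp add: biset_prod_def)

lemma finite_biset_prod: "finite_biset G (biset_prod G M N)"
proof (rule finite_bisetI)
  show "finite (points (biset_prod G M N))"
    using finite_biset.finite_points[OF M] finite_biset.finite_points[OF N] by (simp add: points_biset_prod)
  fix X assume "X \<in> points (biset_prod G M N)"
  then obtain m n where X: "X = middle_orbit G M N (m, n)" and m: "m \<in> points M" and n: "n \<in> points N"
    by (auto simp: points_biset_prod)
  note closed = biset_rules(1,2)[OF M m] biset_rules(1,2)[OF N n]
  note ops = biset_prod_lact[OF m n] biset_prod_ract[OF m n] biset_prod_lact[OF closed(1) n]
    biset_prod_lact[OF m closed(4)] biset_prod_ract[OF m closed(4)] biset_prod_ract[OF closed(1) n]
  show "lt (biset_prod G M N) g X \<in> points (biset_prod G M N)" "rt (biset_prod G M N) X g \<in> points (biset_prod G M N)" for g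
    unfolding X ops points_biset_prod using m n closed by (intro imageI; simp)+
  show "lt (biset_prod G M N) 0 X = X" "rt (biset_prod G M N) X 0 = X"
    unfolding X ops using biset_rules(3,4)[OF M m] biset_rules(3,4)[OF N n] by simp_all
  show "lt (biset_prod G M N) (g + h) X = lt (biset_prod G M N) g (lt (biset_prod G M N) h X)"
    "rt (biset_prod G M N) X (g + h) = rt (biset_prod G M N) (rt (biset_prod G M N) X g) h"
    "rt (biset_prod G M N) (lt (biset_prod G M N) g X) h = lt (biset_prod G M N) g (rt (biset_prod G M N) X h)" for g h
    unfolding X ops using biset_rules(5)[OF M m] biset_rules(6)[OF N n] by simp_all
qed

text \<open>The class is fixed when (x m, n) and (m, n y) lie in one middle orbit; the inverse of
  the element joining them is the intermediate point of the relational composite.\<close>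

lemma stab_biset_prod:
  assumes m: "m \<in> points M" and n: "n \<in> points N"
  shows "stab (biset_prod G M N) (middle_orbit G M N (m, n)) = stab M m O stab N n"
proof -
  have "(x, y) \<in> stab (biset_prod G M N) (middle_orbit G M N (m, n)) \<longleftrightarrow> (\<exists>g. (x, g) \<in> stab M m \<and> (g, y) \<in> stab N n)" for x y
  proof -
    have "(x, y) \<in> stab (biset_prod G M N) (middle_orbit G M N (m, n)) \<longleftrightarrow>
      (\<exists>g. (lt M x m, n) = mact M N g (m, rt N n y))"
      using m n biset_rules(1,2)[OF M m] biset_rules(1,2)[OF N n]
      by (simp add: stab_def biset_prod_lact biset_prod_ract middle_orbit_eq_iff)
    also have "\<dots> \<longleftrightarrow> (\<exists>g. lt M x m = rt M m (- g) \<and> lt N (- g) n = rt N n y)"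
    proof (intro ex_cong1)
      fix g
      have "n = lt N g (rt N n y) \<longleftrightarrow> lt N (- g) n = lt N (- g) (lt N g (rt N n y))"
        by (intro translate_eq_iff(1)[OF N, symmetric] n biset_rules(1,2)[OF N])
      then show "(lt M x m, n) = mact M N g (m, rt N n y) \<longleftrightarrow> lt M x m = rt M m (- g) \<and> lt N (- g) n = rt N n y"
        unfolding mact_def using biset_rules(8)[OF N biset_rules(2)[OF N n]] by (simp del: \<iota>_minus)
    qed
    also have "\<dots> \<longleftrightarrow> (\<exists>g. (x, g) \<in> stab M m \<and> (g, y) \<in> stab N n)"
      unfolding stab_def by (auto simp del: \<iota>_minus) (metis minus_minus)
    finally show ?thesis .
  qed
  then show ?thesis by auto
qed

end

text \<open>The sum over the points replaces the sum over the orbits of \<open>M\<close>, and avoids choosing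
  representatives of orbits and double cosets.\<close>

definition stab_sum :: "(('s \<times> 's) set \<Rightarrow> 'a::ring_1) \<Rightarrow> ('g, 'x) biset \<Rightarrow> 'a"
  where "stab_sum \<tau> M = (\<Sum>m\<in>points M. \<tau> (stab M m))"

lemma stab_sum_iso:
  assumes M: "finite_biset G M" and "biset_isomorphic G M N"
  shows "stab_sum \<tau> M = stab_sum \<tau> N"
proof -
  obtain h where h: "bij_betw h (points M) (points N)"
    "\<And>g x. x \<in> points M \<Longrightarrow> h (lt M g x) = lt N g (h x) \<and> h (rt M x g) = rt N (h x) g"
    using assms(2) by (auto simp: biset_isomorphic_iff)
  have "stab_sum \<tau> N = (\<Sum>m\<in>points M. \<tau> (stab N (h m)))"
    unfolding stab_sum_def by (rule sum.reindex_bij_betw[OF h(1), symmetric])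
  also have "\<dots> = stab_sum \<tau> M"
    unfolding stab_sum_def by (intro sum.cong refl) (simp add: stab_iso[OF M h(1) _ h(2)])
  finally show ?thesis by simp
qed

lemma stab_sum_biset_sum:
  assumes M: "finite_biset G M" and N: "finite_biset G N"
  shows "finite_biset G (biset_sum M N)" "stab_sum \<tau> (biset_sum M N) = stab_sum \<tau> M + stab_sum \<tau> N"
proof -
  show "finite_biset G (biset_sum M N)"
    using finite_biset.finite_points[OF M] finite_biset.finite_points[OF N]
    by (intro finite_bisetI) (auto simp: biset_sum_def biset_rules[OF M] biset_rules[OF N] simp del: \<iota>_zero)
  have "stab (biset_sum M N) (Inl m) = stab M m" "stab (biset_sum M N) (Inr n) = stab N n" for m n
    by (auto simp: stab_def biset_sum_def)
  then show "stab_sum \<tau> (biset_sum M N) = stab_sum \<tau> M + stab_sum \<tau> N"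
    using finite_biset.finite_points[OF M] finite_biset.finite_points[OF N]
    by (simp add: stab_sum_def biset_sum_def sum.Plus)
qed

text \<open>One factor |G| turns the sum over classes into a sum over M x N by
  \<open>orbit_sum\<close>. The other comes from averaging over the replacement of n by g n, which
  creates the sum over g in the hypothesis.\<close>

lemma stab_sum_biset_prod:
  fixes \<tau> :: "('s \<times> 's) set \<Rightarrow> 'a::ring_1"
  assumes M: "finite_biset G M" and N: "finite_biset G N"
    and \<tau>: "\<And>K L. is_subgroup K \<Longrightarrow> is_subgroup L \<Longrightarrow>
      (\<Sum>g\<in>UNIV. of_nat (card {x. (0, x) \<in> K \<and> (x, 0) \<in> conj_rel g 0 L}) * \<tau> (K O conj_rel g 0 L)) = \<tau> K * \<tau> L"
  shows "of_nat (CARD('s)\<^sup>2) * stab_sum \<tau> (biset_prod G M N) = stab_sum \<tau> M * stab_sum \<tau> N"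
proof -
  let ?P = "biset_prod G M N"
  let ?F = "\<lambda>K L. of_nat (card {x. (0, x) \<in> K \<and> (x, 0) \<in> L}) * \<tau> (K O L)"
  have "of_nat CARD('s) * stab_sum \<tau> ?P =
    (\<Sum>z\<in>points M \<times> points N. of_nat (card {g. mact M N g z = z}) * \<tau> (stab ?P (middle_orbit G M N z)))"
    unfolding stab_sum_def points_biset_prod[OF M N] middle_orbit_mact
    using finite_biset.finite_points[OF M] finite_biset.finite_points[OF N]
    by (intro orbit_sum[symmetric] mact_rules[OF M N]) auto
  also have "\<dots> = (\<Sum>z\<in>points M \<times> points N. ?F (stab M (fst z)) (stab N (snd z)))"
  proof (rule sum.cong[OF refl])
    fix z assume z: "z \<in> points M \<times> points N"
    have "rt M (fst z) (- g) = fst z \<longleftrightarrow> lt M 0 (fst z) = rt M (fst z) g" for g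
      using z biset_rules(3,10,11)[OF M, of "fst z"] by (metis mem_Times_iff)
    moreover have "lt N g (snd z) = snd z \<longleftrightarrow> lt N g (snd z) = rt N (snd z) 0" for g
      using z biset_rules(4)[OF N, of "snd z"] by auto
    \<comment> \<open>The middle action fixes (m, n) for g in the intersection of k_2 of one
      stabilizer with k_1 of the other: the weight of the Mackey identity.\<close>
    ultimately have "{g. mact M N g z = z} = {x. (0, x) \<in> stab M (fst z) \<and> (x, 0) \<in> stab N (snd z)}"
      unfolding stab_def mact_def prod_eq_iff fst_conv snd_conv by (simp del: \<iota>_minus \<iota>_zero)
    then show "of_nat (card {g. mact M N g z = z}) * \<tau> (stab ?P (middle_orbit G M N z)) =
      ?F (stab M (fst z)) (stab N (snd z))"
      using z stab_biset_prod[OF M N, of "fst z" "snd z"] by auto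
  qed
  also have "\<dots> = (\<Sum>m\<in>points M. \<Sum>n\<in>points N. ?F (stab M m) (stab N n))"
    by (simp add: sum.cartesian_product split_beta)
  finally have 1: "of_nat CARD('s) * stab_sum \<tau> ?P = \<dots>" .
  \<comment> \<open>Left translation by g permutes N and conjugates each stabilizer in its first
    component.\<close>
  have shift: "(\<Sum>n\<in>points N. f (stab N n)) = (\<Sum>n\<in>points N. f (conj_rel g 0 (stab N n)))"
    for g and f :: "('s \<times> 's) set \<Rightarrow> 'a"
  proof -
    have bij: "bij_betw (lt N g) (points N) (points N)"
      by (rule bij_betw_byWitness[where f' = "lt N (- g)"]) (auto simp: biset_rules[OF N] simp del: \<iota>_minus)
    have "stab N (lt N g n) = conj_rel g 0 (stab N n)" if "n \<in> points N" for n
      using stab_translate[OF N that, of g 0] biset_rules(4)[OF N that] by (simp del: \<iota>_zero)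
    then have "(\<Sum>n\<in>points N. f (conj_rel g 0 (stab N n))) = (\<Sum>n\<in>points N. f (stab N (lt N g n)))"
      by simp
    then show ?thesis using sum.reindex_bij_betw[OF bij, of "\<lambda>n. f (stab N n)"] by simp
  qed
  have "of_nat CARD('s) * (\<Sum>m\<in>points M. \<Sum>n\<in>points N. ?F (stab M m) (stab N n)) =
    (\<Sum>m\<in>points M. \<Sum>g\<in>(UNIV :: 's set). \<Sum>n\<in>points N. ?F (stab M m) (stab N n))"
    by (simp add: sum_distrib_left)
  also have "\<dots> = (\<Sum>m\<in>points M. \<Sum>g\<in>UNIV. \<Sum>n\<in>points N. ?F (stab M m) (conj_rel g 0 (stab N n)))"
    by (rule sum.cong[OF refl], rule sum.cong[OF refl], rule shift)
  also have "\<dots> = (\<Sum>m\<in>points M. \<Sum>n\<in>points N. \<Sum>g\<in>UNIV. ?F (stab M m) (conj_rel g 0 (stab N n)))"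
    by (rule sum.cong[OF refl], rule sum.swap)
  also have "\<dots> = (\<Sum>m\<in>points M. \<Sum>n\<in>points N. \<tau> (stab M m) * \<tau> (stab N n))"
    by (intro sum.cong refl \<tau> is_subgroup_stab M N)
  also have "\<dots> = stab_sum \<tau> M * stab_sum \<tau> N"
    by (simp add: stab_sum_def sum_product)
  finally show ?thesis
    unfolding 1[symmetric] by (simp add: power2_eq_square mult.assoc)
qed

end

text \<open>A normal form without differences; \<open>add_uminus_conv_diff\<close> is a simp rule in
  the opposite direction and is deleted wherever this is used for simplification.\<close>

lemmas group_expand = minus_add diff_conv_add_uminus add.assoc

context enumerated_group
begin

subsection \<open>Transitive bisets\<close>

definition \<kappa> :: "'g \<Rightarrow> 's" where "\<kappa> = inv_into UNIV \<iota>"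

lemma \<kappa>_\<iota> [simp]: "\<kappa> (\<iota> x) = x"
  using \<iota>_bij by (simp add: \<kappa>_def bij_betw_def)

definition coset :: "('s \<times> 's) set \<Rightarrow> 's \<Rightarrow> 's \<Rightarrow> ('s \<times> 's) set"
  where "coset L a b = {(x, y). (- a + x, - b + y) \<in> L}"

text \<open>The transitive biset (G x G)/L; the right action of g translates the second component
  from the left by g^-1.\<close>

definition coset_biset :: "('s \<times> 's) set \<Rightarrow> ('g, ('s \<times> 's) set) biset"
  where "coset_biset L = \<lparr>points = range (\<lambda>(a, b). coset L a b),
    lact = (\<lambda>g X. (\<lambda>(x, y). (\<kappa> g + x, y)) ` X), ract = (\<lambda>X g. (\<lambda>(x, y). (x, - \<kappa> g + y)) ` X)\<rparr>"

lemma coset_biset_ops: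
  "lt (coset_biset L) x (coset L a b) = coset L (x + a) b"
  "rt (coset_biset L) (coset L a b) y = coset L a (- y + b)"
proof -
  have "(\<lambda>(u, v). (x + u, v)) ` coset L a b = coset L (x + a) b"
  proof
    show "(\<lambda>(u, v). (x + u, v)) ` coset L a b \<subseteq> coset L (x + a) b"
      by (auto simp: coset_def group_expand simp del: add_uminus_conv_diff)
    show "coset L (x + a) b \<subseteq> (\<lambda>(u, v). (x + u, v)) ` coset L a b"
      by (auto simp: coset_def group_expand simp del: add_uminus_conv_diff
          intro!: image_eqI[of "(p, q)" _ "(- x + p, q)" for p q])
  qed
  then show "lt (coset_biset L) x (coset L a b) = coset L (x + a) b"
    by (simp add: coset_biset_def)
  have "(\<lambda>(u, v). (u, - y + v)) ` coset L a b = coset L a (- y + b)"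
  proof
    show "(\<lambda>(u, v). (u, - y + v)) ` coset L a b \<subseteq> coset L a (- y + b)"
      by (auto simp: coset_def group_expand simp del: add_uminus_conv_diff)
    show "coset L a (- y + b) \<subseteq> (\<lambda>(u, v). (u, - y + v)) ` coset L a b"
      by (auto simp: coset_def group_expand simp del: add_uminus_conv_diff
          intro!: image_eqI[of "(p, q)" _ "(p, y + q)" for p q])
  qed
  then show "rt (coset_biset L) (coset L a b) y = coset L a (- y + b)"
    by (simp add: coset_biset_def)
qed

lemma points_coset_biset: "points (coset_biset L) = range (\<lambda>(a, b). coset L a b)"
  by (simp add: coset_biset_def)

lemma finite_coset_biset: "finite_biset G (coset_biset L)"
proof -
  have "coset L a b \<in> points (coset_biset L)" for a b
    unfolding points_coset_biset by (rule range_eqI[of _ _ "(a, b)"]) simp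
  note closed = this
  show ?thesis
  proof (rule finite_bisetI)
    show "finite (points (coset_biset L))" by (simp add: points_coset_biset)
    fix X assume "X \<in> points (coset_biset L)"
    then obtain a b where X: "X = coset L a b" by (auto simp: points_coset_biset)
    show "lt (coset_biset L) g X \<in> points (coset_biset L)" "rt (coset_biset L) X g \<in> points (coset_biset L)"
      "lt (coset_biset L) 0 X = X" "rt (coset_biset L) X 0 = X"
      "lt (coset_biset L) (g + h) X = lt (coset_biset L) g (lt (coset_biset L) h X)"
      "rt (coset_biset L) X (g + h) = rt (coset_biset L) (rt (coset_biset L) X g) h"
      "rt (coset_biset L) (lt (coset_biset L) g X) h = lt (coset_biset L) g (rt (coset_biset L) X h)" for g h
      unfolding X coset_biset_ops
      by (simp_all add: closed group_expand del: add_uminus_conv_diff)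
  qed
qed

lemma coset_eq_iff:
  assumes "is_subgroup L"
  shows "coset L a b = coset L c d \<longleftrightarrow> (- c + a, - d + b) \<in> L"
proof
  assume eq: "coset L a b = coset L c d"
  have "(a, b) \<in> coset L a b" using assms by (simp add: coset_def is_subgroup_def)
  then show "(- c + a, - d + b) \<in> L" unfolding eq by (simp add: coset_def)
next
  assume L: "(- c + a, - d + b) \<in> L"
  then have "(- (- c + a), - (- d + b)) \<in> L" using assms unfolding is_subgroup_def by blast
  then have L': "(- a + c, - b + d) \<in> L" by (simp only: minus_add minus_minus)
  have "(- c + x, - d + y) \<in> L" if "(- a + x, - b + y) \<in> L" for x y
  proof -
    have "(- c + a + (- a + x), - d + b + (- b + y)) \<in> L" using assms L that unfolding is_subgroup_def by blast
    then show ?thesis by (simp add: add.assoc)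
  qed
  moreover have "(- a + x, - b + y) \<in> L" if "(- c + x, - d + y) \<in> L" for x y
  proof -
    have "(- a + c + (- c + x), - b + d + (- d + y)) \<in> L"
      using assms L' that unfolding is_subgroup_def by blast
    then show ?thesis by (simp add: add.assoc)
  qed
  ultimately show "coset L a b = coset L c d" by (auto simp: coset_def)
qed

lemma stab_coset: "is_subgroup L \<Longrightarrow> stab (coset_biset L) (coset L 0 0) = L"
  by (simp add: stab_def coset_biset_ops coset_eq_iff)

definition transitive_at :: "('g, 'x) biset \<Rightarrow> 'x \<Rightarrow> bool"
  where "transitive_at M m \<longleftrightarrow> m \<in> points M \<and> points M = range (\<lambda>(a, b). lt M a (rt M m b))"

lemma transitive_coset_biset: "transitive_at (coset_biset L) (coset L 0 0)"
proof -
  have "coset L a b = lt (coset_biset L) a (rt (coset_biset L) (coset L 0 0) (- b))"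
    "lt (coset_biset L) a (rt (coset_biset L) (coset L 0 0) b) = coset L a (- b)" for a b
    by (simp_all only: coset_biset_ops) simp_all
  then show ?thesis
    unfolding transitive_at_def points_coset_biset
    by (auto intro: range_eqI[of _ _ "(a, - b)" for a b] range_eqI[of _ _ "(a, b)" for a b] simp del: \<iota>_minus)
qed

lemma coset_in_points: "coset L 0 0 \<in> points (coset_biset L)"
  using transitive_coset_biset unfolding transitive_at_def by (rule conjunct1)

lemma translate_point_eq:
  assumes M: "finite_biset G M" and m: "m \<in> points M"
  shows "lt M a (rt M m b) = lt M c (rt M m d) \<longleftrightarrow> (- c + a, d - b) \<in> stab M m"
proof -
  note rules = biset_rules[OF M]
  have "lt M a (rt M m b) = lt M c (rt M m d) \<longleftrightarrow>
    lt M (- c) (lt M a (rt M m b)) = lt M (- c) (lt M c (rt M m d))"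
    by (intro translate_eq_iff(1)[OF M, symmetric] rules(1,2) m)
  also have "\<dots> \<longleftrightarrow> lt M (- c + a) (rt M m b) = rt M m d"
    by (simp only: rules(8)[OF rules(2)[OF m]] rules(5)[OF rules(2)[OF m]])
  also have "\<dots> \<longleftrightarrow> rt M (lt M (- c + a) (rt M m b)) (- b) = rt M (rt M m d) (- b)"
    by (intro translate_eq_iff(2)[OF M, symmetric] rules(1,2) m)
  also have "\<dots> \<longleftrightarrow> lt M (- c + a) m = rt M m (d - b)"
    by (simp only: rules(7)[OF rules(2)[OF m]] rules(10)[OF m] rules(6)[OF m] diff_conv_add_uminus)
  finally show ?thesis by (simp add: stab_def)
qed

text \<open>Sending a m b to a n b is well defined and injective, because by
  \<open>translate_point_eq\<close> the common stabilizer decides which translates coincide.\<close>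

lemma transitive_isomorphic:
  assumes M: "finite_biset G M" and N: "finite_biset G N"
    and m: "transitive_at M m" and n: "transitive_at N n" and eq: "stab M m = stab N n"
  shows "biset_isomorphic G M N"
proof -
  note mp = m[unfolded transitive_at_def, THEN conjunct1] and np = n[unfolded transitive_at_def, THEN conjunct1]
  define h where "h x = (THE y. \<exists>a b. x = lt M a (rt M m b) \<and> y = lt N a (rt N n b))" for x
  have h: "h (lt M a (rt M m b)) = lt N a (rt N n b)" for a b
    unfolding h_def
  proof (rule the_equality)
    fix y assume "\<exists>c d. lt M a (rt M m b) = lt M c (rt M m d) \<and> y = lt N c (rt N n d)"
    then obtain c d where "lt M a (rt M m b) = lt M c (rt M m d)" and y: "y = lt N c (rt N n d)" by blast
    then have "lt N a (rt N n b) = lt N c (rt N n d)"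
      by (simp only: translate_point_eq[OF M mp] translate_point_eq[OF N np] eq)
    then show "y = lt N a (rt N n b)" using y by simp
  qed blast
  have ptM: "\<exists>a b. x = lt M a (rt M m b)" if "x \<in> points M" for x
    using that m by (auto simp: transitive_at_def)
  have ptN: "\<exists>a b. y = lt N a (rt N n b)" if "y \<in> points N" for y
    using that n by (auto simp: transitive_at_def)
  have "bij_betw h (points M) (points N)"
  proof (intro bij_betwI')
    fix x y assume "x \<in> points M" "y \<in> points M"
    then obtain a b c d where "x = lt M a (rt M m b)" "y = lt M c (rt M m d)" using ptM by metis
    then show "h x = h y \<longleftrightarrow> x = y"
      by (simp add: h translate_point_eq[OF M mp] translate_point_eq[OF N np] eq)
  next
    fix x assume "x \<in> points M"
    then obtain a b where "x = lt M a (rt M m b)" using ptM by metis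
    then show "h x \<in> points N" using biset_rules(1,2)[OF N] np by (simp add: h)
  next
    fix y assume "y \<in> points N"
    then obtain a b where y: "y = lt N a (rt N n b)" using ptN by metis
    then show "\<exists>x\<in>points M. y = h x"
      using biset_rules(1,2)[OF M] mp by (intro bexI[of _ "lt M a (rt M m b)"]) (simp_all add: h)
  qed
  moreover have "h (lt M g x) = lt N g (h x) \<and> h (rt M x g) = rt N (h x) g" if "x \<in> points M" for g x
  proof -
    obtain a b where x: "x = lt M a (rt M m b)" using ptM \<open>x \<in> points M\<close> by metis
    note rM = biset_rules[OF M] and rN = biset_rules[OF N]
    have "lt M g x = lt M (g + a) (rt M m b)" "rt M x g = lt M a (rt M m (b + g))"
      by (simp_all only: x rM(5)[OF rM(2)[OF mp]] rM(6)[OF mp] rM(7)[OF rM(2)[OF mp]])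
    moreover have "lt N g (h x) = lt N (g + a) (rt N n b)" "rt N (h x) g = lt N a (rt N n (b + g))"
      by (simp_all only: x h rN(5)[OF rN(2)[OF np]] rN(6)[OF np] rN(7)[OF rN(2)[OF np]])
    ultimately show ?thesis by (simp only: h)
  qed
  ultimately show ?thesis unfolding biset_isomorphic_iff by blast
qed

lemma stab_sum_coset_biset:
  assumes L: "is_subgroup L" and \<tau>: "\<And>a b. \<tau> (conj_rel a b L) = \<tau> L"
  shows "stab_sum \<tau> (coset_biset L) = of_nat (card (points (coset_biset L))) * \<tau> L"
    and "card (points (coset_biset L)) > 0"
proof -
  have "\<tau> (stab (coset_biset L) x) = \<tau> L" if x: "x \<in> points (coset_biset L)" for x
  proof -
    obtain a b where "x = lt (coset_biset L) a (rt (coset_biset L) (coset L 0 0) b)"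
      using transitive_coset_biset[of L] x by (auto simp: transitive_at_def)
    then show ?thesis
      by (simp add: stab_translate[OF finite_coset_biset coset_in_points] stab_coset[OF L] \<tau> del: \<iota>_minus)
  qed
  then show "stab_sum \<tau> (coset_biset L) = of_nat (card (points (coset_biset L))) * \<tau> L"
    by (simp add: stab_sum_def)
  show "card (points (coset_biset L)) > 0"
    using finite_biset.finite_points[OF finite_coset_biset] by (simp add: card_gt_0_iff points_coset_biset)
qed

text \<open>The unit has the diagonal as stabilizer, every other point a conjugate of it.\<close>

lemma regular_biset_stab_sum:
  assumes \<tau>: "\<And>a b. \<tau> (conj_rel a b Id) = \<tau> Id"
  shows "finite_biset G (regular_biset G)" "stab_sum \<tau> (regular_biset G) = of_nat CARD('s) * \<tau> Id"
proof -
  have ops: "lt (regular_biset G) x (\<iota> z) = \<iota> (x + z)" "rt (regular_biset G) (\<iota> z) y = \<iota> (z + y)" for x y z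
    by (simp_all add: regular_biset_def \<iota>_add)
  have pts: "points (regular_biset G) = range \<iota>" by (simp add: regular_biset_def carrier_\<iota>)
  show "finite_biset G (regular_biset G)"
    by (intro finite_bisetI) (auto simp: pts ops add.assoc simp del: \<iota>_zero)
  have "stab (regular_biset G) (\<iota> z) = conj_rel z 0 Id" for z
  proof -
    have "x + z = z + y \<longleftrightarrow> - z + x + z = y" for x y
      by (metis add.assoc add_minus_cancel minus_add_cancel)
    then show ?thesis by (auto simp: stab_def ops conj_rel_def)
  qed
  then have "\<tau> (stab (regular_biset G) (\<iota> z)) = \<tau> Id" for z by (simp add: \<tau>)
  moreover have "inj \<iota>" using \<iota>_bij by (simp add: bij_betw_def)
  ultimately show "stab_sum \<tau> (regular_biset G) = of_nat CARD('s) * \<tau> Id"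
    by (simp add: stab_sum_def pts sum.reindex)
qed

subsection \<open>The Burnside relations\<close>

definition burnside_span :: "(('g, nat) biset set \<Rightarrow>\<^sub>0 rat) set"
  where "burnside_span = Modules.module.span (\<lambda>c. Poly_Mapping.map ((*) c)) (burnside_relations G)"

interpretation PM: Modules.module "\<lambda>c :: rat. Poly_Mapping.map ((*) c) :: (('g, nat) biset set \<Rightarrow>\<^sub>0 rat) \<Rightarrow> _"
  by (rule module_poly_mapping)

definition class_vec :: "('g, 'x) biset \<Rightarrow> (('g, nat) biset set \<Rightarrow>\<^sub>0 rat)"
  where "class_vec M = Poly_Mapping.single (biset_class G M) 1"

lemma class_vec_iso: "finite_biset G M \<Longrightarrow> finite_biset G N \<Longrightarrow> biset_isomorphic G M N \<Longrightarrow> class_vec M = class_vec N"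
  using biset_class_eq_iff[of M N] by (simp add: class_vec_def)

lemma class_vec_sum:
  fixes M N :: "('g, nat) biset"
  assumes "finite_biset G M" "finite_biset G N"
  shows "class_vec (biset_sum M N) - (class_vec M + class_vec N) \<in> burnside_span"
  unfolding burnside_span_def class_vec_def
  by (rule PM.span_base) (use assms in \<open>auto simp: burnside_relations_def\<close>)

lemma sub_biset:
  assumes M: "finite_biset G M" and S: "S \<subseteq> points M"
    and "\<And>x g. x \<in> S \<Longrightarrow> lt M g x \<in> S" "\<And>x g. x \<in> S \<Longrightarrow> rt M x g \<in> S"
  shows "finite_biset G (M\<lparr>points := S\<rparr>)"
proof -
  have "x \<in> points M" if "x \<in> S" for x using S that by blast
  then show ?thesis
    using assms finite_subset[OF S finite_biset.finite_points[OF M]]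
    by (intro finite_bisetI) (auto simp: biset_rules[OF M] simp del: \<iota>_zero)
qed

lemma bij_betw_split_sum:
  "S \<subseteq> P \<Longrightarrow> bij_betw (\<lambda>x. if x \<in> S then Inl x else Inr x) P (S <+> (P - S))"
  by (intro bij_betwI') (auto intro: bexI)

text \<open>Induction on the number of points: split off one orbit, which is the coset biset of the
  representative of its stabilizer.\<close>

lemma class_vec_in_span:
  fixes M :: "('g, nat) biset"
  assumes M: "finite_biset G M"
    and reps: "\<And>L. is_subgroup L \<Longrightarrow> \<exists>a b. conj_rel a b L \<in> \<L>"
  shows "class_vec M \<in> PM.span (burnside_relations G \<union> (\<lambda>L. class_vec (coset_biset L)) ` \<L>)" (is "_ \<in> ?W")
  using M
proof (induction "card (points M)" arbitrary: M rule: less_induct)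
  case less
  note M = less.prems
  have span: "burnside_span \<subseteq> ?W" unfolding burnside_span_def by (rule PM.span_mono) simp
  show ?case
  proof (cases "points M = {}")
    case True
    \<comment> \<open>For the empty biset the relation reads [M] = [M] + [M], so [M] is itself in
      the span of the relations.\<close>
    have "biset_isomorphic G (biset_sum M M) M"
      unfolding biset_isomorphic_iff by (simp add: biset_sum_def True Plus_def bij_betw_def)
    then have "class_vec (biset_sum M M) = class_vec M"
      using class_vec_iso stab_sum_biset_sum(1)[OF M M] M by blast
    then have "class_vec (biset_sum M M) - (class_vec M + class_vec M) = - class_vec M" by simp
    then have "- class_vec M \<in> ?W" using class_vec_sum[OF M M] span by auto
    then show ?thesis using PM.span_neg by fastforce
  next
    case False
    then obtain m where m: "m \<in> points M" by blast
    note rules = biset_rules[OF M]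
    let ?O = "range (\<lambda>(a, b). lt M a (rt M m b))"
    have O_sub: "?O \<subseteq> points M" using m by (auto simp: rules)
    have ops: "lt M g (lt M a (rt M m b)) = lt M (g + a) (rt M m b)"
      "rt M (lt M a (rt M m b)) g = lt M a (rt M m (b + g))" for g a b
      by (simp_all only: rules(5)[OF rules(2)[OF m]] rules(6)[OF m] rules(7)[OF rules(2)[OF m]])
    have O_closed: "lt M g x \<in> ?O" "rt M x g \<in> ?O" if x: "x \<in> ?O" for x g
    proof -
      obtain a b where x: "x = lt M a (rt M m b)" using x by auto
      show "lt M g x \<in> ?O" unfolding x ops by (rule range_eqI[of _ _ "(g + a, b)"]) simp
      show "rt M x g \<in> ?O" unfolding x ops by (rule range_eqI[of _ _ "(a, b + g)"]) simp
    qed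
    have m_O: "m \<in> ?O" using rules(3)[OF rules(2)[OF m]] rules(4)[OF m] by (auto simp: image_iff simp del: \<iota>_zero) metis
    have D_closed: "lt M g x \<in> points M - ?O" "rt M x g \<in> points M - ?O" if x: "x \<in> points M - ?O" for x g
    proof -
      have "lt M (- g) (lt M g x) = x" "rt M (rt M x g) (- g) = x" using x rules(8,10) by blast+
      then show "lt M g x \<in> points M - ?O" "rt M x g \<in> points M - ?O"
        using x rules(1,2) O_closed(1)[of "lt M g x" "- g"] O_closed(2)[of "rt M x g" "- g"] by (metis DiffE DiffI)+
    qed
    define P where "P = M\<lparr>points := ?O\<rparr>"
    define Q where "Q = M\<lparr>points := points M - ?O\<rparr>"
    have P: "finite_biset G P" unfolding P_def by (rule sub_biset[OF M O_sub O_closed])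
    have Q: "finite_biset G Q" unfolding Q_def by (rule sub_biset[OF M _ D_closed]) auto
    have "biset_isomorphic G M (biset_sum P Q)"
      unfolding biset_isomorphic_iff
    proof (intro exI conjI allI ballI)
      let ?h = "\<lambda>x. if x \<in> ?O then Inl x else Inr x"
      show "bij_betw ?h (points M) (points (biset_sum P Q))"
        using bij_betw_split_sum[OF O_sub] by (simp add: biset_sum_def P_def Q_def)
      fix g x assume x: "x \<in> points M"
      show "?h (lt M g x) = lt (biset_sum P Q) g (?h x)" "?h (rt M x g) = rt (biset_sum P Q) (?h x) g"
        using O_closed[of x g] D_closed[of x g] x by (auto simp: biset_sum_def P_def Q_def)
    qed
    then have "class_vec M = class_vec (biset_sum P Q)"
      using class_vec_iso M stab_sum_biset_sum(1)[OF P Q] by blast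
    then have "class_vec M - (class_vec P + class_vec Q) \<in> ?W"
      using class_vec_sum[OF P Q] span by auto
    moreover have "class_vec Q \<in> ?W"
    proof (rule less.hyps[OF _ Q])
      show "card (points Q) < card (points M)"
        using m m_O finite_biset.finite_points[OF M] unfolding Q_def by (intro psubset_card_mono) auto
    qed
    moreover have "class_vec P \<in> ?W"
    proof -
      have trans: "transitive_at P (lt M a (rt M m b))" for a b
      proof -
        have "?O \<subseteq> range (\<lambda>(c, d). lt M c (rt M (lt M a (rt M m b)) d))"
        proof clarify
          fix c d
          have "lt M c (rt M m d) = lt M (c - a) (rt M (lt M a (rt M m b)) (- b + d))"
            by (simp only: ops) (simp del: \<iota>_minus)
          then show "lt M c (rt M m d) \<in> range (\<lambda>(c, d). lt M c (rt M (lt M a (rt M m b)) d))"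
            by (metis (mono_tags, lifting) case_prod_conv rangeI)
        qed
        moreover have mem: "lt M a (rt M m b) \<in> ?O" by (rule range_eqI[of _ _ "(a, b)"]) simp
        moreover have "range (\<lambda>(c, d). lt M c (rt M (lt M a (rt M m b)) d)) \<subseteq> ?O"
          by clarify (rule O_closed[OF O_closed(2)[OF mem]])
        ultimately show ?thesis unfolding transitive_at_def by (simp add: P_def subset_antisym)
      qed
      obtain a b where ab: "conj_rel a b (stab M m) \<in> \<L>" using reps[OF is_subgroup_stab[OF M m]] by blast
      \<comment> \<open>By \<open>stab_translate\<close> the base point \<open>?p\<close> has
        exactly the representative \<open>?L\<close> as stabilizer, not merely a conjugate of
        it.\<close>
      let ?L = "conj_rel a b (stab M m)" and ?p = "lt M a (rt M m (- b))"
      have "stab P ?p = stab M ?p" by (simp add: stab_def P_def)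
      also have "\<dots> = ?L" using stab_translate[OF M m, of a "- b"] by simp
      finally have L: "stab P ?p = ?L" .
      have "is_subgroup (stab P ?p)"
        by (rule is_subgroup_stab[OF P trans[unfolded transitive_at_def, THEN conjunct1]])
      then have "is_subgroup ?L" unfolding L .
      then have "biset_isomorphic G P (coset_biset ?L)"
        by (intro transitive_isomorphic[OF P finite_coset_biset trans[of a "- b"] transitive_coset_biset])
          (simp only: L stab_coset)
      then have "class_vec P = class_vec (coset_biset ?L)"
        by (intro class_vec_iso P finite_coset_biset)
      then show ?thesis using ab by (intro PM.span_base) auto
    qed
    ultimately have "class_vec M - (class_vec P + class_vec Q) + (class_vec P + class_vec Q) \<in> ?W"
      by (intro PM.span_add)
    then show ?thesis by simp
  qed
qed


subsection \<open>The double Burnside algebra\<close>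

text \<open>The kernel of the extended \<open>\<phi>\<close> is the span of the relations: modulo
  these every class is a combination of coset bisets, whose images are independent.
  \<open>linear_ext_fibre_iso\<close> then identifies the quotient with S.\<close>

theorem double_burnside_iso:
  fixes scale :: "rat \<Rightarrow> 'a::ring_1 \<Rightarrow> 'a" and \<tau> :: "('s \<times> 's) set \<Rightarrow> 'a" and S :: "(rat, 'a) module"
  assumes scaled: "scaled_ring scale"
    and S: "assoc_algebra S" "carrier S = UNIV" "mult S = (*)" "add S = (+)" "zero S = 0" "one S = 1" "smult S = scale"
    and \<tau>_mult: "\<And>K L. is_subgroup K \<Longrightarrow> is_subgroup L \<Longrightarrow>
      (\<Sum>g\<in>UNIV. of_nat (card {x. (0, x) \<in> K \<and> (x, 0) \<in> conj_rel g 0 L}) * \<tau> (K O conj_rel g 0 L)) = \<tau> K * \<tau> L"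
    and \<tau>_conj: "\<And>a b L. \<tau> (conj_rel a b L) = \<tau> L"
    and \<tau>_Id: "\<tau> Id = of_nat CARD('s)"
    and \<L>: "finite \<L>" "\<And>L. L \<in> \<L> \<Longrightarrow> is_subgroup L"
    and reps: "\<And>L. is_subgroup L \<Longrightarrow> \<exists>a b. conj_rel a b L \<in> \<L>"
    and indep: "\<And>c L. (\<Sum>L\<in>\<L>. scale (c L) (\<tau> L)) = 0 \<Longrightarrow> L \<in> \<L> \<Longrightarrow> c L = 0"
    and spanning: "\<And>x. \<exists>c. x = (\<Sum>L\<in>\<L>. scale (c L) (\<tau> L))"
  shows "algebra_iso S (double_burnside G :: (rat, _) module) \<noteq> {}"
proof -
  interpret scaled_ring scale by (rule scaled)
  let ?n = "of_nat (CARD('s)\<^sup>2) :: rat" and ?cls = "biset_classes G" and ?C = "\<lambda>L. coset_biset L"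
  let ?m = "\<lambda>X Y. Some (class_prod G X Y)"
  \<comment> \<open>The chosen representative is immaterial, as \<open>stab_sum\<close> is invariant
    under isomorphism.\<close>
  define \<phi> where "\<phi> X = scale (1 / ?n) (stab_sum \<tau> (SOME M. M \<in> X))" for X :: "('g, nat) biset set"
  have n: "?n \<noteq> 0" by simp
  have cancel: "1 / q * (1 / q) * q = 1 / q" if "q \<noteq> 0" for q :: rat using that by simp
  have of_nat_scale: "of_nat k * x = scale (of_nat k) x" for k and x :: 'a
    by (induction k) (simp_all add: scale_left_distrib distrib_right)
  have \<phi>_class: "\<phi> (biset_class G M) = scale (1 / ?n) (stab_sum \<tau> M)" if M: "finite_biset G M"
    for M :: "('g, 'x) biset"
    using stab_sum_iso[OF M some_in_biset_class(2)[OF M], of \<tau>] by (simp add: \<phi>_def)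
  have classE: "\<exists>M :: ('g, nat) biset. finite_biset G M \<and> X = biset_class G M" if "X \<in> ?cls" for X
    using that by (auto simp: biset_classes_def)
  have prod: "class_prod G X Y \<in> ?cls" "\<phi> X * \<phi> Y = \<phi> (class_prod G X Y)" if XY: "X \<in> ?cls" "Y \<in> ?cls" for X Y
  proof -
    define M where "M = (SOME M. M \<in> X)"
    define N where "N = (SOME N. N \<in> Y)"
    have M: "finite_biset G M" and N: "finite_biset G N"
      using classE[OF XY(1)] classE[OF XY(2)] some_in_biset_class(1) unfolding M_def N_def by blast+
    have eq: "class_prod G X Y = biset_class G (biset_prod G M N)" by (simp add: class_prod_def M_def N_def)
    note fin = finite_biset_prod[OF M N]
    show "class_prod G X Y \<in> ?cls" unfolding eq by (rule biset_class_in_classes[OF fin])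
    have "\<phi> X * \<phi> Y = scale (1 / ?n * (1 / ?n)) (stab_sum \<tau> M * stab_sum \<tau> N)"
      by (simp add: \<phi>_def M_def N_def scale_mult_left scale_mult_right)
    also have "\<dots> = scale (1 / ?n * (1 / ?n)) (scale ?n (stab_sum \<tau> (biset_prod G M N)))"
      by (simp only: stab_sum_biset_prod[OF M N \<tau>_mult, symmetric] of_nat_scale)
    also have "\<dots> = scale (1 / ?n) (stab_sum \<tau> (biset_prod G M N))"
      by (simp only: scale_scale cancel[OF n])
    finally show "\<phi> X * \<phi> Y = \<phi> (class_prod G X Y)" by (simp add: eq \<phi>_class[OF fin])
  qed
  \<comment> \<open>The index of L divided by |G|^2, that is 1/|L|: the ratio of the image of the
    coset biset to \<tau>(L).\<close>
  define k where "k L = of_nat (card (points (?C L))) / ?n" for L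
  have k: "k L \<noteq> 0" "\<phi> (biset_class G (?C L)) = scale (k L) (\<tau> L)" if "L \<in> \<L>" for L
    using stab_sum_coset_biset[of L \<tau>, OF \<L>(2)[OF that] \<tau>_conj] n
    by (simp_all add: k_def \<phi>_class[OF finite_coset_biset] of_nat_scale del: card_0_eq)
  have lin_vec: "linear_ext \<phi> (class_vec (?C L)) = scale (k L) (\<tau> L)" if "L \<in> \<L>" for L
    by (simp add: class_vec_def k[OF that])
  note unit = regular_biset_stab_sum[of \<tau>, OF \<tau>_conj]
  have C_cls: "biset_class G (?C L) \<in> ?cls" for L by (rule biset_class_in_classes[OF finite_coset_biset])
  have onto: "linear_ext \<phi> ` {f. Poly_Mapping.keys f \<subseteq> ?cls} = carrier S"
  proof -
    have "x \<in> linear_ext \<phi> ` {f. Poly_Mapping.keys f \<subseteq> ?cls}" for x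
    proof -
      obtain c where x: "x = (\<Sum>L\<in>\<L>. scale (c L) (\<tau> L))" using spanning by blast
      let ?f = "\<Sum>L\<in>\<L>. Poly_Mapping.single (biset_class G (?C L)) (c L / k L)"
      have "Poly_Mapping.keys ?f \<subseteq> ?cls"
        by (rule order.trans[OF keys_sum]) (use C_cls in \<open>auto split: if_splits\<close>)
      moreover have "linear_ext \<phi> ?f = x"
        unfolding x linear_ext_sum by (intro sum.cong refl) (simp add: k)
      ultimately show ?thesis by blast
    qed
    then show ?thesis by (auto simp: S)
  qed
  have kernel: "burnside_span = {f. Poly_Mapping.keys f \<subseteq> ?cls \<and> linear_ext \<phi> f = 0}" (is "_ = ?K")
  proof
    have "burnside_relations G \<subseteq> ?K"
    proof
      fix r :: "('g, nat) biset set \<Rightarrow>\<^sub>0 rat" assume "r \<in> burnside_relations G"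
      then obtain M N :: "('g, nat) biset" where M: "finite_biset G M" and N: "finite_biset G N"
        and r: "r = class_vec (biset_sum M N) - (class_vec M + class_vec N)"
        by (auto simp: burnside_relations_def class_vec_def)
      note sum = stab_sum_biset_sum(1)[OF M N] stab_sum_biset_sum(2)[OF M N, of \<tau>]
      have kv: "Poly_Mapping.keys (class_vec K) = {biset_class G K}" for K :: "('g, 'x) biset"
        by (simp add: class_vec_def)
      have "Poly_Mapping.keys r \<subseteq> Poly_Mapping.keys (class_vec (biset_sum M N)) \<union> Poly_Mapping.keys (class_vec M + class_vec N)"
        unfolding r by (rule keys_diff)
      also have "\<dots> \<subseteq> Poly_Mapping.keys (class_vec (biset_sum M N)) \<union>
          (Poly_Mapping.keys (class_vec M) \<union> Poly_Mapping.keys (class_vec N))"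
        by (intro Un_mono order.refl Poly_Mapping.keys_add)
      also have "\<dots> \<subseteq> ?cls" by (simp add: kv biset_class_in_classes M N sum(1))
      finally show "r \<in> ?K"
        using sum(2) by (simp add: r class_vec_def linear_ext_diff linear_ext_add \<phi>_class M N sum(1) scale_right_distrib)
    qed
    moreover have "PM.subspace ?K"
    proof (rule PM.subspaceI)
      show "x + y \<in> ?K" if "x \<in> ?K" "y \<in> ?K" for x y
        using that Poly_Mapping.keys_add[of x y] by (auto simp: linear_ext_add)
      show "Poly_Mapping.map ((*) c) x \<in> ?K" if x: "x \<in> ?K" for c x
      proof -
        have "Poly_Mapping.keys (Poly_Mapping.map ((*) c) x) \<subseteq> Poly_Mapping.keys x" by (auto simp: in_keys_iff)
        then show ?thesis using x by (auto simp: linear_ext_smult)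
      qed
    qed simp
    ultimately show "burnside_span \<subseteq> ?K" unfolding burnside_span_def by (rule PM.span_minimal)
    show "?K \<subseteq> burnside_span"
    proof
      fix f assume f: "f \<in> ?K"
      let ?V = "range (\<lambda>c. \<Sum>L\<in>\<L>. Poly_Mapping.map ((*) (c L)) (class_vec (?C L)))"
      have V: "PM.span ((\<lambda>L. class_vec (?C L)) ` \<L>) \<subseteq> ?V"
      proof (rule PM.span_minimal)
        show "(\<lambda>L. class_vec (?C L)) ` \<L> \<subseteq> ?V"
        proof clarify
          fix L assume "L \<in> \<L>"
          then have "class_vec (?C L) = (\<Sum>L'\<in>\<L>. Poly_Mapping.map ((*) (if L' = L then 1 else 0)) (class_vec (?C L')))"
            using \<L>(1) by (subst sum.remove[of _ L]) (auto intro!: sum.neutral)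
          then show "class_vec (?C L) \<in> ?V" by (rule range_eqI[of _ _ "\<lambda>L'. if L' = L then 1 else 0"])
        qed
        show "PM.subspace ?V"
        proof (rule PM.subspaceI)
          show "0 \<in> ?V" by (rule range_eqI[of _ _ "\<lambda>_. 0"]) simp
          show "x + y \<in> ?V" if xy: "x \<in> ?V" "y \<in> ?V" for x y
          proof -
            obtain c d where "x = (\<Sum>L\<in>\<L>. Poly_Mapping.map ((*) (c L)) (class_vec (?C L)))"
              "y = (\<Sum>L\<in>\<L>. Poly_Mapping.map ((*) (d L)) (class_vec (?C L)))" using xy by auto
            then show ?thesis
              by (intro range_eqI[of _ _ "\<lambda>L. c L + d L"]) (simp add: PM.scale_left_distrib sum.distrib)
          qed
          show "Poly_Mapping.map ((*) r) x \<in> ?V" if x: "x \<in> ?V" for r x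
          proof -
            obtain c where "x = (\<Sum>L\<in>\<L>. Poly_Mapping.map ((*) (c L)) (class_vec (?C L)))" using x by auto
            then show ?thesis
              by (intro range_eqI[of _ _ "\<lambda>L. r * c L"]) (simp add: PM.scale_sum_right)
          qed
        qed
      qed
      have single: "Poly_Mapping.single X a \<in> PM.span (burnside_relations G \<union> (\<lambda>L. class_vec (?C L)) ` \<L>)"
        if X: "X \<in> ?cls" for X a
      proof -
        obtain M :: "('g, nat) biset" where M: "finite_biset G M" "X = biset_class G M" using classE[OF X] by blast
        have "Poly_Mapping.single X a = Poly_Mapping.map ((*) a) (class_vec M)"
          by (rule poly_mapping_eqI) (simp add: M class_vec_def lookup_single when_def)
        then show ?thesis using PM.span_scale[OF class_vec_in_span[OF M(1) reps]] by simp
      qed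
      have "f \<in> PM.span (burnside_relations G \<union> (\<lambda>L. class_vec (?C L)) ` \<L>)"
        by (subst poly_mapping_monomials[of f]) (use f in \<open>auto intro!: PM.span_sum single\<close>)
      \<comment> \<open>Here g is a combination of relations and h one of coset bisets. The extended
        \<open>\<phi>\<close> kills f and g, hence h, and independence makes h zero.\<close>
      then obtain g h where fgh: "f = g + h" and g: "g \<in> burnside_span"
        and h: "h \<in> PM.span ((\<lambda>L. class_vec (?C L)) ` \<L>)"
        unfolding PM.span_Un burnside_span_def by auto
      obtain c where c: "h = (\<Sum>L\<in>\<L>. Poly_Mapping.map ((*) (c L)) (class_vec (?C L)))" using h V by auto
      have "linear_ext \<phi> f = 0" "linear_ext \<phi> g = 0" using f g \<open>burnside_span \<subseteq> ?K\<close> by auto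
      then have "linear_ext \<phi> h = 0" by (simp add: fgh linear_ext_add)
      then have "(\<Sum>L\<in>\<L>. scale (c L * k L) (\<tau> L)) = 0"
        by (simp add: c linear_ext_sum linear_ext_smult lin_vec)
      then have "c L = 0" if "L \<in> \<L>" for L
        using indep[of "\<lambda>L. c L * k L"] k(1)[OF that] that by auto
      then have "h = 0" by (simp add: c)
      then show "f \<in> burnside_span" using fgh g by simp
    qed
  qed
  have e: "Poly_Mapping.keys (Poly_Mapping.single (biset_class G (regular_biset G)) 1 :: _ \<Rightarrow>\<^sub>0 rat) \<subseteq> ?cls"
    "linear_ext \<phi> (Poly_Mapping.single (biset_class G (regular_biset G)) 1) = one S"
  proof -
    \<comment> \<open>|G| points, each contributing |G| times the unit: the scaled value is
      1.\<close>
    have "of_nat CARD('s) = scale (of_nat CARD('s)) (1 :: 'a)" using of_nat_scale[of "CARD('s)" 1] by simp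
    then have "stab_sum \<tau> (regular_biset G) = scale ?n 1"
      by (simp add: unit(2) \<tau>_Id of_nat_scale power2_eq_square scale_mult_left)
    then show "linear_ext \<phi> (Poly_Mapping.single (biset_class G (regular_biset G)) 1) = one S"
      using n by (simp add: \<phi>_class[OF unit(1)] S)
  qed (simp add: biset_class_in_classes[OF unit(1)])
  have "(\<lambda>a. {f. Poly_Mapping.keys f \<subseteq> ?cls \<and> linear_ext \<phi> f = a}) \<in>
    algebra_iso S (quotient_algebra (basis_algebra ?cls ?m (Poly_Mapping.single (biset_class G (regular_biset G)) 1)) burnside_span)"
    by (rule linear_ext_fibre_iso(1)[where \<phi> = \<phi>, OF S(1,3,4,5,7) _ _ e onto kernel]) (auto simp: prod)
  then show ?thesis
    unfolding double_burnside_def biset_class_algebra_def burnside_span_def by blast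
qed

end

section \<open>The symmetric group on three letters\<close>

text \<open>\<open>Ri\<close> is \<open>c\<^sup>i\<close> and \<open>Si\<close> is \<open>c\<^sup>i s\<close> for a 3-cycle \<open>c\<close> and a transposition \<open>s\<close>; the group is
  written additively, as HOL has no type class of multiplicative groups.\<close>

datatype s3 = R0 | R1 | R2 | S0 | S1 | S2

instantiation s3 :: group_add
begin

definition zero_s3 :: s3 where "0 = R0"

fun plus_s3 :: "s3 \<Rightarrow> s3 \<Rightarrow> s3"
  where "R0 + R0 = R0" | "R0 + R1 = R1" | "R0 + R2 = R2" | "R0 + S0 = S0" | "R0 + S1 = S1" | "R0 + S2 = S2"
  | "R1 + R0 = R1" | "R1 + R1 = R2" | "R1 + R2 = R0" | "R1 + S0 = S1" | "R1 + S1 = S2" | "R1 + S2 = S0"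
  | "R2 + R0 = R2" | "R2 + R1 = R0" | "R2 + R2 = R1" | "R2 + S0 = S2" | "R2 + S1 = S0" | "R2 + S2 = S1"
  | "S0 + R0 = S0" | "S0 + R1 = S2" | "S0 + R2 = S1" | "S0 + S0 = R0" | "S0 + S1 = R2" | "S0 + S2 = R1"
  | "S1 + R0 = S1" | "S1 + R1 = S0" | "S1 + R2 = S2" | "S1 + S0 = R1" | "S1 + S1 = R0" | "S1 + S2 = R2"
  | "S2 + R0 = S2" | "S2 + R1 = S1" | "S2 + R2 = S0" | "S2 + S0 = R2" | "S2 + S1 = R1" | "S2 + S2 = R0"

fun uminus_s3 :: "s3 \<Rightarrow> s3"
  where "- R0 = R0" | "- R1 = R2" | "- R2 = R1" | "- S0 = S0" | "- S1 = S1" | "- S2 = S2"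

definition minus_s3 :: "s3 \<Rightarrow> s3 \<Rightarrow> s3" where "x - y = x + - (y :: s3)"

instance
proof
  fix a b c :: s3
  show "a + b + c = a + (b + c)" by (cases a; cases b; cases c) simp_all
  show "0 + a = a" "a + 0 = a" "- a + a = 0" by (cases a; simp add: zero_s3_def)+
  show "a + - b = a - b" by (simp add: minus_s3_def)
qed

end

lemma UNIV_s3: "UNIV = {R0, R1, R2, S0, S1, S2}"
  by (auto intro: s3.exhaust)

instance s3 :: finite
  by standard (simp add: UNIV_s3)

lemma CARD_s3: "CARD(s3) = 6"
  by (simp add: UNIV_s3)

lemma ex_s3: "(\<exists>x. P x) \<longleftrightarrow> P R0 \<or> P R1 \<or> P R2 \<or> P S0 \<or> P S1 \<or> P S2"
  by (metis s3.exhaust)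

fun s3_perm :: "s3 \<Rightarrow> nat \<Rightarrow> nat"
  where "s3_perm R0 n = (if n = 1 then 1 else if n = 2 then 2 else if n = 3 then 3 else n)"
  | "s3_perm R1 n = (if n = 1 then 2 else if n = 2 then 3 else if n = 3 then 1 else n)"
  | "s3_perm R2 n = (if n = 1 then 3 else if n = 2 then 1 else if n = 3 then 2 else n)"
  | "s3_perm S0 n = (if n = 1 then 1 else if n = 2 then 3 else if n = 3 then 2 else n)"
  | "s3_perm S1 n = (if n = 1 then 2 else if n = 2 then 1 else if n = 3 then 3 else n)"
  | "s3_perm S2 n = (if n = 1 then 3 else if n = 2 then 2 else if n = 3 then 1 else n)"

lemma s3_perm_add: "s3_perm (x + y) = s3_perm x \<circ> s3_perm y"
  by (cases x; cases y) (simp_all add: fun_eq_iff)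

lemma s3_perm_bij: "bij_betw s3_perm UNIV (carrier (sym_group 3))"
proof -
  have inj: "inj s3_perm"
  proof (rule injI)
    fix x y assume "s3_perm x = s3_perm y"
    then have "s3_perm x 1 = s3_perm y 1" "s3_perm x 2 = s3_perm y 2" by simp_all
    then show "x = y" by (cases x; cases y) simp_all
  qed
  have "s3_perm x permutes {1..3}" for x
  proof (rule bij_imp_permutes)
    have "{1..3::nat} = {1, 2, 3}" by auto
    then show "bij_betw (s3_perm x) {1..3} {1..3}"
      by (cases x) (auto simp: bij_betw_def inj_on_def)
    show "s3_perm x n = n" if "n \<notin> {1..3}" for n using that by (cases x) auto
  qed
  then have sub: "range s3_perm \<subseteq> carrier (sym_group 3)" by (auto simp: sym_group_carrier)
  have "carrier (sym_group 3) = {p. p permutes {1..3}}" by (auto simp: sym_group_carrier)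
  then have "finite (carrier (sym_group 3))" "card (carrier (sym_group 3)) = 6"
    using card_permutations[of "{1..3::nat}" 3] finite_permutations[of "{1..3::nat}"] by (simp_all add: fact_numeral)
  moreover have "card (range s3_perm) = 6" using inj by (simp add: card_image CARD_s3)
  ultimately have "range s3_perm = carrier (sym_group 3)" using sub by (metis card_subset_eq)
  then show ?thesis using inj by (simp add: bij_betw_def)
qed

fun is_rot :: "s3 \<Rightarrow> bool" where "is_rot x \<longleftrightarrow> x = R1 \<or> x = R2"

fun is_ref :: "s3 \<Rightarrow> bool" where "is_ref x \<longleftrightarrow> x = S0 \<or> x = S1 \<or> x = S2"

fun is_one :: "s3 \<Rightarrow> bool" where "is_one x \<longleftrightarrow> x = R0"

text \<open>The c^i in the normal form c^i or c^i s; with \<open>is_ref\<close> it splits S_3 as C_3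
  extended by <s>.\<close>

fun rot_part :: "s3 \<Rightarrow> s3"
  where "rot_part R0 = R0" | "rot_part R1 = R1" | "rot_part R2 = R2"
  | "rot_part S0 = R0" | "rot_part S1 = R1" | "rot_part S2 = R2"

text \<open>Up to conjugation, a subgroup of \<open>S\<^sub>3 \<times> S\<^sub>3\<close> is a semidirect product of a subgroup \<open>T\<close> of \<open>C\<^sub>3 \<times> C\<^sub>3\<close>
  by a subgroup of \<open>\<langle>s\<rangle> \<times> \<langle>s\<rangle>\<close>. A \<open>key\<close> lists which of \<open>(s,1)\<close>, \<open>(1,s)\<close>, \<open>(s,s)\<close>, \<open>(c,1)\<close>, \<open>(1,c)\<close>, \<open>(c,c)\<close>
  it contains.\<close>

datatype key = Key bool bool bool bool bool bool

text \<open>The first conjunct tests the reflection pattern, the second the rotation parts. The last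
  branch concerns (c, c^2) and its inverse, which in normal form occur only if T is all of C_3 x
  C_3.\<close>

fun std_mem :: "key \<Rightarrow> s3 \<Rightarrow> s3 \<Rightarrow> bool"
  where "std_mem (Key p q w a b d) x y \<longleftrightarrow>
    (if is_ref x then (if is_ref y then w else p) else is_ref y \<longrightarrow> q) \<and>
    (if rot_part x = R0 then rot_part y = R0 \<or> b
     else if rot_part y = R0 then a else if rot_part x = rot_part y then d else a \<and> b)"

definition std :: "key \<Rightarrow> (s3 \<times> s3) set"
  where "std k = {(x, y). std_mem k x y}"

text \<open>Five subgroups of <s> x <s> combine with the four products T = X x Y. A diagonal T
  admits only the trivial and the diagonal one, since conjugating (c, c) by (s, 1) or (1, s)
  enlarges T.\<close>

definition keys22 :: "key list"
  where "keys22 = [Key p q w a b d. (p, q, w) \<leftarrow> [(False, False, False), (True, False, False), (False, True, False),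
      (False, False, True), (True, True, True)],
    (a, b, d) \<leftarrow> [(False, False, False), (True, False, False), (False, True, False), (True, True, True)]] @
    [Key False False False False False True, Key False False True False False True]"

section \<open>The table\<close>

text \<open>The multiplicities \<open>triv, sgn, std\<close> of the irreducible characters in \<open>\<rat>[S\<^sub>3/H]\<close>, where \<open>c\<close>, \<open>t\<close> tell whether \<open>H\<close>
  contains a 3-cycle, a transposition.\<close>

fun perm_char :: "bool \<Rightarrow> bool \<Rightarrow> int vec3"
  where "perm_char c t = V3 1 (if t then 0 else 1) (if c then 0 else if t then 1 else 2)"

text \<open>\<open>r\<close> is |X| |Y|, and \<open>x0\<close>, \<open>y0\<close> are 1 for trivial
  X, Y. Up to the factor 2 this is an outer product of vectors of length four, with \<eta> as the
  remaining diagonal place.\<close>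

fun rank_one :: "int \<Rightarrow> int \<Rightarrow> int vec3 \<Rightarrow> int \<Rightarrow> int vec3 \<Rightarrow> int coords"
  where "rank_one r x0 (V3 x1 x2 x3) y0 y =
    Coords (v3_scale (r * x1) y) (v3_scale (r * x2) y) (v3_scale (r * x3) y)
      (v3_scale (r * y0) (V3 x1 x2 x3)) (v3_scale (2 * r * x0) y) 0 0 0 0 (V3 0 (2 * r * x0 * y0) 0)"

text \<open>The entries are \<open>|L|\<close> times the image in \<open>A\<close> of the transitive biset with stabilizer \<open>L\<close>. If \<open>L = X \<times> Y\<close>, the
  biset factors through the trivial group and its image is the outer product of the vectors
  \<open>(0; triv, sgn, std) + (1; 0, 0, 0)[X = 1]\<close> of the \<open>S\<^sub>3\<close>-sets \<open>S\<^sub>3/X\<close> and \<open>S\<^sub>3/Y\<close>, up to a factor 2 in the blocks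
  \<open>(4,1)\<close> and \<open>(4,4)\<close> that avoids fractions. These images span an ideal isomorphic to the span of the blocks
  \<open>(1,1)\<close>, \<open>(1,4)\<close>, \<open>(4,1)\<close> and of \<open>\<eta>\<close>; the other six entries come from lifting idempotents modulo it.\<close>

fun table :: "key \<Rightarrow> int coords"
  where "table (Key p q w a b d) =
    (if d \<and> \<not> a \<and> \<not> b then
      (if w then Coords (V3 6 0 0) (V3 0 6 0) (V3 0 0 6) (V3 0 0 0) (V3 0 0 0) 6 0 0 6 (V3 6 0 0)
       else Coords (V3 3 3 0) (V3 3 3 0) (V3 0 0 6) (V3 0 0 3) (V3 0 0 6) 0 0 0 6 (V3 0 3 0))
     else if w \<and> \<not> p \<and> \<not> q then
      (if a then
        (if b then Coords (V3 18 0 0) (V3 0 18 0) (V3 0 0 0) (V3 0 0 0) (V3 0 0 0) 18 0 0 0 (V3 0 0 0)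
         else Coords (V3 6 0 6) (V3 0 6 6) (V3 0 0 0) (V3 0 6 0) (V3 0 0 0) 6 6 0 0 (V3 0 0 0))
       else
        (if b then Coords (V3 6 0 0) (V3 0 6 0) (V3 6 6 0) (V3 0 0 0) (V3 0 12 0) 6 0 6 0 (V3 0 0 0)
         else Coords (V3 2 0 2) (V3 0 2 2) (V3 2 2 4) (V3 0 2 2) (V3 0 4 4) 2 2 2 0 (V3 0 (- 20) 2)))
     else rank_one ((if a then 3 else 1) * (if b then 3 else 1) * (if p then 2 else 1) * (if q then 2 else 1))
      (if a \<or> p then 0 else 1) (perm_char a p) (if b \<or> q then 0 else 1) (perm_char b q))"

section \<open>Evaluating the Mackey identity with subsets of S_3 as six bits\<close>

datatype vec6 = V6 bool bool bool bool bool bool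

fun vec6_conj :: "s3 \<Rightarrow> vec6 \<Rightarrow> vec6"
  where "vec6_conj R0 (V6 a b c d e f) = V6 a b c d e f"
  | "vec6_conj R1 (V6 a b c d e f) = V6 a b c e f d"
  | "vec6_conj R2 (V6 a b c d e f) = V6 a b c f d e"
  | "vec6_conj S0 (V6 a b c d e f) = V6 a c b d f e"
  | "vec6_conj S1 (V6 a b c d e f) = V6 a c b f e d"
  | "vec6_conj S2 (V6 a b c d e f) = V6 a c b e d f"

fun vec6_meet :: "vec6 \<Rightarrow> vec6 \<Rightarrow> bool"
  where "vec6_meet (V6 a b c d e f) (V6 a' b' c' d' e' f') \<longleftrightarrow>
    a \<and> a' \<or> b \<and> b' \<or> c \<and> c' \<or> d \<and> d' \<or> e \<and> e' \<or> f \<and> f'"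

fun vec6_count :: "vec6 \<Rightarrow> vec6 \<Rightarrow> int"
  where "vec6_count (V6 a b c d e f) (V6 a' b' c' d' e' f') =
    (if a \<and> a' then 1 else 0) + ((if b \<and> b' then 1 else 0) + ((if c \<and> c' then 1 else 0) +
    ((if d \<and> d' then 1 else 0) + ((if e \<and> e' then 1 else 0) + (if f \<and> f' then 1 else 0)))))"

definition vec6_of :: "(s3 \<Rightarrow> bool) \<Rightarrow> vec6"
  where "vec6_of P = V6 (P R0) (P R1) (P R2) (P S0) (P S1) (P S2)"

definition s3_list :: "s3 list" where "s3_list = [R0, R1, R2, S0, S1, S2]"

text \<open>A bit of the key of a composite asks for a middle element common to a row set of K and a
  conjugated column set of L. So three rows and three columns per key determine the keys of all
  composites.\<close>

definition row :: "(s3 \<Rightarrow> bool) \<Rightarrow> key \<Rightarrow> vec6"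
  where "row P k = vec6_of (\<lambda>y. list_ex (\<lambda>x. P x \<and> std_mem k x y) s3_list)"

definition col :: "(s3 \<Rightarrow> bool) \<Rightarrow> key \<Rightarrow> vec6"
  where "col P k = vec6_of (\<lambda>x. list_ex (\<lambda>y. P y \<and> std_mem k x y) s3_list)"

datatype key_data = KD vec6 vec6 vec6 vec6 vec6 vec6 "int coords"

definition key_data :: "key \<Rightarrow> key_data"
  where "key_data k = KD (row is_one k) (row is_rot k) (row is_ref k) (col is_one k) (col is_rot k) (col is_ref k) (table k)"

fun meet_key :: "vec6 \<Rightarrow> vec6 \<Rightarrow> vec6 \<Rightarrow> vec6 \<Rightarrow> vec6 \<Rightarrow> vec6 \<Rightarrow> key"
  where "meet_key r1 rr rf c1 cr cf = Key (vec6_meet rf c1) (vec6_meet r1 cf) (vec6_meet rf cf)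
    (vec6_meet rr c1) (vec6_meet r1 cr) (vec6_meet rr cr)"

fun mackey_term :: "key_data \<Rightarrow> key_data \<Rightarrow> s3 \<Rightarrow> int coords"
  where "mackey_term (KD r1 rr rf _ _ _ _) (KD _ _ _ c1 cr cf _) g =
    coords_scale (vec6_count r1 (vec6_conj g c1))
      (table (meet_key r1 rr rf (vec6_conj g c1) (vec6_conj g cr) (vec6_conj g cf)))"

fun data_table :: "key_data \<Rightarrow> int coords" where "data_table (KD _ _ _ _ _ _ t) = t"

definition mackey_sum :: "key_data \<Rightarrow> key_data \<Rightarrow> int coords"
  where "mackey_sum k l = coords_add (mackey_term k l R0) (coords_add (mackey_term k l R1)
    (coords_add (mackey_term k l R2) (coords_add (mackey_term k l S0)
    (coords_add (mackey_term k l S1) (mackey_term k l S2)))))"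

definition mackey_check :: "key_data list \<Rightarrow> key_data list \<Rightarrow> bool"
  where "mackey_check ks ls = list_all (\<lambda>k. list_all (\<lambda>l. mackey_sum k l = coords_mult (data_table k) (data_table l)) ls) ks"

lemma mackey_check_keys22: "mackey_check (map key_data keys22) (map key_data keys22)"
  by code_simp

section \<open>Subgroups of \<open>S\<^sub>3 \<times> S\<^sub>3\<close>\<close>

definition has :: "(s3 \<times> s3) set \<Rightarrow> (s3 \<Rightarrow> bool) \<Rightarrow> (s3 \<Rightarrow> bool) \<Rightarrow> bool"
  where "has L P Q \<longleftrightarrow> (\<exists>x y. (x, y) \<in> L \<and> P x \<and> Q y)"

text \<open>Quantifying over conjugacy classes makes this a conjugation invariant of arbitrary
  subsets.\<close>

definition key_of :: "(s3 \<times> s3) set \<Rightarrow> key"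
  where "key_of L = Key (has L is_ref is_one) (has L is_one is_ref) (has L is_ref is_ref)
    (has L is_rot is_one) (has L is_one is_rot) (has L is_rot is_rot)"

lemma conj_rel_conj_rel: "conj_rel a b (conj_rel c d L) = conj_rel (a + c) (b + d) L"
  by (simp add: conj_rel_def group_expand del: add_uminus_conv_diff)

lemma class_conj:
  "is_one (- a + x + a) = is_one x" "is_rot (- a + x + a) = is_rot x" "is_ref (- a + x + a) = is_ref x"
  by (cases a; cases x; simp)+

lemma has_conj_rel:
  assumes "\<And>a x. P (- a + x + a) = P x" "\<And>a x. Q (- a + x + a) = Q x"
  shows "has (conj_rel a b L) P Q = has L P Q"
proof
  assume "has (conj_rel a b L) P Q"
  then show "has L P Q" using assms unfolding has_def conj_rel_def by blast
next
  assume "has L P Q"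
  then obtain x y where xy: "(x, y) \<in> L" "P x" "Q y" by (auto simp: has_def)
  have "- a + (a + x - a) + a = x" "- b + (b + y - b) + b = y"
    by (simp_all add: group_expand del: add_uminus_conv_diff)
  then have "(a + x - a, b + y - b) \<in> conj_rel a b L" "P (a + x - a)" "Q (b + y - b)"
    using xy assms(1)[of a "a + x - a"] assms(2)[of b "b + y - b"] by (simp_all add: conj_rel_def)
  then show "has (conj_rel a b L) P Q" by (auto simp: has_def)
qed

lemma key_of_conj_rel: "key_of (conj_rel a b L) = key_of L"
  by (simp only: key_of_def has_conj_rel class_conj)

lemma is_subgroup_conj_rel:
  assumes "is_subgroup L"
  shows "is_subgroup (conj_rel a b L)"
proof -
  have "- a + (x + x') + a = (- a + x + a) + (- a + x' + a)" "- a + - x + a = - (- a + x + a)" for a x x' :: 'a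
    by (simp_all add: add.assoc minus_add)
  then show ?thesis using assms unfolding is_subgroup_def conj_rel_def by auto
qed

lemma key_in_keys22:
  assumes "p \<and> q \<Longrightarrow> w" "p \<and> w \<Longrightarrow> q" "q \<and> w \<Longrightarrow> p" "a \<and> b \<Longrightarrow> d" "a \<and> d \<Longrightarrow> b" "b \<and> d \<Longrightarrow> a"
    "d \<and> (p \<or> q) \<Longrightarrow> a"
  shows "Key p q w a b d \<in> set keys22"
proof -
  have "\<forall>p q w a b d. (p \<and> q \<longrightarrow> w) \<longrightarrow> (p \<and> w \<longrightarrow> q) \<longrightarrow> (q \<and> w \<longrightarrow> p) \<longrightarrow> (a \<and> b \<longrightarrow> d) \<longrightarrow>
    (a \<and> d \<longrightarrow> b) \<longrightarrow> (b \<and> d \<longrightarrow> a) \<longrightarrow> (d \<and> (p \<or> q) \<longrightarrow> a) \<longrightarrow> Key p q w a b d \<in> set keys22"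
    by code_simp
  from this[rule_format] show ?thesis using assms by metis
qed

lemma std_eqI: "(\<And>x y. (x, y) \<in> L \<longleftrightarrow> std_mem k x y) \<Longrightarrow> L = std k"
  by (auto simp: std_def)

context
  fixes L :: "(s3 \<times> s3) set"
  assumes L: "is_subgroup L"
begin

lemma L_add: "(x, y) \<in> L \<Longrightarrow> (x', y') \<in> L \<Longrightarrow> (x + x', y + y') \<in> L"
  and L_minus: "(x, y) \<in> L \<Longrightarrow> (- x, - y) \<in> L" and L_zero: "(R0, R0) \<in> L"
  using L unfolding is_subgroup_def zero_s3_def by blast+

text \<open>Cubing fixes reflections and kills rotations, so it separates the components of a mixed
  pair.\<close>

lemma L_cube: "(x, y) \<in> L \<Longrightarrow> (x + x + x, y + y + y) \<in> L"
  by (intro L_add)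

lemma cube_ref: "is_ref x \<Longrightarrow> x + x + x = x" and cube_rot: "\<not> is_ref x \<Longrightarrow> x + x + x = R0"
  and ref_S0: "is_ref x \<Longrightarrow> x + S0 = rot_part x" "is_ref x \<Longrightarrow> rot_part x + S0 = x"
  and rot_part_rot: "\<not> is_ref x \<Longrightarrow> rot_part x = x"
  and rot_R0: "x + R0 = x"
  by (cases x; simp)+

lemma has_ref_oneI: "(x, y) \<in> L \<Longrightarrow> is_ref x \<Longrightarrow> \<not> is_ref y \<Longrightarrow> has L is_ref is_one"
  using L_cube[of x y] unfolding has_def by (metis cube_ref cube_rot is_one.simps)

lemma has_one_refI: "(x, y) \<in> L \<Longrightarrow> \<not> is_ref x \<Longrightarrow> is_ref y \<Longrightarrow> has L is_one is_ref"
  using L_cube[of x y] unfolding has_def by (metis cube_ref cube_rot is_one.simps)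

text \<open>The hypotheses put the reflections of L at s and exclude the antidiagonal T; membership
  is then decided by the six bits.\<close>

lemma normalized_eq_std:
  assumes p: "has L is_ref is_one \<Longrightarrow> (S0, R0) \<in> L" and q: "has L is_one is_ref \<Longrightarrow> (R0, S0) \<in> L"
    and w: "has L is_ref is_ref \<Longrightarrow> (S0, S0) \<in> L" and n: "(R1, R2) \<in> L \<Longrightarrow> (R1, R1) \<in> L"
  shows "L \<in> std ` set keys22"
proof -
  let ?p = "(S0, R0) \<in> L" and ?q = "(R0, S0) \<in> L" and ?w = "(S0, S0) \<in> L"
  let ?a = "(R1, R0) \<in> L" and ?b = "(R0, R1) \<in> L" and ?d = "(R1, R1) \<in> L"
  let ?k = "Key ?p ?q ?w ?a ?b ?d"
  \<comment> \<open>Multiplying by the appropriate one of (s, s), (s, 1), (1, s) reduces membership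
    to the rotation parts.\<close>
  have split: "(x, y) \<in> L \<longleftrightarrow> (if is_ref x then (if is_ref y then ?w else ?p) else is_ref y \<longrightarrow> ?q) \<and>
      (rot_part x, rot_part y) \<in> L" for x y
  proof (cases "is_ref x"; cases "is_ref y")
    assume x: "is_ref x" and y: "is_ref y"
    have "(S0, S0) \<in> L" if "(x, y) \<in> L" using that x y w by (auto simp: has_def)
    then show ?thesis using x y L_add[of x y S0 S0] L_add[of "rot_part x" "rot_part y" S0 S0] ref_S0 by auto
  next
    assume x: "is_ref x" and y: "\<not> is_ref y"
    have "(S0, R0) \<in> L" if "(x, y) \<in> L" using has_ref_oneI[OF that x y] p by blast
    then show ?thesis
      using x y L_add[of x y S0 R0] L_add[of "rot_part x" "rot_part y" S0 R0] ref_S0 rot_part_rot rot_R0 by auto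
  next
    assume x: "\<not> is_ref x" and y: "is_ref y"
    have "(R0, S0) \<in> L" if "(x, y) \<in> L" using has_one_refI[OF that x y] q by blast
    then show ?thesis
      using x y L_add[of x y R0 S0] L_add[of "rot_part x" "rot_part y" R0 S0] ref_S0 rot_part_rot rot_R0 by auto
  qed (simp add: rot_part_rot)
  have neg: "(R2, R0) \<in> L \<longleftrightarrow> ?a" "(R0, R2) \<in> L \<longleftrightarrow> ?b" "(R2, R2) \<in> L \<longleftrightarrow> ?d" "(R2, R1) \<in> L \<longleftrightarrow> (R1, R2) \<in> L"
    using L_minus[of R1 R0] L_minus[of R2 R0] L_minus[of R0 R1] L_minus[of R0 R2] L_minus[of R1 R1]
      L_minus[of R2 R2] L_minus[of R1 R2] L_minus[of R2 R1] by auto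
  have abd: "?a \<Longrightarrow> ?b \<Longrightarrow> ?d" "?a \<Longrightarrow> ?d \<Longrightarrow> ?b" "?b \<Longrightarrow> ?d \<Longrightarrow> ?a"
    using L_add[of R1 R0 R0 R1] L_add[of R2 R0 R1 R1] L_add[of R0 R2 R1 R1] neg by auto
  \<comment> \<open>By \<open>n\<close>, (c, c^2) comes with (c, c); their product is (c^2, 1), and
    T is everything.\<close>
  have e: "(R1, R2) \<in> L \<longleftrightarrow> ?a \<and> ?b"
    using L_add[of R1 R0 R0 R2] L_add[of R1 R2 R1 R1] L_add[of R2 R1 R1 R1] n neg by auto
  have pqw: "?p \<Longrightarrow> ?q \<Longrightarrow> ?w" "?p \<Longrightarrow> ?w \<Longrightarrow> ?q" "?q \<Longrightarrow> ?w \<Longrightarrow> ?p"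
    using L_add[of S0 R0 R0 S0] L_add[of S0 R0 S0 S0] L_add[of R0 S0 S0 S0] by auto
  \<comment> \<open>Conjugating (c, c) by (s, 1) or (1, s) yields an antidiagonal element.\<close>
  have "?a \<and> ?b" if "?d" "?p \<or> ?q"
  proof -
    have "(R2, R1) \<in> L \<or> (R1, R2) \<in> L"
      using that L_add[OF L_add[of S0 R0 R1 R1], of S0 R0] L_add[OF L_add[of R0 S0 R1 R1], of R0 S0] by auto
    then show ?thesis using neg e by blast
  qed
  then have "?k \<in> set keys22"
    using abd pqw by (intro key_in_keys22) blast+
  moreover have "(x, y) \<in> L \<longleftrightarrow> std_mem ?k x y" for x y
  proof -
    have "(rot_part x, rot_part y) \<in> L \<longleftrightarrow>
      (if rot_part x = R0 then rot_part y = R0 \<or> ?b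
       else if rot_part y = R0 then ?a else if rot_part x = rot_part y then ?d else ?a \<and> ?b)"
      by (cases x; cases y; simp only: rot_part.simps neg e L_zero s3.distinct if_True if_False simp_thms refl)
    then show ?thesis unfolding split[of x y] std_mem.simps by (simp only:)
  qed
  then have "L = std ?k" by (rule std_eqI)
  ultimately show ?thesis by blast
qed

end

text \<open>A first conjugation moves suitable reflections to s. If T is then antidiagonal,
  conjugation by (s, 1) makes it diagonal and leaves s in place.\<close>

lemma subgroup_conj_std:
  assumes L: "is_subgroup L"
  shows "\<exists>a b. conj_rel a b L \<in> std ` set keys22"
proof -
  have ex_conj: "\<exists>a. x = a + S0 - a" if "is_ref x" for x
    using that by (cases x) (auto simp: ex_s3 minus_s3_def simp del: add_uminus_conv_diff)
  obtain x0 y0 where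
    x0: "is_ref x0" "has L is_ref is_one \<Longrightarrow> (x0, R0) \<in> L" and
    y0: "is_ref y0" "has L is_one is_ref \<Longrightarrow> (R0, y0) \<in> L" and
    xy0: "\<not> has L is_ref is_one \<Longrightarrow> \<not> has L is_one is_ref \<Longrightarrow> has L is_ref is_ref \<Longrightarrow> (x0, y0) \<in> L"
  proof (cases "has L is_ref is_one \<or> has L is_one is_ref")
    case True
    obtain x where x: "is_ref x" "has L is_ref is_one \<Longrightarrow> (x, R0) \<in> L"
      by (cases "has L is_ref is_one") (auto simp: has_def)
    obtain y where "is_ref y" "has L is_one is_ref \<Longrightarrow> (R0, y) \<in> L"
      by (cases "has L is_one is_ref") (auto simp: has_def)
    with x True show thesis using that by blast
  next
    case no_single: False
    show thesis
    proof (cases "has L is_ref is_ref")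
      case True
      then show ?thesis using that no_single unfolding has_def by blast
    next
      case False
      then show ?thesis using that[of S0 S0] no_single by simp
    qed
  qed
  obtain a b where ab: "x0 = a + S0 - a" "y0 = b + S0 - b" using ex_conj x0(1) y0(1) by blast
  define M where "M = conj_rel (- a) (- b) L"
  have M_iff: "(x, y) \<in> M \<longleftrightarrow> (a + x - a, b + y - b) \<in> L" for x y by (simp add: M_def conj_rel_def)
  have R0_conj: "g + R0 - g = R0" for g by (simp flip: zero_s3_def)
  have M: "is_subgroup M" unfolding M_def by (rule is_subgroup_conj_rel[OF L])
  have has_M: "has M P Q \<longleftrightarrow> has L P Q" if "P \<in> {is_one, is_ref}" "Q \<in> {is_one, is_ref}" for P Q
    unfolding M_def using that by (intro has_conj_rel) (auto simp: class_conj simp del: is_one.simps is_ref.simps)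
  have M_ref_one: "(S0, R0) \<in> M" if "has M is_ref is_one"
    using x0(2) that has_M[of is_ref is_one] unfolding M_iff R0_conj ab by blast
  have M_one_ref: "(R0, S0) \<in> M" if "has M is_one is_ref"
    using y0(2) that has_M[of is_one is_ref] unfolding M_iff R0_conj ab by blast
  have M_ref_ref: "(S0, S0) \<in> M" if ref_ref: "has M is_ref is_ref"
  \<comment> \<open>A pair of reflections times (s, 1) is a rotation paired with a reflection, whose
    cube gives some (1, s'); symmetrically for (1, s). So both (s, 1) and (1, s) are present, and
    with them (s, s).\<close>
  proof (cases "has M is_ref is_one \<or> has M is_one is_ref")
    case True
    obtain x y where xy: "(x, y) \<in> M" "is_ref x" "is_ref y" using ref_ref by (auto simp: has_def)
    have "has M is_one is_ref" if "has M is_ref is_one"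
      using has_one_refI[OF M L_add[OF M xy(1) M_ref_one[OF that]]] xy(2,3) by (cases x; cases y; simp)
    moreover have "has M is_ref is_one" if "has M is_one is_ref"
      using has_ref_oneI[OF M L_add[OF M xy(1) M_one_ref[OF that]]] xy(2,3) by (cases x; cases y; simp)
    ultimately show ?thesis using True L_add[OF M M_ref_one M_one_ref] by auto
  next
    case False
    then show ?thesis
      using xy0 ref_ref has_M[of is_ref is_one] has_M[of is_one is_ref] has_M[of is_ref is_ref]
      unfolding M_iff ab by blast
  qed
  show ?thesis
  proof (cases "(R1, R2) \<in> M \<longrightarrow> (R1, R1) \<in> M")
    case True
    then have "M \<in> std ` set keys22"
      using normalized_eq_std[OF M M_ref_one M_one_ref M_ref_ref] by blast
    then show ?thesis unfolding M_def by blast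
  next
    case False
    define N where "N = conj_rel S0 0 M"
    have N_iff: "(x, y) \<in> N \<longleftrightarrow> (- S0 + x + S0, y) \<in> M" for x y by (simp add: N_def conj_rel_def)
    have N: "is_subgroup N" unfolding N_def by (rule is_subgroup_conj_rel[OF M])
    have has_N: "has N P Q \<longleftrightarrow> has M P Q" if "P \<in> {is_one, is_ref}" "Q \<in> {is_one, is_ref}" for P Q
      unfolding N_def using that by (intro has_conj_rel) (auto simp: class_conj simp del: is_one.simps is_ref.simps)
    have "(S0, R0) \<in> N" if "has N is_ref is_one" using M_ref_one that has_N[of is_ref is_one] by (simp add: N_iff)
    moreover have "(R0, S0) \<in> N" if "has N is_one is_ref" using M_one_ref that has_N[of is_one is_ref] by (simp add: N_iff)
    moreover have "(S0, S0) \<in> N" if "has N is_ref is_ref" using M_ref_ref that has_N[of is_ref is_ref] by (simp add: N_iff)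
    moreover have "(R1, R1) \<in> N" using False L_minus[OF M, of R1 R2] by (simp add: N_iff)
    ultimately have "N \<in> std ` set keys22"
      using normalized_eq_std[OF N] by blast
    then show ?thesis unfolding N_def M_def conj_rel_conj_rel by blast
  qed
qed

section \<open>The Mackey formula for the table\<close>

text \<open>Replacing g by b^-1 g c absorbs the two inner conjugations; the outer ones conjugate the
  composite, which \<tau> does not notice.\<close>

lemma mackey_sum_conj_rel:
  fixes \<tau> :: "('s::{group_add,finite} \<times> 's) set \<Rightarrow> 'a::ring_1"
  assumes \<tau>: "\<And>a b L. \<tau> (conj_rel a b L) = \<tau> L"
  shows "(\<Sum>g\<in>UNIV. of_nat (card {x. (0, x) \<in> conj_rel a b K \<and> (x, 0) \<in> conj_rel g 0 (conj_rel c d L)}) *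
      \<tau> (conj_rel a b K O conj_rel g 0 (conj_rel c d L))) =
    (\<Sum>g\<in>UNIV. of_nat (card {x. (0, x) \<in> K \<and> (x, 0) \<in> conj_rel g 0 L}) * \<tau> (K O conj_rel g 0 L))"
proof (rule sum.reindex_bij_witness[where i = "\<lambda>h. b + h - c" and j = "\<lambda>g. - b + g + c"])
  fix g :: 's
  let ?h = "- b + g + c"
  have shift: "- b + (b + y - b) + b = y" "- (g + c) + (b + y - b) + (g + c) = - ?h + y + ?h"
    "- ?h + (- b + y + b) + ?h = - (g + c) + y + (g + c)" for y
    by (simp_all add: group_expand del: add_uminus_conv_diff)
  show "b + ?h - c = g" "- b + (b + g - c) + c = g"
    by (simp_all add: group_expand del: add_uminus_conv_diff)
  have "conj_rel a b K O conj_rel (g + c) d L = conj_rel a d (K O conj_rel ?h 0 L)"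
  proof (intro Set.set_eqI iffI)
    fix p assume "p \<in> conj_rel a b K O conj_rel (g + c) d L"
    then obtain x y z where p: "p = (x, z)" "(- a + x + a, - b + y + b) \<in> K"
      "(- (g + c) + y + (g + c), - d + z + d) \<in> L" by (auto simp: conj_rel_def)
    then have "(- b + y + b, - d + z + d) \<in> conj_rel ?h 0 L"
      unfolding conj_rel_def by (simp only: mem_Collect_eq case_prod_conv shift) simp
    with p show "p \<in> conj_rel a d (K O conj_rel ?h 0 L)" by (auto simp: conj_rel_def[of a d])
  next
    fix p assume "p \<in> conj_rel a d (K O conj_rel ?h 0 L)"
    then obtain x y z where p: "p = (x, z)" "(- a + x + a, y) \<in> K" "(- ?h + y + ?h, - d + z + d) \<in> L"
      by (auto simp: conj_rel_def)
    then have "(x, b + y - b) \<in> conj_rel a b K" "(b + y - b, z) \<in> conj_rel (g + c) d L"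
      unfolding conj_rel_def by (simp_all only: mem_Collect_eq case_prod_conv shift)
    then show "p \<in> conj_rel a b K O conj_rel (g + c) d L" using p(1) by auto
  qed
  moreover have "card {x. (0, x) \<in> conj_rel a b K \<and> (x, 0) \<in> conj_rel (g + c) d L} =
      card {x. (0, x) \<in> K \<and> (x, 0) \<in> conj_rel ?h 0 L}"
  proof (rule bij_betw_same_card[OF bij_betw_byWitness[where f = "\<lambda>x. - b + x + b" and f' = "\<lambda>y. b + y - b"]])
    have zero: "- e + 0 + e = 0" for e :: 's by simp
    show "(\<lambda>x. - b + x + b) ` {x. (0, x) \<in> conj_rel a b K \<and> (x, 0) \<in> conj_rel (g + c) d L} \<subseteq>
        {x. (0, x) \<in> K \<and> (x, 0) \<in> conj_rel ?h 0 L}"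
      unfolding conj_rel_def by (auto simp only: mem_Collect_eq case_prod_conv shift zero image_subset_iff)
    show "(\<lambda>y. b + y - b) ` {x. (0, x) \<in> K \<and> (x, 0) \<in> conj_rel ?h 0 L} \<subseteq>
        {x. (0, x) \<in> conj_rel a b K \<and> (x, 0) \<in> conj_rel (g + c) d L}"
      unfolding conj_rel_def by (auto simp only: mem_Collect_eq case_prod_conv shift zero image_subset_iff)
  qed (simp_all add: group_expand del: add_uminus_conv_diff)
  ultimately show "of_nat (card {x. (0, x) \<in> K \<and> (x, 0) \<in> conj_rel ?h 0 L}) * \<tau> (K O conj_rel ?h 0 L) =
      of_nat (card {x. (0, x) \<in> conj_rel a b K \<and> (x, 0) \<in> conj_rel g 0 (conj_rel c d L)}) *
      \<tau> (conj_rel a b K O conj_rel g 0 (conj_rel c d L))"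
    by (simp only: conj_rel_conj_rel add_0_left \<tau>)
qed simp_all

definition elem_of :: "int coords \<Rightarrow> A_array" where "elem_of t = A_of (map_coords rat_of_int t)"

text \<open>The \<tau> of the overview. Passing through \<open>key_of\<close> makes it invariant
  under conjugation.\<close>

definition stab_elem :: "(s3 \<times> s3) set \<Rightarrow> A_array" where "stab_elem L = elem_of (table (key_of L))"

lemma map_vec3_hom:
  "map_vec3 rat_of_int (v3_add u v) = v3_add (map_vec3 rat_of_int u) (map_vec3 rat_of_int v)"
  "map_vec3 rat_of_int (v3_scale r u) = v3_scale (rat_of_int r) (map_vec3 rat_of_int u)"
  "rat_of_int (v3_dot u v) = v3_dot (map_vec3 rat_of_int u) (map_vec3 rat_of_int v)"
  by (cases u; cases v; simp)+

lemma elem_of_hom: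
  "elem_of (coords_add s t) = elem_of s + elem_of t"
  "elem_of (coords_scale r t) = of_int r * elem_of t"
  "elem_of (coords_mult s t) = elem_of s * elem_of t"
proof -
  have of_int_mult: "of_int r * x = A_smult (of_int r) x" for r x
  proof (cases r)
    case (nonneg n)
    have "of_nat n * x = A_smult (of_nat n) x"
      by (induction n) (simp_all add: A.scale_left_distrib distrib_right)
    then show ?thesis by (simp add: nonneg)
  next
    case (neg n)
    have "of_nat n * x = A_smult (of_nat n) x" for n
      by (induction n) (simp_all add: A.scale_left_distrib distrib_right)
    from this[of "Suc n"] show ?thesis by (simp only: neg of_int_minus of_int_of_nat_eq A.scale_minus_left mult_minus_left)
  qed
  show "elem_of (coords_add s t) = elem_of s + elem_of t"
    unfolding coords_of_inject[symmetric] by (cases s; cases t) (simp add: elem_of_def coords_of_ring map_vec3_hom)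
  show "elem_of (coords_scale r t) = of_int r * elem_of t"
    unfolding coords_of_inject[symmetric] of_int_mult
    by (cases t) (simp add: elem_of_def coords_of_A_smult map_vec3_hom)
  show "elem_of (coords_mult s t) = elem_of s * elem_of t"
    unfolding coords_of_inject[symmetric]
    by (cases s rule: coords_cases; cases t rule: coords_cases) (simp add: elem_of_def coords_of_ring)
qed

lemma coords_of_smult_elem_of:
  "coords_of (A_smult r (elem_of t)) = coords_scale r (map_coords rat_of_int t)"
  by (simp add: coords_of_A_smult elem_of_def)

lemma vec6_sem:
  "vec6_conj g (vec6_of P) = vec6_of (\<lambda>y. P (- g + y + g))"
  "vec6_meet (vec6_of P) (vec6_of Q) \<longleftrightarrow> (\<exists>y. P y \<and> Q y)"
  "vec6_count (vec6_of P) (vec6_of Q) = int (card {y. P y \<and> Q y})"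
proof -
  show "vec6_conj g (vec6_of P) = vec6_of (\<lambda>y. P (- g + y + g))" by (cases g) (simp_all add: vec6_of_def)
  show "vec6_meet (vec6_of P) (vec6_of Q) \<longleftrightarrow> (\<exists>y. P y \<and> Q y)" by (simp add: vec6_of_def ex_s3)
  have "int (card {y. P y \<and> Q y}) = (\<Sum>y\<in>UNIV. if P y \<and> Q y then 1 else 0)"
    by (simp add: sum.If_cases)
  then show "vec6_count (vec6_of P) (vec6_of Q) = int (card {y. P y \<and> Q y})"
    by (simp add: vec6_of_def UNIV_s3)
qed

lemma row_sem: "row P k = vec6_of (\<lambda>y. \<exists>x. P x \<and> (x, y) \<in> std k)"
  and col_sem: "col Q k = vec6_of (\<lambda>x. \<exists>y. Q y \<and> (x, y) \<in> std k)"
  by (simp_all add: row_def col_def s3_list_def std_def ex_s3)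

lemma has_comp: "has (K O conj_rel g 0 L) P Q \<longleftrightarrow>
    (\<exists>y. (\<exists>x. P x \<and> (x, y) \<in> K) \<and> (\<exists>z. Q z \<and> (- g + y + g, z) \<in> L))"
  by (auto simp: has_def conj_rel_def relcomp_unfold)

text \<open>The bridge from the bit computation to the summand of the Mackey identity.\<close>

lemma mackey_term_sem:
  "elem_of (mackey_term (key_data k) (key_data l) g) =
    of_nat (card {x. (0, x) \<in> std k \<and> (x, 0) \<in> conj_rel g 0 (std l)}) * stab_elem (std k O conj_rel g 0 (std l))"
proof -
  have "{y. (\<exists>x. is_one x \<and> (x, y) \<in> std k) \<and> (\<exists>z. is_one z \<and> (- g + y + g, z) \<in> std l)} =
    {x. (0, x) \<in> std k \<and> (x, 0) \<in> conj_rel g 0 (std l)}"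
    by (auto simp: conj_rel_def zero_s3_def[symmetric])
  then show ?thesis
    by (simp add: key_data_def elem_of_hom stab_elem_def key_of_def has_comp row_sem col_sem vec6_sem
        del: is_one.simps is_rot.simps is_ref.simps)
qed

lemma set_s3_list: "x \<in> set s3_list"
  by (cases x) (simp_all add: s3_list_def)

definition std_has :: "(s3 \<Rightarrow> bool) \<Rightarrow> (s3 \<Rightarrow> bool) \<Rightarrow> key \<Rightarrow> bool"
  where "std_has P Q k = list_ex (\<lambda>x. list_ex (\<lambda>y. P x \<and> Q y \<and> std_mem k x y) s3_list) s3_list"

definition std_key :: "key \<Rightarrow> key"
  where "std_key k = Key (std_has is_ref is_one k) (std_has is_one is_ref k) (std_has is_ref is_ref k)
    (std_has is_rot is_one k) (std_has is_one is_rot k) (std_has is_rot is_rot k)"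

lemma std_key_keys22: "map std_key keys22 = keys22"
  by code_simp

lemma map_idI_iff: "map f xs = xs \<longleftrightarrow> (\<forall>x\<in>set xs. f x = x)"
  by (induction xs) auto

text \<open>As \<open>key_of\<close> is a conjugation invariant, the 22 standard subgroups are
  pairwise not conjugate; in particular \<open>std\<close> is injective on
  \<open>keys22\<close>.\<close>

lemma key_of_std: "k \<in> set keys22 \<Longrightarrow> key_of (std k) = k"
proof -
  have "has (std k) P Q \<longleftrightarrow> std_has P Q k" for P Q k
    unfolding has_def std_def std_has_def list_ex_iff mem_Collect_eq case_prod_conv using set_s3_list by blast
  then have "key_of (std k) = std_key k" for k by (simp only: key_of_def std_key_def)
  moreover have "\<forall>k\<in>set keys22. std_key k = k" using std_key_keys22
    unfolding map_idI_iff by blast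
  ultimately show "k \<in> set keys22 \<Longrightarrow> key_of (std k) = k" by simp
qed

fun closed_pair :: "key \<Rightarrow> s3 \<Rightarrow> s3 \<Rightarrow> s3 \<times> s3 \<Rightarrow> bool"
  where "closed_pair k x y (x', y') \<longleftrightarrow> std_mem k (x + x') (y + y')"

fun closed_elem :: "key \<Rightarrow> (s3 \<times> s3) list \<Rightarrow> s3 \<times> s3 \<Rightarrow> bool"
  where "closed_elem k ps (x, y) \<longleftrightarrow> std_mem k (- x) (- y) \<and> list_all (closed_pair k x y) ps"

fun std_mem_pair :: "key \<Rightarrow> s3 \<times> s3 \<Rightarrow> bool" where "std_mem_pair k (x, y) \<longleftrightarrow> std_mem k x y"

definition std_list :: "key \<Rightarrow> (s3 \<times> s3) list"
  where "std_list k = filter (std_mem_pair k) (List.product s3_list s3_list)"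

definition std_closed :: "key \<Rightarrow> bool"
  where "std_closed k \<longleftrightarrow> std_mem k R0 R0 \<and> list_all (closed_elem k (std_list k)) (std_list k)"

lemma std_closed_keys22: "list_all std_closed keys22"
  by code_simp

lemma is_subgroup_std: "k \<in> set keys22 \<Longrightarrow> is_subgroup (std k)"
proof -
  have mem: "(x, y) \<in> set (std_list k) \<longleftrightarrow> (x, y) \<in> std k" for x y k
    by (simp add: std_list_def std_def set_s3_list)
  assume "k \<in> set keys22"
  then have "std_closed k" using std_closed_keys22 by (simp add: list_all_iff)
  then have "(R0, R0) \<in> std k" and closed: "\<forall>z\<in>set (std_list k). closed_elem k (std_list k) z"
    by (simp_all add: std_closed_def list_all_iff std_def)
  moreover have "(- x, - y) \<in> std k" if "(x, y) \<in> std k" for x y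
    using closed that mem[of x y k] by (fastforce simp: std_def)
  moreover have "(x + x', y + y') \<in> std k" if "(x, y) \<in> std k" "(x', y') \<in> std k" for x y x' y'
    using closed that mem[of x y k] mem[of x' y' k] by (fastforce simp: std_def list_all_iff)
  ultimately show "is_subgroup (std k)" unfolding is_subgroup_def zero_s3_def by blast
qed

lemma stab_elem_conj_rel: "stab_elem (conj_rel a b L) = stab_elem L"
  by (simp add: stab_elem_def key_of_conj_rel)

lemma stab_elem_std: "k \<in> set keys22 \<Longrightarrow> stab_elem (std k) = elem_of (table k)"
  by (simp add: stab_elem_def key_of_std)

lemma stab_elem_mackey_std:
  assumes "k \<in> set keys22" "l \<in> set keys22"
  shows "(\<Sum>g\<in>UNIV. of_nat (card {x. (0, x) \<in> std k \<and> (x, 0) \<in> conj_rel g 0 (std l)}) *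
    stab_elem (std k O conj_rel g 0 (std l))) = stab_elem (std k) * stab_elem (std l)"
proof -
  have "mackey_sum (key_data k) (key_data l) = coords_mult (table k) (table l)"
    using mackey_check_keys22 assms
    by (auto simp: mackey_check_def list_all_iff key_data_def)
  then have "elem_of (mackey_sum (key_data k) (key_data l)) = stab_elem (std k) * stab_elem (std l)"
    using assms by (simp add: elem_of_hom stab_elem_std)
  then show ?thesis
    by (simp add: mackey_sum_def elem_of_hom mackey_term_sem UNIV_s3 add.assoc)
qed

lemma stab_elem_mackey:
  assumes K: "is_subgroup K" and L: "is_subgroup L"
  shows "(\<Sum>g\<in>UNIV. of_nat (card {x. (0, x) \<in> K \<and> (x, 0) \<in> conj_rel g 0 L}) *
    stab_elem (K O conj_rel g 0 L)) = stab_elem K * stab_elem L"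
proof -
  obtain a b k where k: "conj_rel a b K = std k" "k \<in> set keys22" using subgroup_conj_std[OF K] by blast
  obtain c d l where l: "conj_rel c d L = std l" "l \<in> set keys22" using subgroup_conj_std[OF L] by blast
  have "(\<Sum>g\<in>UNIV. of_nat (card {x. (0, x) \<in> K \<and> (x, 0) \<in> conj_rel g 0 L}) * stab_elem (K O conj_rel g 0 L)) =
    stab_elem (std k) * stab_elem (std l)"
    using mackey_sum_conj_rel[of stab_elem a b K c d L, OF stab_elem_conj_rel] stab_elem_mackey_std[OF k(2) l(2)]
    by (simp only: k(1) l(1))
  then show ?thesis
    using stab_elem_conj_rel[of a b K] stab_elem_conj_rel[of c d L] by (simp only: k(1) l(1))
qed

section \<open>The table is a basis\<close>

lemma sum_std: "(\<Sum>L\<in>std ` set keys22. h L) = (\<Sum>k\<in>set keys22. h (std k))"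
proof -
  have "inj_on std (set keys22)" by (rule inj_on_inverseI) (rule key_of_std)
  then show ?thesis by (simp add: sum.reindex)
qed

lemma stab_elem_sum:
  "(\<Sum>L\<in>std ` set keys22. A_smult (c L) (stab_elem L)) =
    (\<Sum>k\<in>set keys22. A_smult (c (std k)) (elem_of (table k)))"
  unfolding sum_std by (intro sum.cong refl) (simp add: stab_elem_std)

text \<open>\<open>36\<close> times the coefficient functions of the table, found by inverting it.\<close>

fun dual :: "'a::comm_ring_1 coords \<Rightarrow> key \<Rightarrow> 'a"
  where "dual (Coords (V3 x1 x2 x3) (V3 x4 x5 x6) (V3 x7 x8 x9) (V3 x10 x11 x12) (V3 x13 x14 x15)
      x16 x17 x18 x19 (V3 x20 x21 x22)) k =
    (if k = Key False False False False False False then - (9 * x19) + 9 * x20 + 18 * x21 + 180 * x22 else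
     if k = Key False False False True False False then 12 * x11 - 12 * x17 + 3 * x19 - 3 * x20 - 6 * x21 - 60 * x22 else
     if k = Key False False False False True False then 6 * x14 - 12 * x18 + 3 * x19 - 3 * x20 - 6 * x21 - 60 * x22 else
     if k = Key False False False True True True then 4 * x5 - 4 * x11 - 2 * x14 - 4 * x16 + 4 * x17 + 4 * x18 - 3 * x19 + 3 * x20 + 2 * x21 + 20 * x22 else
     if k = Key True False False False False False then 18 * x12 - 18 * x21 - 198 * x22 else
     if k = Key True False False True False False then 6 * x10 - 6 * x11 - 6 * x12 + 6 * x17 + 6 * x21 + 66 * x22 else
     if k = Key True False False False True False then 6 * x8 - 6 * x12 - 6 * x14 + 6 * x18 + 6 * x21 + 66 * x22 else
     if k = Key True False False True True True then 2 * x2 - 2 * x5 - 2 * x8 - 2 * x10 + 2 * x11 + 2 * x12 + 2 * x14 + 2 * x16 - 2 * x17 - 2 * x18 - 2 * x21 - 22 * x22 else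
     if k = Key False True False False False False then 9 * x15 - 18 * x21 - 198 * x22 else
     if k = Key False True False True False False then 6 * x6 - 12 * x11 - 3 * x15 + 6 * x17 + 6 * x21 + 66 * x22 else
     if k = Key False True False False True False then 3 * x13 - 3 * x14 - 3 * x15 + 6 * x18 + 6 * x21 + 66 * x22 else
     if k = Key False True False True True True then 2 * x4 - 2 * x5 - 2 * x6 + 4 * x11 - x13 + x14 + x15 + 2 * x16 - 2 * x17 - 2 * x18 - 2 * x21 - 22 * x22 else
     if k = Key False False True False False False then 18 * x22 else
     if k = Key False False True True False False then 6 * x17 - 6 * x22 else
     if k = Key False False True False True False then 6 * x18 - 6 * x22 else
     if k = Key False False True True True True then 2 * x16 - 2 * x17 - 2 * x18 - 2 * x20 + 2 * x22 else
     if k = Key True True True False False False then 9 * x9 - 18 * x12 - 9 * x15 - 9 * x20 + 18 * x21 + 198 * x22 else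
     if k = Key True True True True False False then 3 * x3 - 3 * x6 - 3 * x9 - 6 * x10 + 6 * x11 + 6 * x12 + 3 * x15 - 6 * x17 + 3 * x20 - 6 * x21 - 66 * x22 else
     if k = Key True True True False True False then 3 * x7 - 3 * x8 - 3 * x9 + 6 * x12 - 3 * x13 + 3 * x14 + 3 * x15 - 6 * x18 + 3 * x20 - 6 * x21 - 66 * x22 else
     if k = Key True True True True True True then x1 - x2 - x3 - x4 + x5 + x6 - x7 + x8 + x9 + 2 * x10 - 2 * x11 - 2 * x12 + x13 - x14 - x15 - 2 * x16 + 2 * x17 + 2 * x18 - x20 + 2 * x21 + 22 * x22 else
     if k = Key False False False False False True then 6 * x19 - 6 * x20 else
     if k = Key False False True False False True then 6 * x20 else 0)"

lemma dual_linear: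
  "dual (coords_add s t) k = dual s k + dual t k" "dual (coords_scale r t) k = r * dual t k"
  by (cases s rule: coords_cases; cases t rule: coords_cases; simp add: algebra_simps)+

lemma dual_of_int: "dual (map_coords rat_of_int t) k = rat_of_int (dual t k)"
  by (cases t rule: coords_cases) simp

definition dual_row :: "key \<Rightarrow> int list" where "dual_row l = map (dual (table l)) keys22"

definition unit_row :: "key \<Rightarrow> int list" where "unit_row l = map (\<lambda>k. if k = l then 36 else 0) keys22"

lemma dual_row_keys22: "map dual_row keys22 = map unit_row keys22"
  by code_simp

lemma dual_table:
  assumes "k \<in> set keys22" "l \<in> set keys22"
  shows "dual (table l) k = (if k = l then 36 else 0)"
proof -
  have "dual_row l = unit_row l" using dual_row_keys22 assms(2) by (simp only: map_eq_conv)
  then show ?thesis using assms(1) by (simp only: dual_row_def unit_row_def map_eq_conv)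
qed

text \<open>Applying the functional dual to the entry at l isolates 36 times the coefficient
  there.\<close>

lemma table_indep:
  fixes t :: "key \<Rightarrow> rat"
  assumes 0: "(\<Sum>k\<in>set keys22. A_smult (t k) (elem_of (table k))) = 0" and l: "l \<in> set keys22"
  shows "t l = 0"
proof -
  have sum: "dual (coords_of (\<Sum>k\<in>S. A_smult (t k) (elem_of (table k)))) l = (\<Sum>k\<in>S. t k * rat_of_int (dual (table k) l))"
    if "finite S" for S
    using that
    by (induction S rule: finite_induct)
      (simp_all add: coords_of_ring(1,3) dual_linear coords_of_smult_elem_of dual_of_int del: dual.simps, simp)
  have "0 = dual (coords_of (0 :: A_array)) l" by (simp add: coords_of_ring)
  also have "\<dots> = (\<Sum>k\<in>set keys22. t k * rat_of_int (dual (table k) l))"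
    unfolding 0[symmetric] by (rule sum) simp
  also have "\<dots> = (\<Sum>k\<in>set keys22. if k = l then 36 * t l else 0)"
    by (intro sum.cong refl) (simp add: dual_table l)
  also have "\<dots> = 36 * t l" using l by simp
  finally show ?thesis by simp
qed


lemma stab_elem_indep:
  assumes "(\<Sum>L\<in>std ` set keys22. A_smult (c L) (stab_elem L)) = 0" "L \<in> std ` set keys22"
  shows "c L = 0"
  using table_indep[of "\<lambda>k. c (std k)"] assms unfolding stab_elem_sum by blast

text \<open>The dual functionals divided by 36 give the coefficients; the expansion is checked in 22
  indeterminate coordinates.\<close>

lemma stab_elem_spanning: "\<exists>c. x = (\<Sum>L\<in>std ` set keys22. A_smult (c L) (stab_elem L))"
proof -
  have "x = (\<Sum>k\<in>set keys22. A_smult (dual (coords_of x) k / 36) (elem_of (table k)))"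
    unfolding coords_of_inject[symmetric]
    by (cases "coords_of x" rule: coords_cases)
      (simp add: keys22_def coords_of_ring coords_of_smult_elem_of add_divide_distrib diff_divide_distrib)
  \<comment> \<open>The coefficients have to be a function of the subgroup, so the key is read off
    with \<open>key_of\<close>.\<close>
  also have "\<dots> = (\<Sum>k\<in>set keys22. A_smult ((\<lambda>L. dual (coords_of x) (key_of L) / 36) (std k)) (elem_of (table k)))"
    by (intro sum.cong refl) (simp only: key_of_std)
  finally show ?thesis
    unfolding stab_elem_sum by (rule exI[of _ "\<lambda>L. dual (coords_of x) (key_of L) / 36"])
qed

section \<open>The isomorphisms\<close>

interpretation S3: enumerated_group "sym_group 3" s3_perm
  by (intro enumerated_group.intro enumerated_group_axioms.intro sym_group_is_group s3_perm_bij)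
    (simp add: s3_perm_add sym_group_mult)

lemma A_alg_iso_double_burnside: "algebra_iso A_alg (double_burnside (sym_group 3)) \<noteq> {}"
proof (rule S3.double_burnside_iso[where \<tau> = stab_elem and \<L> = "std ` set keys22"])
  show "stab_elem Id = of_nat CARD(s3)"
  proof -
    have "key_of Id = Key False False True False False True"
      by (auto simp: key_of_def has_def)
    moreover have "(of_nat 6 :: A_array) = 1 + 1 + 1 + 1 + 1 + 1" by simp
    then have "coords_of (of_nat 6) = Coords (V3 6 0 0) (V3 0 6 0) (V3 0 0 6) (V3 0 0 0) (V3 0 0 0) 6 0 0 6 (V3 6 0 0)"
      by (simp only: coords_of_ring coords_add.simps v3_add.simps) simp
    ultimately show ?thesis
      unfolding coords_of_inject[symmetric] CARD_s3
      by (simp add: stab_elem_def elem_of_def del: of_nat_numeral)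
  qed
qed (use stab_elem_mackey stab_elem_conj_rel is_subgroup_std subgroup_conj_std stab_elem_indep stab_elem_spanning
    scaled_ring_A assoc_algebra_A_alg in \<open>auto simp del: key_of_def\<close>)

theorem proposition6:
  shows "(\<exists>\<phi> \<in> algebra_iso A'_alg (quotient_algebra QPsi I_Psi).
      \<phi> a11 = I_Psi +>\<^bsub>QPsi\<^esub> trivial_path v11 \<and>
      \<phi> a22 = I_Psi +>\<^bsub>QPsi\<^esub> trivial_path v22 \<and>
      \<phi> a33 = I_Psi +>\<^bsub>QPsi\<^esub> trivial_path v33 \<and>
      \<phi> a44 = I_Psi +>\<^bsub>QPsi\<^esub> trivial_path v44 \<and>
      \<phi> a41 = I_Psi +>\<^bsub>QPsi\<^esub> arrow_path Psi ar_rho \<and>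
      \<phi> a14 = I_Psi +>\<^bsub>QPsi\<^esub> arrow_path Psi ar_pi \<and>
      \<phi> a42 = I_Psi +>\<^bsub>QPsi\<^esub> arrow_path Psi ar_vartheta \<and>
      \<phi> a24 = I_Psi +>\<^bsub>QPsi\<^esub> arrow_path Psi ar_sigma)
    \<and> morita_equivalent TYPE('u) (quotient_algebra QPsi I_Psi) A_alg
    \<and> algebra_iso A_alg (double_burnside (sym_group 3)) \<noteq> {}"
proof (intro conjI morita_equivalent_Psi A_alg_iso_double_burnside)
  obtain \<phi> where \<phi>: "\<phi> \<in> algebra_iso A'_alg (quotient_algebra QPsi I_Psi)"
    "\<And>v. \<phi> (psi_vertex_elem v) = I_Psi +>\<^bsub>QPsi\<^esub> trivial_path v"
    "\<And>a. \<phi> (psi_arrow_elem a) = I_Psi +>\<^bsub>QPsi\<^esub> arrow_path Psi a"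
    by (rule A'_alg_iso, rule that)
  show "\<exists>\<phi>\<in>algebra_iso A'_alg (quotient_algebra QPsi I_Psi).
      \<phi> a11 = I_Psi +>\<^bsub>QPsi\<^esub> trivial_path v11 \<and>
      \<phi> a22 = I_Psi +>\<^bsub>QPsi\<^esub> trivial_path v22 \<and>
      \<phi> a33 = I_Psi +>\<^bsub>QPsi\<^esub> trivial_path v33 \<and>
      \<phi> a44 = I_Psi +>\<^bsub>QPsi\<^esub> trivial_path v44 \<and>
      \<phi> a41 = I_Psi +>\<^bsub>QPsi\<^esub> arrow_path Psi ar_rho \<and>
      \<phi> a14 = I_Psi +>\<^bsub>QPsi\<^esub> arrow_path Psi ar_pi \<and>
      \<phi> a42 = I_Psi +>\<^bsub>QPsi\<^esub> arrow_path Psi ar_vartheta \<and>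
      \<phi> a24 = I_Psi +>\<^bsub>QPsi\<^esub> arrow_path Psi ar_sigma"
    using \<phi>(1) \<phi>(2)[of v11] \<phi>(2)[of v22] \<phi>(2)[of v33] \<phi>(2)[of v44]
      \<phi>(3)[of ar_rho] \<phi>(3)[of ar_pi] \<phi>(3)[of ar_vartheta] \<phi>(3)[of ar_sigma]
    by (intro bexI[of _ \<phi>]) simp_all
qed

end
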